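(* Let $M^2\subset E^3$ be a surface parametrized by coordinates $R^1,R^2$ of curvature lines, with third fundamental form $G_{11}(dR^1)^2+G_{22}(dR^2)^2$ and radii of principal curvature $k^1,k^2$. Suppose there exist a flat metric $g_{11}(dR^1)^2+g_{22}(dR^2)^2$ and functions $\eta_1=\eta_1(R^1)$, $\eta_2=\eta_2(R^2)$ such that $$G_{11}=g_{11}/\eta_1,\qquad G_{22}=g_{22}/\eta_2 .$$ Then for any $\lambda$ the metric $$\frac{g_{11}}{\lambda+\eta_1}(dR^1)^2+\frac{g_{22}}{\lambda+\eta_2}(dR^2)^2$$ has constant Gaussian curvature $1$, and there is (locally) a $1$-parameter family of surfaces $M^2_\lambda\subset E^3$, parametrized by curvature line coordinates $R^1,R^2$, having this metric (which depends on $\lambda$) as third fundamental form and the functions $k^1,k^2$ (which are independent of $\lambda$) as radii of principal curvature. Hence the Weingarten operators of the surfaces $M^2_\lambda$ coincide.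
   Context: The third fundamental form of a surface is the metric of its Gaussian image on the unit sphere; it automatically has constant curvature $1$. The radii of principal curvature $k^1,k^2$ are the reciprocals of the principal curvatures; in curvature line coordinates they satisfy the Peterson–Codazzi equations $\frac{\partial_2k^1}{k^2-k^1}=\partial_2\ln\sqrt{G_{11}}$, $\frac{\partial_1k^2}{k^1-k^2}=\partial_1\ln\sqrt{G_{22}}$, where $\partial_i=\partial/\partial R^i$. The metrics $G$ and $g$ are positive definite, so $\eta_1,\eta_2>0$, and $\lambda$ ranges over values with $\lambda+\eta_1>0$, $\lambda+\eta_2>0$. The Weingarten operators are compared in the coordinates $R^1,R^2$. *)

theory Defs
  imports "HOL-Analysis.Analysis"
begin

text \<open>The following two notions are meant for open \<open>S\<close>: all iterated derivatives
  up to order \<open>k\<close> (respectively of every order) exist and are continuous.\<close>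

primrec Ck_on :: "nat \<Rightarrow> ('a::real_normed_vector \<Rightarrow> 'b::real_normed_vector) \<Rightarrow> 'a set \<Rightarrow> bool"
  where
    "Ck_on 0 f S \<longleftrightarrow> continuous_on S f"
  | "Ck_on (Suc k) f S \<longleftrightarrow> (\<forall>x\<in>S. f differentiable (at x)) \<and>
       (\<forall>v. Ck_on k (\<lambda>x. frechet_derivative f (at x) v) S)"

definition smooth_on :: "('a::real_normed_vector \<Rightarrow> 'b::real_normed_vector) \<Rightarrow> 'a set \<Rightarrow> bool"
  where "smooth_on f S \<longleftrightarrow> (\<forall>k. Ck_on k f S)"

definition partial_deriv :: "2 \<Rightarrow> (real^2 \<Rightarrow> 'b::real_normed_vector) \<Rightarrow> real^2 \<Rightarrow> 'b"
  where "partial_deriv i f p = frechet_derivative f (at p) (axis i 1)"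


subsection \<open>Intrinsic geometry of a metric on a plane domain\<close>

definition diag_metric :: "(real^2 \<Rightarrow> real) \<Rightarrow> (real^2 \<Rightarrow> real) \<Rightarrow> real^2 \<Rightarrow> real^2^2"
  where "diag_metric a b p = vector [vector [a p, 0], vector [0, b p]]"

text \<open>\<open>christoffel g k i j\<close> is $\Gamma^k_{ij}$.\<close>

definition christoffel :: "(real^2 \<Rightarrow> real^2^2) \<Rightarrow> 2 \<Rightarrow> 2 \<Rightarrow> 2 \<Rightarrow> real^2 \<Rightarrow> real"
  where "christoffel g k i j p = (\<Sum>l\<in>UNIV. matrix_inv (g p) $ k $ l *
     (partial_deriv i (\<lambda>q. g q $ j $ l) p + partial_deriv j (\<lambda>q. g q $ i $ l) p
       - partial_deriv l (\<lambda>q. g q $ i $ j) p)) / 2"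

text \<open>\<open>riemann g l k i j\<close> is the \<open>l\<close>-th component of $R(\partial_i,\partial_j)\partial_k$, where
  $R(X,Y) = [\nabla_X,\nabla_Y] - \nabla_{[X,Y]}$. With this sign the unit sphere has
  Gaussian curvature \<open>1\<close>.\<close>

definition riemann :: "(real^2 \<Rightarrow> real^2^2) \<Rightarrow> 2 \<Rightarrow> 2 \<Rightarrow> 2 \<Rightarrow> 2 \<Rightarrow> real^2 \<Rightarrow> real"
  where "riemann g l k i j p =
     partial_deriv i (christoffel g l j k) p - partial_deriv j (christoffel g l i k) p
     + (\<Sum>m\<in>UNIV. christoffel g l i m p * christoffel g m j k p
                  - christoffel g l j m p * christoffel g m i k p)"

definition flat_on :: "(real^2 \<Rightarrow> real^2^2) \<Rightarrow> (real^2) set \<Rightarrow> bool"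
  where "flat_on g U \<longleftrightarrow> (\<forall>p\<in>U. \<forall>l k i j. riemann g l k i j p = 0)"

text \<open>$K = \langle R(\partial_1,\partial_2)\partial_2, \partial_1\rangle / \det g$.\<close>

definition gauss_curvature :: "(real^2 \<Rightarrow> real^2^2) \<Rightarrow> real^2 \<Rightarrow> real"
  where "gauss_curvature g p = (\<Sum>l\<in>UNIV. g p $ 1 $ l * riemann g l 2 1 2 p) / det (g p)"


subsection \<open>Parametrized surfaces in Euclidean 3-space\<close>

definition regular_surface :: "(real^2 \<Rightarrow> real^3) \<Rightarrow> (real^2) set \<Rightarrow> bool"
  where "regular_surface r U \<longleftrightarrow> open U \<and> smooth_on r U \<and>
     (\<forall>p\<in>U. cross3 (partial_deriv 1 r p) (partial_deriv 2 r p) \<noteq> 0)"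

text \<open>The normal is oriented by the coordinates; reversing it changes the sign of the second
  fundamental form, of the Weingarten operator and of both radii of principal curvature.\<close>

definition unit_normal :: "(real^2 \<Rightarrow> real^3) \<Rightarrow> real^2 \<Rightarrow> real^3"
  where "unit_normal r p = sgn (cross3 (partial_deriv 1 r p) (partial_deriv 2 r p))"

definition first_form :: "(real^2 \<Rightarrow> real^3) \<Rightarrow> real^2 \<Rightarrow> real^2^2"
  where "first_form r p = (\<chi> i j. partial_deriv i r p \<bullet> partial_deriv j r p)"

definition second_form :: "(real^2 \<Rightarrow> real^3) \<Rightarrow> real^2 \<Rightarrow> real^2^2"
  where "second_form r p = (\<chi> i j. partial_deriv i (partial_deriv j r) p \<bullet> unit_normal r p)"

definition third_form :: "(real^2 \<Rightarrow> real^3) \<Rightarrow> real^2 \<Rightarrow> real^2^2"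
  where "third_form r p =
     (\<chi> i j. partial_deriv i (unit_normal r) p \<bullet> partial_deriv j (unit_normal r) p)"

text \<open>The matrix, in the coordinate basis of the tangent plane, of the operator sending the
  tangent vector $\partial_j r$ to $-\partial_j n$, with \<open>n\<close> the unit normal.\<close>

definition weingarten :: "(real^2 \<Rightarrow> real^3) \<Rightarrow> real^2 \<Rightarrow> real^2^2"
  where "weingarten r p = matrix_inv (first_form r p) ** second_form r p"

definition curvature_line_coords :: "(real^2 \<Rightarrow> real^3) \<Rightarrow> (real^2) set \<Rightarrow> bool"
  where "curvature_line_coords r U \<longleftrightarrow>
     (\<forall>p\<in>U. \<forall>i j. i \<noteq> j \<longrightarrow> first_form r p $ i $ j = 0 \<and> second_form r p $ i $ j = 0)"

text \<open>The principal curvature of the \<open>i\<close>-th coordinate direction is the corresponding eigenvalue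
  of the Weingarten operator. It has to be nonzero for the radius to exist.\<close>

definition principal_radii ::
    "(real^2 \<Rightarrow> real^3) \<Rightarrow> (real^2) set \<Rightarrow> (real^2 \<Rightarrow> real) \<Rightarrow> (real^2 \<Rightarrow> real) \<Rightarrow> bool"
  where "principal_radii r U k1 k2 \<longleftrightarrow> (\<forall>p\<in>U. k1 p \<noteq> 0 \<and> k2 p \<noteq> 0 \<and>
     weingarten r p *v axis 1 1 = (1 / k1 p) *\<^sub>R axis 1 1 \<and>
     weingarten r p *v axis 2 1 = (1 / k2 p) *\<^sub>R axis 2 1)"


subsection \<open>The deformed metric\<close>

definition admissible :: "(real^2) set \<Rightarrow> (real \<Rightarrow> real) \<Rightarrow> (real \<Rightarrow> real) \<Rightarrow> real set"
  where "admissible U \<eta>1 \<eta>2 = {\<mu>. \<forall>p\<in>U. 0 < \<mu> + \<eta>1 (p $ 1) \<and> 0 < \<mu> + \<eta>2 (p $ 2)}"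

definition deformed_metric ::
    "(real^2 \<Rightarrow> real) \<Rightarrow> (real^2 \<Rightarrow> real) \<Rightarrow> (real \<Rightarrow> real) \<Rightarrow> (real \<Rightarrow> real) \<Rightarrow> real \<Rightarrow> real^2 \<Rightarrow> real^2^2"
  where "deformed_metric g11 g22 \<eta>1 \<eta>2 \<mu> =
     diag_metric (\<lambda>p. g11 p / (\<mu> + \<eta>1 (p $ 1))) (\<lambda>p. g22 p / (\<mu> + \<eta>2 (p $ 2)))"

end

theory Submission
  imports Defs
begin

text \<open>Let \<open>h1, h2\<close> be the square roots of the coefficients of an orthogonal metric. Its Gaussian
  curvature is governed by the rotation coefficients \<open>a = (d2 h1) / h2\<close> and \<open>b = (d1 h2) / h1\<close>:
  the metric is flat iff \<open>d1 b + d2 a = 0\<close>, and has curvature 1 iff \<open>d1 b + d2 a + h1 h2 = 0\<close>.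
  Dividing \<open>g11\<close> by \<open>\<mu> + \<eta>1(R1)\<close> and \<open>g22\<close> by \<open>\<mu> + \<eta>2(R2)\<close> multiplies \<open>a\<close> and \<open>b\<close> by reciprocal
  ratios of square roots, because \<open>\<eta>1\<close> does not depend on \<open>R2\<close> nor \<open>\<eta>2\<close> on \<open>R1\<close>. After
  multiplication by both square roots the left side of the second condition is therefore affine
  in \<open>\<mu>\<close>, and the coefficient of \<open>\<mu>\<close> is the left side of the first condition for \<open>g\<close>
  (\<open>gauss_defect_deform\<close>). It vanishes since \<open>g\<close> is flat. The constant term vanishes since at
  \<open>\<mu> = 0\<close> the metric is the third fundamental form of the given surface, that is, the metric of
  its Gauss image on the unit sphere (\<open>frame_gauss\<close>). So all the deformed metrics have curvature 1.

  The Peterson-Codazzi equations contain the metric only through \<open>d2 (ln h1)\<close> and \<open>d1 (ln h2)\<close>, which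
  the deformation does not change. So for every \<open>\<mu>\<close> the pair of deformed metric and old radii
  satisfies the integrability conditions of the linear system for an orthonormal frame
  \<open>e1, e2, n\<close> and a position vector \<open>s\<close> with \<open>di n = hi ei\<close> and \<open>di s = - ki hi ei\<close>
  (\<open>frame_act_integrable\<close>). A solution is the required surface (\<open>surface_of_frame\<close>), and equal
  radii in the same coordinates give equal Weingarten matrices.

  It remains to solve an integrable linear system, smoothly also in \<open>\<mu>\<close> (\<open>frobenius_linear\<close>).
  Along the rays from \<open>p0\<close> it is a linear ordinary differential equation, which is solved by the
  Picard series. The solution depends smoothly on parameters because each of its
  derivatives solves an equation of the same form (\<open>fam_Ck_volterra_solution\<close>). By integrability,
  the defect of the system along the rays solves a homogeneous equation with zero initial value.\<close>

section \<open>Smooth functions, with and without a time parameter\<close>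

text \<open>For a linear differential equation with time \<open>t\<close> and parameters \<open>x\<close>. Only \<open>x\<close> is differentiated, but
  integration over \<open>t\<close> needs joint continuity. It is demanded at every order, since differentiability
  in \<open>x\<close> at each time does not imply it.\<close>

primrec fam_Ck ::
    "nat \<Rightarrow> real set \<Rightarrow> (real \<Rightarrow> 'a::real_normed_vector \<Rightarrow> 'b::real_normed_vector) \<Rightarrow> 'a set \<Rightarrow> bool"
  where
    "fam_Ck 0 T f S \<longleftrightarrow> continuous_on (T \<times> S) (\<lambda>(t, x). f t x)"
  | "fam_Ck (Suc k) T f S \<longleftrightarrow> continuous_on (T \<times> S) (\<lambda>(t, x). f t x) \<and>
       (\<forall>t\<in>T. \<forall>x\<in>S. f t differentiable (at x)) \<and>
       (\<forall>v. fam_Ck k T (\<lambda>t x. frechet_derivative (f t) (at x) v) S)"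

lemma fam_Ck_cont: "fam_Ck k T f S \<Longrightarrow> continuous_on (T \<times> S) (\<lambda>(t, x). f t x)"
  by (cases k) auto

lemma fam_Ck_has_derivative:
  "fam_Ck (Suc k) T f S \<Longrightarrow> t \<in> T \<Longrightarrow> x \<in> S \<Longrightarrow>
     (f t has_derivative frechet_derivative (f t) (at x)) (at x)"
  by (simp add: frechet_derivative_works)

lemma fam_Ck_derivative:
  "fam_Ck (Suc k) T f S \<Longrightarrow> fam_Ck k T (\<lambda>t x. frechet_derivative (f t) (at x) v) S"
  by simp

lemma fam_Ck_Suc_imp: "fam_Ck (Suc k) T f S \<Longrightarrow> fam_Ck k T f S"
  by (induction k arbitrary: f) auto

lemma fam_Ck_mono: "fam_Ck k T f S \<Longrightarrow> j \<le> k \<Longrightarrow> fam_Ck j T f S"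
proof (induction k)
  case 0
  then show ?case by simp
next
  case (Suc k)
  then show ?case
    using fam_Ck_Suc_imp le_Suc_eq by metis
qed

lemma fam_Ck_cong:
  assumes "open S" and "\<And>t x. t \<in> T \<Longrightarrow> x \<in> S \<Longrightarrow> f t x = g t x"
  shows "fam_Ck k T f S \<longleftrightarrow> fam_Ck k T g S"
  using assms(2)
proof (induction k arbitrary: f g)
  case 0
  then show ?case
    by (auto intro!: continuous_on_cong)
next
  case (Suc k)
  have der: "(f t has_derivative d) (at x) \<longleftrightarrow> (g t has_derivative d) (at x)"
    if "t \<in> T" "x \<in> S" for t x d
    using has_derivative_transform_within_open[OF _ assms(1) that(2)] Suc.prems that(1)
    by metis
  have "continuous_on (T \<times> S) (\<lambda>(t, x). f t x) = continuous_on (T \<times> S) (\<lambda>(t, x). g t x)"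
    using Suc.prems by (auto intro!: continuous_on_cong)
  moreover have "f t differentiable at x \<longleftrightarrow> g t differentiable at x"
    if "t \<in> T" "x \<in> S" for t x
    using der[OF that] by (simp add: differentiable_def)
  moreover have "fam_Ck k T (\<lambda>t x. frechet_derivative (f t) (at x) v) S \<longleftrightarrow>
      fam_Ck k T (\<lambda>t x. frechet_derivative (g t) (at x) v) S" for v
    by (rule Suc.IH) (simp add: frechet_derivative_def der)
  ultimately show ?case
    by auto
qed

lemma fam_Ck_SucI:
  assumes "open S"
    and "continuous_on (T \<times> S) (\<lambda>(t, x). f t x)"
    and D: "\<And>t x. t \<in> T \<Longrightarrow> x \<in> S \<Longrightarrow> (f t has_derivative f' t x) (at x)"
    and "\<And>v. fam_Ck k T (\<lambda>t x. f' t x v) S"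
  shows "fam_Ck (Suc k) T f S"
proof -
  have "frechet_derivative (f t) (at x) = f' t x" if "t \<in> T" "x \<in> S" for t x
    using frechet_derivative_at[OF D[OF that]] by simp
  then have "fam_Ck k T (\<lambda>t x. frechet_derivative (f t) (at x) v) S" for v
    using assms(4)[of v] fam_Ck_cong[OF assms(1)] by (smt (verit, best))
  then show ?thesis
    using assms by (auto simp: differentiable_def)
qed

lemma fam_Ck_time:
  fixes c :: "real \<Rightarrow> 'b::real_normed_vector"
  shows "continuous_on T c \<Longrightarrow> open S \<Longrightarrow> fam_Ck k T (\<lambda>t x. c t) S"
proof (induction k arbitrary: c)
  case 0
  then show ?case
    by (auto simp: split_beta intro!: continuous_on_compose2[of T c] continuous_intros)
next
  case (Suc k)
  have "fam_Ck k T (\<lambda>t x. 0::'b) S"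
    by (rule Suc.IH) (use Suc.prems in auto)
  then show ?case
    using Suc.prems
    by (intro fam_Ck_SucI[where f'="\<lambda>t x v. 0"])
      (auto simp: split_beta intro!: continuous_on_compose2[of T c] continuous_intros)
qed

lemma fam_Ck_const: "open S \<Longrightarrow> fam_Ck k T (\<lambda>t x. c) S"
  by (rule fam_Ck_time) auto

lemma fam_Ck_linear:
  assumes L: "bounded_linear L" and f: "fam_Ck k T f S" and S: "open S"
  shows "fam_Ck k T (\<lambda>t x. L (f t x)) S"
  using f
proof (induction k arbitrary: f)
  case 0
  then show ?case
    using bounded_linear.continuous_on[OF L] by (force simp: split_beta)
next
  case (Suc k)
  show ?case
  proof (rule fam_Ck_SucI[OF S])
    show "continuous_on (T \<times> S) (\<lambda>(t, x). L (f t x))"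
      using bounded_linear.continuous_on[OF L fam_Ck_cont[OF Suc.prems]] by (simp add: split_beta)
    show "((\<lambda>x. L (f t x)) has_derivative (\<lambda>v. L (frechet_derivative (f t) (at x) v))) (at x)"
      if "t \<in> T" "x \<in> S" for t x
      using bounded_linear.has_derivative[OF L fam_Ck_has_derivative[OF Suc.prems that]] .
    show "fam_Ck k T (\<lambda>t x. L (frechet_derivative (f t) (at x) v)) S" for v
      using Suc by auto
  qed
qed

lemma fam_Ck_id: "open S \<Longrightarrow> fam_Ck k T (\<lambda>t x. x) S"
proof (cases k)
  case 0
  then show ?thesis by (auto simp: split_beta intro!: continuous_intros)
next
  case (Suc j)
  assume "open S"
  have "fam_Ck (Suc j) T (\<lambda>t x. x) S"
    by (rule fam_Ck_SucI[where f'="\<lambda>t x v. v"])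
      (use \<open>open S\<close> in \<open>auto simp: split_beta intro!: continuous_intros fam_Ck_const\<close>)
  then show ?thesis using Suc by simp
qed

lemma fam_Ck_add:
  assumes "fam_Ck k T f S" "fam_Ck k T g S" and S: "open S"
  shows "fam_Ck k T (\<lambda>t x. f t x + g t x) S"
  using assms(1,2)
proof (induction k arbitrary: f g)
  case 0
  then show ?case
    by (auto simp: split_beta intro!: continuous_intros)
next
  case (Suc k)
  show ?case
  proof (rule fam_Ck_SucI[OF S])
    show "continuous_on (T \<times> S) (\<lambda>(t, x). f t x + g t x)"
      using Suc.prems[THEN fam_Ck_cont] by (auto simp: split_beta intro!: continuous_intros)
    show "((\<lambda>x. f t x + g t x) has_derivative
        (\<lambda>v. frechet_derivative (f t) (at x) v + frechet_derivative (g t) (at x) v)) (at x)"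
      if "t \<in> T" "x \<in> S" for t x
      by (intro has_derivative_add fam_Ck_has_derivative[OF Suc.prems(1) that]
          fam_Ck_has_derivative[OF Suc.prems(2) that])
    show "fam_Ck k T (\<lambda>t x. frechet_derivative (f t) (at x) v + frechet_derivative (g t) (at x) v) S"
      for v
      using Suc by auto
  qed
qed

lemma fam_Ck_sum:
  assumes "finite I" "\<And>i. i \<in> I \<Longrightarrow> fam_Ck k T (f i) S" "open S"
  shows "fam_Ck k T (\<lambda>t x. \<Sum>i\<in>I. f i t x) S"
  using assms
proof (induction I rule: finite_induct)
  case empty
  then show ?case by (simp add: fam_Ck_const)
next
  case (insert i I)
  then show ?case by (simp add: fam_Ck_add)
qed

lemma fam_Ck_bilinear:
  assumes B: "bounded_bilinear B" and "fam_Ck k T f S" "fam_Ck k T g S" and S: "open S"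
  shows "fam_Ck k T (\<lambda>t x. B (f t x) (g t x)) S"
  using assms(2,3)
proof (induction k arbitrary: f g)
  case 0
  then show ?case
    using bounded_bilinear.continuous_on[OF B] by (force simp: split_beta)
next
  case (Suc k)
  show ?case
  proof (rule fam_Ck_SucI[OF S])
    show "continuous_on (T \<times> S) (\<lambda>(t, x). B (f t x) (g t x))"
      using bounded_bilinear.continuous_on[OF B Suc.prems[THEN fam_Ck_cont]]
      by (simp add: split_beta)
    show "((\<lambda>x. B (f t x) (g t x)) has_derivative
        (\<lambda>v. B (f t x) (frechet_derivative (g t) (at x) v)
           + B (frechet_derivative (f t) (at x) v) (g t x))) (at x)"
      if "t \<in> T" "x \<in> S" for t x
      by (intro bounded_bilinear.FDERIV[OF B] fam_Ck_has_derivative[OF Suc.prems(1) that]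
          fam_Ck_has_derivative[OF Suc.prems(2) that])
    show "fam_Ck k T (\<lambda>t x. B (f t x) (frechet_derivative (g t) (at x) v)
           + B (frechet_derivative (f t) (at x) v) (g t x)) S" for v
      by (intro fam_Ck_add Suc.IH S fam_Ck_derivative Suc.prems Suc.prems[THEN fam_Ck_Suc_imp])
  qed
qed

text \<open>With a single instant of time the rules for families become rules for \<open>Ck_on\<close>.\<close>

lemma Ck_on_iff_fam: "Ck_on k f S \<longleftrightarrow> fam_Ck k {0} (\<lambda>_. f) S"
proof (induction k arbitrary: f)
  case 0
  have "continuous_on S f" if "continuous_on ({0::real} \<times> S) (\<lambda>(t, x). f x)"
    using continuous_on_compose2[OF that, of S "\<lambda>x. (0, x)"]
    by (force intro: continuous_intros)
  moreover have "continuous_on ({0::real} \<times> S) (\<lambda>(t, x). f x)" if "continuous_on S f"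
    by (auto simp: split_beta intro!: continuous_on_compose2[OF that] continuous_intros)
  ultimately show ?case by auto
next
  case (Suc k)
  have "continuous_on ({0::real} \<times> S) (\<lambda>(t, x). f x)" if "\<forall>x\<in>S. f differentiable at x"
  proof -
    have "continuous_on S f"
      using that by (meson differentiable_imp_continuous_within continuous_at_imp_continuous_on)
    then show ?thesis
      by (auto simp: split_beta intro!: continuous_on_compose2[of S f] continuous_intros)
  qed
  then show ?case
    using Suc by auto
qed

lemma fam_Ck_slice: "fam_Ck k T f S \<Longrightarrow> t \<in> T \<Longrightarrow> Ck_on k (f t) S"
proof (induction k arbitrary: f)
  case 0
  then have "continuous_on S (\<lambda>x. (\<lambda>(t, x). f t x) (t, x))"
    by (intro continuous_on_compose2[of "T \<times> S" "\<lambda>(t, x). f t x" S "\<lambda>x. (t, x)"])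
      (auto intro!: continuous_intros)
  then show ?case by simp
qed auto

text \<open>The chain rule is expanded in a basis: the derivative is then a finite sum of products of a
  derivative of \<open>g\<close> with a directional derivative of \<open>f\<close> composed with \<open>g\<close>, and the induction
  hypothesis applies to the latter.\<close>

lemma fam_Ck_compose:
  fixes f :: "'a::euclidean_space \<Rightarrow> 'b::real_normed_vector"
  assumes "Ck_on k f S" "fam_Ck k T g W"
    and W: "open W" and gS: "\<And>t x. t \<in> T \<Longrightarrow> x \<in> W \<Longrightarrow> g t x \<in> S"
  shows "fam_Ck k T (\<lambda>t x. f (g t x)) W"
  using assms(1,2)
proof (induction k arbitrary: f)
  case 0
  then show ?case
    using gS by (auto simp: split_beta intro!: continuous_on_compose2[of S f])
next
  case (Suc k)
  have f: "continuous_on S f" "\<And>x. x \<in> S \<Longrightarrow> (f has_derivative frechet_derivative f (at x)) (at x)"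
    using Suc.prems(1)
    by (auto simp flip: frechet_derivative_works
        intro!: continuous_at_imp_continuous_on dest: differentiable_imp_continuous_within)
  show ?case
  proof (rule fam_Ck_SucI[OF W])
    show "continuous_on (T \<times> W) (\<lambda>(t, x). f (g t x))"
      using fam_Ck_cont[OF Suc.prems(2)] gS f(1)
      by (auto simp: split_beta intro!: continuous_on_compose2[of S f])
    show "((\<lambda>x. f (g t x)) has_derivative
        (\<lambda>v. \<Sum>i\<in>Basis. (frechet_derivative (g t) (at x) v \<bullet> i) *\<^sub>R
           frechet_derivative f (at (g t x)) i)) (at x)"
      if tx: "t \<in> T" "x \<in> W" for t x
    proof -
      have "((\<lambda>x. f (g t x)) has_derivative
          (\<lambda>v. frechet_derivative f (at (g t x)) (frechet_derivative (g t) (at x) v))) (at x)"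
        using has_derivative_compose[OF fam_Ck_has_derivative[OF Suc.prems(2) tx] f(2)[OF gS[OF tx]]] .
      moreover have "frechet_derivative f (at (g t x)) w =
          (\<Sum>i\<in>Basis. (w \<bullet> i) *\<^sub>R frechet_derivative f (at (g t x)) i)" for w
      proof -
        have "linear (frechet_derivative f (at (g t x)))"
          using f(2)[OF gS[OF tx]] has_derivative_linear by blast
        from linear_sum[OF this, of "\<lambda>i. (w \<bullet> i) *\<^sub>R i" Basis] linear_scale[OF this]
        show ?thesis by (simp add: euclidean_representation)
      qed
      ultimately show ?thesis
        by (rule has_derivative_eq_rhs[OF _ ext])
    qed
    show "fam_Ck k T (\<lambda>t x. \<Sum>i\<in>Basis. (frechet_derivative (g t) (at x) v \<bullet> i) *\<^sub>R
           frechet_derivative f (at (g t x)) i) W" for v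
    proof (intro fam_Ck_sum fam_Ck_bilinear[OF bounded_bilinear_scaleR] W finite_Basis)
      fix i :: 'a assume "i \<in> Basis"
      show "fam_Ck k T (\<lambda>t x. frechet_derivative (g t) (at x) v \<bullet> i) W"
        using fam_Ck_linear[OF bounded_linear_inner_left fam_Ck_derivative[OF Suc.prems(2)] W] .
      show "fam_Ck k T (\<lambda>t x. frechet_derivative f (at (g t x)) i) W"
        using Suc.IH[of "\<lambda>y. frechet_derivative f (at y) i"] Suc.prems fam_Ck_Suc_imp
        by (auto simp del: fam_Ck.simps)
    qed
  qed
qed

lemma smooth_on_iff_fam: "smooth_on f S \<longleftrightarrow> (\<forall>k. fam_Ck k {0} (\<lambda>_. f) S)"
  by (simp add: smooth_on_def Ck_on_iff_fam)

lemma smooth_on_subset: 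
  assumes "smooth_on f S" "T \<subseteq> S" shows "smooth_on f T"
proof -
  have "Ck_on k f T" if "Ck_on k f S" for k using that 
  proof (induction k arbitrary: f)
    case 0
    then show ?case using assms(2) by (auto intro: continuous_on_subset)
  next
    case (Suc k)
    then show ?case using assms(2) by auto
  qed
  then show ?thesis using assms by (auto simp: smooth_on_def)
qed

lemma smooth_on_cong:
  "open S \<Longrightarrow> (\<And>x. x \<in> S \<Longrightarrow> f x = g x) \<Longrightarrow> smooth_on f S \<longleftrightarrow> smooth_on g S"
  using fam_Ck_cong[of S "{0}" "\<lambda>_. f" "\<lambda>_. g"] by (simp add: smooth_on_iff_fam)

lemma smooth_on_has_derivative:
  "smooth_on f S \<Longrightarrow> x \<in> S \<Longrightarrow> (f has_derivative frechet_derivative f (at x)) (at x)"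
  unfolding smooth_on_def by (metis Ck_on.simps(2) frechet_derivative_works)

lemma smooth_on_continuous: "smooth_on f S \<Longrightarrow> continuous_on S f"
  unfolding smooth_on_def by (metis Ck_on.simps(1))

lemma smooth_on_derivative:
  "smooth_on f S \<Longrightarrow> smooth_on (\<lambda>x. frechet_derivative f (at x) v) S"
  unfolding smooth_on_def by (metis Ck_on.simps(2))

lemma smooth_on_partial_deriv: "smooth_on f S \<Longrightarrow> smooth_on (partial_deriv i f) S"
  using smooth_on_derivative[of f S "axis i 1"] by (simp add: partial_deriv_def[abs_def])

lemma smooth_on_const: "open S \<Longrightarrow> smooth_on (\<lambda>x. c) S"
  by (simp add: smooth_on_iff_fam fam_Ck_const)

lemma smooth_on_linear: "bounded_linear L \<Longrightarrow> smooth_on f S \<Longrightarrow> open S \<Longrightarrow> smooth_on (\<lambda>x. L (f x)) S"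
  using fam_Ck_linear[of L _ "{0}" "\<lambda>_. f" S] unfolding smooth_on_iff_fam by blast

lemma smooth_on_id: "open S \<Longrightarrow> smooth_on (\<lambda>x. x) S"
  by (simp add: smooth_on_iff_fam fam_Ck_id)

lemma smooth_on_add:
  "smooth_on f S \<Longrightarrow> smooth_on g S \<Longrightarrow> open S \<Longrightarrow> smooth_on (\<lambda>x. f x + g x) S"
  by (simp add: smooth_on_iff_fam fam_Ck_add)

lemma smooth_on_bilinear:
  "bounded_bilinear B \<Longrightarrow> smooth_on f S \<Longrightarrow> smooth_on g S \<Longrightarrow> open S \<Longrightarrow>
     smooth_on (\<lambda>x. B (f x) (g x)) S"
  using fam_Ck_bilinear[of B _ "{0}" "\<lambda>_. f" S "\<lambda>_. g"] unfolding smooth_on_iff_fam by blast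

lemmas smooth_on_mult = smooth_on_bilinear[OF bounded_bilinear_mult]
lemmas smooth_on_inner = smooth_on_bilinear[OF bounded_bilinear_inner]
lemmas smooth_on_scaleR = smooth_on_bilinear[OF bounded_bilinear_scaleR]
lemmas smooth_on_minus = smooth_on_linear[OF bounded_linear_minus[OF bounded_linear_ident]]

lemma smooth_on_compose:
  fixes f :: "'a::euclidean_space \<Rightarrow> 'b::real_normed_vector"
  assumes "smooth_on f S" "smooth_on g W" "open W" "\<And>x. x \<in> W \<Longrightarrow> g x \<in> S"
  shows "smooth_on (\<lambda>x. f (g x)) W"
  unfolding smooth_on_iff_fam
proof
  fix k
  have "Ck_on k f S" "fam_Ck k {0} (\<lambda>_. g) W"
    using assms(1,2) unfolding smooth_on_def by (simp_all flip: Ck_on_iff_fam)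
  from fam_Ck_compose[OF this assms(3)] show "fam_Ck k {0} (\<lambda>_ x. f (g x)) W"
    using assms(4) by blast
qed

lemma smooth_on_Pair:
  fixes f :: "'a::real_normed_vector \<Rightarrow> 'b::real_normed_vector" and g :: "'a \<Rightarrow> 'c::real_normed_vector"
  assumes "smooth_on f S" "smooth_on g S" "open S"
  shows "smooth_on (\<lambda>x. (f x, g x)) S"
proof -
  have "bounded_linear (\<lambda>x::'b. (x, 0::'c))" "bounded_linear (\<lambda>y::'c. (0::'b, y))"
    by (auto intro!: bounded_linear_Pair bounded_linear_ident bounded_linear_zero)
  from smooth_on_add[OF smooth_on_linear[OF this(1) assms(1,3)] smooth_on_linear[OF this(2) assms(2,3)] assms(3)]
  show ?thesis by simp
qed

lemma smooth_on_powr: "smooth_on (\<lambda>x::real. x powr a) {0<..}"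
proof -
  \<comment> \<open>With arbitrary coefficient and exponent the class is closed under differentiation.\<close>
  have "Ck_on k (\<lambda>x::real. c * x powr a) {0<..}" for k c
  proof (induction k arbitrary: a c)
    case 0
    show ?case by (auto intro!: continuous_intros)
  next
    case (Suc k)
    have der: "((\<lambda>x::real. c * x powr a) has_derivative (\<lambda>v. (v * c * a) * x powr (a - 1))) (at x)"
      if "x > 0" for x
      using that by (auto intro!: derivative_eq_intros simp: powr_diff field_simps)
    have "fam_Ck (Suc k) {0} (\<lambda>_ x::real. c * x powr a) {0<..}"
    proof (rule fam_Ck_SucI)
      show "continuous_on ({0::real} \<times> {0<..}) (\<lambda>(t, x::real). c * x powr a)"
        by (auto simp: split_beta intro!: continuous_intros)
      show "fam_Ck k {0} (\<lambda>_ x::real. (v * c * a) * x powr (a - 1)) {0<..}" for v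
        using Suc.IH[of "v * c * a" "a - 1"] by (simp add: Ck_on_iff_fam)
    qed (use der in auto)
    then show ?case by (simp add: Ck_on_iff_fam)
  qed
  then have "Ck_on k (\<lambda>x::real. 1 * x powr a) {0<..}" for k .
  then show ?thesis
    by (simp add: smooth_on_def)
qed

lemma smooth_on_inverse:
  fixes f :: "'a::real_normed_vector \<Rightarrow> real"
  assumes "smooth_on f S" "open S" "\<And>x. x \<in> S \<Longrightarrow> f x \<noteq> 0"
  shows "smooth_on (\<lambda>x. inverse (f x)) S"
proof -
  \<comment> \<open>A power with real exponent needs a positive base, so \<open>1/f\<close> is written as \<open>f\<close> times \<open>1/f^2\<close>.\<close>
  have pos: "0 < f x * f x" if "x \<in> S" for x
    using assms(3)[OF that] not_real_square_gt_zero by blast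
  have "smooth_on (\<lambda>x. (f x * f x) powr (-1)) S"
    by (rule smooth_on_compose[OF smooth_on_powr smooth_on_mult[OF assms(1,1,2)] assms(2)])
      (simp add: pos)
  from smooth_on_mult[OF assms(1) this assms(2)]
  have "smooth_on (\<lambda>x. f x * (f x * f x) powr - 1) S" .
  moreover have "f x * (f x * f x) powr - 1 = inverse (f x)" if "x \<in> S" for x
    using pos[OF that] assms(3)[OF that] by (simp add: powr_minus field_simps)
  ultimately show ?thesis
    using smooth_on_cong[OF assms(2), of "\<lambda>x. f x * (f x * f x) powr - 1" "\<lambda>x. inverse (f x)"] by blast
qed

lemma smooth_on_divide:
  fixes f g :: "'a::real_normed_vector \<Rightarrow> real"
  assumes "smooth_on f S" "smooth_on g S" "open S" "\<And>x. x \<in> S \<Longrightarrow> g x \<noteq> 0"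
  shows "smooth_on (\<lambda>x. f x / g x) S"
  using smooth_on_mult[OF assms(1) smooth_on_inverse[OF assms(2-4)] assms(3)]
  by (simp add: divide_inverse)

lemma smooth_on_sqrt:
  fixes f :: "'a::real_normed_vector \<Rightarrow> real"
  assumes "smooth_on f S" "open S" "\<And>x. x \<in> S \<Longrightarrow> f x > 0"
  shows "smooth_on (\<lambda>x. sqrt (f x)) S"
proof -
  have "smooth_on (\<lambda>x. f x powr (1/2)) S"
    by (rule smooth_on_compose[OF smooth_on_powr assms(1,2)]) (use assms in auto)
  then show ?thesis
    using smooth_on_cong[OF assms(2), of "\<lambda>x. f x powr (1/2)" "\<lambda>x. sqrt (f x)"] assms(3)
    by (simp add: powr_half_sqrt less_imp_le)
qed

section \<open>Integration in time\<close>

text \<open>The integral of \<open>f s x\<close> over \<open>s\<close> from 0 to \<open>t\<close>. After the substitution \<open>s = u * t\<close> the domain of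
  integration is fixed, so that theorems on integrals with parameters apply to \<open>t\<close> and \<open>x\<close> alike.\<close>

definition volterra :: "(real \<Rightarrow> 'a \<Rightarrow> 'b::euclidean_space) \<Rightarrow> real \<Rightarrow> 'a \<Rightarrow> 'b" where
  "volterra f t x = t *\<^sub>R integral {0..1} (\<lambda>u. f (u * t) x)"

lemma unit_mult_mem: "u \<in> {0..1} \<Longrightarrow> t \<in> {0..1} \<Longrightarrow> u * t \<in> {0..(1::real)}"
  by (auto intro: mult_le_one)

lemma fam_continuous_rescale:
  assumes "continuous_on ({0..1::real} \<times> S) (\<lambda>(t, x). f t x)"
  shows "continuous_on (({0..1} \<times> S) \<times> {0..1}) (\<lambda>((t, x), u). f (u * t) x)"
proof -
  have "continuous_on (({0..1} \<times> S) \<times> {0..1}) (\<lambda>p. (\<lambda>(t, x). f t x) (snd p * fst (fst p), snd (fst p)))"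
    by (rule continuous_on_compose2[OF assms], intro continuous_intros)
      (auto intro: mult_le_one)
  then show ?thesis
    by (simp add: split_beta)
qed

lemma fam_continuous_slice:
  assumes "continuous_on ({0..1} \<times> S) (\<lambda>(t, x). f t x)" "x \<in> S"
  shows "continuous_on {0..1::real} (\<lambda>t. f t x)"
proof -
  have "continuous_on {0..1} (\<lambda>t. (\<lambda>(t, x). f t x) (t, x))"
    by (rule continuous_on_compose2[OF assms(1)]) (use assms(2) in \<open>auto intro!: continuous_intros\<close>)
  then show ?thesis
    by simp
qed

lemma continuous_rescale:
  assumes "continuous_on {0..1} f" "t \<in> {0..1}"
  shows "continuous_on {0..1::real} (\<lambda>u. f (u * t))"
  using assms unit_mult_mem by (auto intro!: continuous_on_compose2[OF assms(1)] continuous_intros)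

lemma volterra_eq_antiderivative:
  assumes f: "continuous_on {0..1} (\<lambda>t. f t x)" and t: "t \<in> {0..1}"
    and P: "\<And>t. t \<in> {0..1} \<Longrightarrow> (P has_vector_derivative f t x) (at t within {0..1})"
  shows "volterra f t x = P t - P 0"
proof -
  have "((\<lambda>u. P (u * t)) has_vector_derivative t *\<^sub>R f (u * t) x) (at u within {0..1})"
    if "u \<in> {0..1}" for u
  proof -
    have "((\<lambda>u. u * t) has_vector_derivative t) (at u within {0..1})"
      by (auto intro!: derivative_eq_intros)
    moreover have "(P has_vector_derivative f (u * t) x) (at (u * t) within (\<lambda>u. u * t) ` {0..1})"
      using P[OF unit_mult_mem[OF that t]] unit_mult_mem[OF _ t]
      by (auto intro: has_vector_derivative_within_subset)
    ultimately show ?thesis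
      using vector_diff_chain_within[of "\<lambda>u. u * t" t u "{0..1}" P "f (u * t) x"] by (simp add: o_def)
  qed
  then have "((\<lambda>u. t *\<^sub>R f (u * t) x) has_integral P (1 * t) - P (0 * t)) {0..1}"
    by (intro fundamental_theorem_of_calculus) auto
  then have "integral {0..1} (\<lambda>u. t *\<^sub>R f (u * t) x) = P t - P 0"
    by (metis integral_unique mult_1 mult_zero_left)
  then show ?thesis
    by (simp add: volterra_def)
qed

lemma volterra_has_vector_derivative:
  assumes f: "continuous_on {0..1} (\<lambda>t. f t x)" and t: "t \<in> {0..1}"
  shows "((\<lambda>t. volterra f t x) has_vector_derivative f t x) (at t within {0..1})"
proof -
  let ?P = "\<lambda>t. integral {0..t} (\<lambda>s. f s x)"
  have P: "(?P has_vector_derivative f t x) (at t within {0..1})" if "t \<in> {0..1}" for t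
    using integral_has_vector_derivative[OF f that] .
  have eq: "volterra f s x = ?P s" if "s \<in> {0..1}" for s
    using volterra_eq_antiderivative[of f x s ?P, OF f that P] by simp
  show ?thesis
    by (rule has_vector_derivative_transform[OF t eq P[OF t]])
qed

lemma continuous_volterra:
  assumes "continuous_on ({0..1} \<times> S) (\<lambda>(t, x). f t x)"
  shows "continuous_on ({0..1} \<times> S) (\<lambda>(t, x). volterra f t x)"
proof -
  have "continuous_on (({0..1} \<times> S) \<times> cbox 0 1) (\<lambda>(p, u). f (u * fst p) (snd p))"
    using fam_continuous_rescale[OF assms] by (simp add: split_beta)
  from integral_continuous_on_param[OF this]
  show ?thesis
    by (auto simp: volterra_def split_beta intro!: continuous_intros)
qed

text \<open>Differentiation under the integral sign requires the derivative to be continuous as an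
  operator; in finite dimension this follows from continuity of the directional derivatives.\<close>

lemma volterra_has_derivative:
  fixes f :: "real \<Rightarrow> 'a::euclidean_space \<Rightarrow> 'b::euclidean_space"
  assumes f: "fam_Ck (Suc 0) {0..1} f S" and S: "open S" and t: "t \<in> {0..1}" and x: "x \<in> S"
  shows "(volterra f t has_derivative
      (\<lambda>v. volterra (\<lambda>t x. frechet_derivative (f t) (at x) v) t x)) (at x)"
proof -
  obtain r where r: "r > 0" "ball x r \<subseteq> S"
    using S x open_contains_ball by blast
  define d where "d y u = Blinfun (frechet_derivative (f (u * t)) (at y))" for y u
  have D: "(f s has_derivative frechet_derivative (f s) (at y)) (at y)"
    if "s \<in> {0..1}" "y \<in> S" for s y
    using fam_Ck_has_derivative[OF f that] .
  have d: "blinfun_apply (d y u) = frechet_derivative (f (u * t)) (at y)"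
    if "y \<in> S" "u \<in> {0..1}" for y u
    unfolding d_def
    using bounded_linear_Blinfun_apply D[OF unit_mult_mem[OF that(2) t] that(1)]
      has_derivative_bounded_linear by blast
  have cont: "continuous_on (S \<times> {0..1}) (\<lambda>(y, u). frechet_derivative (f (u * t)) (at y) v)" for v
  proof -
    have "continuous_on ({0..1} \<times> S) (\<lambda>(t, x). frechet_derivative (f t) (at x) v)"
      using f by simp
    then have "continuous_on (S \<times> {0..1})
        (\<lambda>p. (\<lambda>(t, x). frechet_derivative (f t) (at x) v) (snd p * t, fst p))"
      by (rule continuous_on_compose2, intro continuous_intros)
        (use t in \<open>auto intro: mult_le_one\<close>)
    then show ?thesis
      by (simp add: split_beta)
  qed
  have contd: "continuous_on (S \<times> {0..1}) (\<lambda>(y, u). d y u)"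
    unfolding split_beta
  proof (rule continuous_on_blinfun_componentwise)
    fix i :: 'a
    show "continuous_on (S \<times> {0..1}) (\<lambda>p. blinfun_apply (d (fst p) (snd p)) i)"
      by (rule continuous_on_eq[OF cont[of i, unfolded split_beta]]) (auto simp: d)
  qed
  have contf: "continuous_on {0..1} (\<lambda>u. f (u * t) y)" if "y \<in> S" for y
    using continuous_rescale[OF fam_continuous_slice[OF fam_Ck_cont[OF f] that] t] .
  have "((\<lambda>y. integral (cbox 0 1) (\<lambda>u. f (u * t) y)) has_derivative integral (cbox 0 1) (d x))
      (at x within ball x r)"
  proof (rule leibniz_rule)
    show "((\<lambda>y. f (u * t) y) has_derivative blinfun_apply (d y u)) (at y within ball x r)"
      if "y \<in> ball x r" "u \<in> cbox 0 1" for y u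
      using D[OF unit_mult_mem[OF _ t], of u y] that r d[of y u]
      by (auto intro: has_derivative_at_withinI simp: subset_iff)
    show "(\<lambda>u. f (u * t) y) integrable_on cbox 0 1" if "y \<in> ball x r" for y
      using contf[of y] that r by (auto intro!: integrable_continuous_interval)
    show "continuous_on (ball x r \<times> cbox 0 1) (\<lambda>(y, u). d y u)"
      by (rule continuous_on_subset[OF contd]) (use r in auto)
  qed (use r in auto)
  then have "((\<lambda>y. integral {0..1} (\<lambda>u. f (u * t) y)) has_derivative integral {0..1} (d x)) (at x)"
    using r by (simp add: at_within_open[of x "ball x r"])
  then have "(volterra f t has_derivative (\<lambda>v. t *\<^sub>R integral {0..1} (d x) v)) (at x)"
    unfolding volterra_def[abs_def] by (intro derivative_intros)
  moreover have "blinfun_apply (integral {0..1} (d x)) v =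
      integral {0..1} (\<lambda>u. frechet_derivative (f (u * t)) (at x) v)" for v
  proof -
    have "continuous_on {0..1} (\<lambda>u. d x u)"
    proof -
      have "continuous_on {0..1} (\<lambda>u. (\<lambda>(y, u). d y u) (x, u))"
        by (rule continuous_on_compose2[OF contd]) (use x in \<open>auto intro!: continuous_intros\<close>)
      then show ?thesis by simp
    qed
    then have "blinfun_apply (integral {0..1} (d x)) v = integral {0..1} (\<lambda>u. d x u v)"
      by (intro blinfun_apply_integral integrable_continuous_interval)
    also have "\<dots> = integral {0..1} (\<lambda>u. frechet_derivative (f (u * t)) (at x) v)"
      by (rule integral_cong) (simp add: d[OF x])
    finally show ?thesis .
  qed
  ultimately show ?thesis
    by (simp add: volterra_def)
qed

lemma fam_Ck_volterra:
  fixes f :: "real \<Rightarrow> 'a::euclidean_space \<Rightarrow> 'b::euclidean_space"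
  assumes "fam_Ck k {0..1} f S" "open S"
  shows "fam_Ck k {0..1} (volterra f) S"
  using assms(1)
proof (induction k arbitrary: f)
  case 0
  then show ?case using continuous_volterra by auto
next
  case (Suc k)
  show ?case
  proof (rule fam_Ck_SucI[OF assms(2)])
    show "(volterra f t has_derivative
      (\<lambda>v. volterra (\<lambda>t x. frechet_derivative (f t) (at x) v) t x)) (at x)"
      if "t \<in> {0..1}" "x \<in> S" for t x
      using volterra_has_derivative[OF fam_Ck_mono[OF Suc.prems] assms(2) that] by auto
    show "fam_Ck k {0..1} (\<lambda>t x. volterra (\<lambda>t x. frechet_derivative (f t) (at x) v) t x) S" for v
      using Suc by auto
  qed (use continuous_volterra[OF fam_Ck_cont[OF Suc.prems]] in auto)
qed

lemma volterra_cong: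
  assumes "\<And>s. s \<in> {0..1} \<Longrightarrow> f s x = g s x" "t \<in> {0..1}"
  shows "volterra f t x = volterra g t x"
  unfolding volterra_def using assms unit_mult_mem by (auto intro!: integral_cong)

lemma volterra_add:
  assumes "continuous_on {0..1} (\<lambda>t. f t x)" "continuous_on {0..1} (\<lambda>t. g t x)" "t \<in> {0..1}"
  shows "volterra (\<lambda>t x. f t x + g t x) t x = volterra f t x + volterra g t x"
  unfolding volterra_def scaleR_add_right[symmetric]
  by (intro arg_cong[where f="scaleR t"] integral_add integrable_continuous_interval continuous_rescale assms)

lemma volterra_diff:
  assumes "continuous_on {0..1} (\<lambda>t. f t x)" "continuous_on {0..1} (\<lambda>t. g t x)" "t \<in> {0..1}"
  shows "volterra (\<lambda>t x. f t x - g t x) t x = volterra f t x - volterra g t x"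
  unfolding volterra_def scaleR_diff_right[symmetric]
  by (intro arg_cong[where f="scaleR t"] integral_diff integrable_continuous_interval continuous_rescale assms)

text \<open>Integration of \<open>s^n\<close> gains the factor \<open>1 / (n + 1)\<close>, so the Picard series converges like an
  exponential series, however large the coefficients are.\<close>

lemma norm_volterra_le:
  assumes f: "continuous_on {0..1} (\<lambda>t. f t x)" and t: "t \<in> {0..1}"
    and le: "\<And>s. s \<in> {0..1} \<Longrightarrow> norm (f s x) \<le> C * K * ((K * s) ^ n / fact n)"
  shows "norm (volterra f t x) \<le> C * ((K * t) ^ Suc n / fact (Suc n))"
proof -
  have "norm (volterra f t x - 0) \<le> (C * ((K * t) ^ Suc n / fact (Suc n)) - C * ((K * 0) ^ Suc n / fact (Suc n)))"
  proof -
    have "volterra (\<lambda>s x. C * K * ((K * s) ^ n / fact n)) t x =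
        C * ((K * t) ^ Suc n / fact (Suc n)) - C * ((K * 0) ^ Suc n / fact (Suc n))"
    proof (rule volterra_eq_antiderivative[OF _ t])
      show "((\<lambda>t. C * ((K * t) ^ Suc n / fact (Suc n))) has_vector_derivative C * K * ((K * t) ^ n / fact n))
          (at t within {0..1})" for t
        unfolding has_real_derivative_iff_has_vector_derivative[symmetric]
        by (rule derivative_eq_intros refl | simp)+ 
    qed (auto intro!: continuous_intros)
    moreover have "norm (volterra f t x) \<le> volterra (\<lambda>s x. C * K * ((K * s) ^ n / fact n)) t x"
    proof -
      have "norm (integral {0..1} (\<lambda>u. f (u * t) x)) \<le>
          integral {0..1} (\<lambda>u. C * K * ((K * (u * t)) ^ n / fact n))"
        by (intro integral_norm_bound_integral integrable_continuous_interval continuous_rescale[OF f t])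
          (use le unit_mult_mem[OF _ t] in \<open>auto intro!: continuous_intros\<close>)
      then have "t * norm (integral {0..1} (\<lambda>u. f (u * t) x)) \<le>
          t * integral {0..1} (\<lambda>u. C * K * ((K * (u * t)) ^ n / fact n))"
        using t by (intro mult_left_mono) auto
      then show ?thesis
        unfolding volterra_def using t by simp
    qed
    ultimately show ?thesis by simp
  qed
  then show ?thesis by simp
qed

section \<open>Linear Volterra equations with parameters\<close>

lemma frechet_derivative_apply:
  "(f has_derivative f') (at x) \<Longrightarrow> frechet_derivative f (at x) v = f' v"
  by (simp flip: frechet_derivative_at)

lemma fam_C0_suminf:
  fixes f :: "nat \<Rightarrow> real \<Rightarrow> 'a::real_normed_vector \<Rightarrow> 'b::banach"
  assumes f: "\<And>n. fam_Ck 0 T (f n) S"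
    and dom: "\<And>x. x \<in> S \<Longrightarrow> \<exists>N b. open N \<and> x \<in> N \<and> summable b \<and>
                 (\<forall>n. \<forall>t\<in>T. \<forall>y\<in>N. norm (f n t y) \<le> b n)"
  shows "fam_Ck 0 T (\<lambda>t x. \<Sum>n. f n t x) S"
proof -
  have "continuous (at p within T \<times> S) (\<lambda>(t, x). \<Sum>n. f n t x)" if p: "p \<in> T \<times> S" for p
  proof -
    obtain N b where N: "open N" "snd p \<in> N" "summable b"
      and b: "\<And>n t y. t \<in> T \<Longrightarrow> y \<in> N \<Longrightarrow> norm (f n t y) \<le> b n"
      using dom[of "snd p"] p by (auto simp: mem_Times_iff)
    have "uniform_limit (T \<times> (S \<inter> N)) (\<lambda>n q. \<Sum>i<n. f i (fst q) (snd q))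
        (\<lambda>q. \<Sum>i. f i (fst q) (snd q)) sequentially"
      by (rule Weierstrass_m_test[where M=b]) (use b N in auto)
    moreover have "continuous_on (T \<times> (S \<inter> N)) (\<lambda>q. \<Sum>i<n. f i (fst q) (snd q))" for n
    proof (rule continuous_on_sum)
      fix i
      show "continuous_on (T \<times> (S \<inter> N)) (\<lambda>q. f i (fst q) (snd q))"
        using f[of i] by (auto simp: split_beta elim: continuous_on_subset)
    qed
    ultimately have "continuous_on (T \<times> (S \<inter> N)) (\<lambda>q. \<Sum>i. f i (fst q) (snd q))"
      using uniform_limit_theorem[OF always_eventually] by force
    then have "continuous (at p within T \<times> (S \<inter> N)) (\<lambda>q. \<Sum>i. f i (fst q) (snd q))"
      using p N by (auto simp: continuous_on_eq_continuous_within)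
    moreover have "at p within T \<times> (S \<inter> N) = at p within T \<times> S"
      by (rule at_within_nhd[of _ "UNIV \<times> N"]) (use N p in \<open>auto simp: mem_Times_iff open_Times\<close>)
    ultimately show ?thesis
      by (simp add: split_beta')
  qed
  then show ?thesis
    by (simp add: continuous_on_eq_continuous_within)
qed

text \<open>Local majorants suffice, because continuity and differentiability are local.\<close>

lemma fam_C1_suminf:
  fixes f :: "nat \<Rightarrow> real \<Rightarrow> 'a::real_normed_vector \<Rightarrow> 'b::banach"
  assumes f: "\<And>n. fam_Ck (Suc 0) T (f n) S" and S: "open S"
    and dom: "\<And>x. x \<in> S \<Longrightarrow> \<exists>N b. open N \<and> x \<in> N \<and> summable b \<and>
                 (\<forall>n. \<forall>t\<in>T. \<forall>y\<in>N. norm (f n t y) \<le> b n \<and>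
                    (\<forall>h. norm (frechet_derivative (f n t) (at y) h) \<le> b n * norm h))"
  shows "fam_Ck (Suc 0) T (\<lambda>t x. \<Sum>n. f n t x) S"
proof (rule fam_Ck_SucI[OF S])
  have "fam_Ck 0 T (\<lambda>t x. \<Sum>n. f n t x) S"
    by (rule fam_C0_suminf) (use f dom in \<open>auto, meson\<close>)
  then show "continuous_on (T \<times> S) (\<lambda>(t, x). \<Sum>n. f n t x)"
    by simp
  show "fam_Ck 0 T (\<lambda>t x. \<Sum>n. frechet_derivative (f n t) (at x) h) S" for h
  proof (rule fam_C0_suminf)
    show "fam_Ck 0 T (\<lambda>t x. frechet_derivative (f n t) (at x) h) S" for n
      using f[of n] by simp
    fix x assume "x \<in> S"
    from dom[OF this] obtain N b where N: "open N" "x \<in> N" "summable b"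
      and b: "\<And>n t y. t \<in> T \<Longrightarrow> y \<in> N \<Longrightarrow> norm (frechet_derivative (f n t) (at y) h) \<le> b n * norm h"
      by auto
    show "\<exists>N b. open N \<and> x \<in> N \<and> summable b \<and>
        (\<forall>n. \<forall>t\<in>T. \<forall>y\<in>N. norm (frechet_derivative (f n t) (at y) h) \<le> b n)"
      by (rule exI[of _ N], rule exI[of _ "\<lambda>n. b n * norm h"])
        (use N b in \<open>auto intro: summable_mult2\<close>)
  qed
next
  fix t x assume t: "t \<in> T" and x: "x \<in> S"
  from dom[OF x] obtain N b where N: "open N" "x \<in> N" and sb: "summable b"
    and b: "\<And>n y. y \<in> N \<Longrightarrow> norm (f n t y) \<le> b n"
    and b': "\<And>n y h. y \<in> N \<Longrightarrow> norm (frechet_derivative (f n t) (at y) h) \<le> b n * norm h"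
    using t by metis
  obtain r where r: "r > 0" "ball x r \<subseteq> N \<inter> S"
    using openE[of "N \<inter> S" x] N S x by auto
  have s: "summable (\<lambda>n. f n t y)" if "y \<in> N" for y
    using summable_comparison_test'[OF sb, of 0 "\<lambda>n. f n t y"] b[OF that] by auto
  have s': "summable (\<lambda>n. frechet_derivative (f n t) (at y) h)" if "y \<in> N" for y h
    using summable_comparison_test'[OF summable_mult2[OF sb], of 0 "\<lambda>n. frechet_derivative (f n t) (at y) h"]
      b'[OF that] by auto
  have "\<exists>g. \<forall>y\<in>ball x r. (\<lambda>n. f n t y) sums g y \<and>
      (g has_derivative (\<lambda>h. \<Sum>n. frechet_derivative (f n t) (at y) h)) (at y within ball x r)"
  proof (rule has_derivative_series)
    show "(f n t has_derivative frechet_derivative (f n t) (at y)) (at y within ball x r)"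
      if "y \<in> ball x r" for n y
      using fam_Ck_has_derivative[OF f t] that r by (blast intro: has_derivative_at_withinI)
    show "(\<lambda>n. f n t x) sums (\<Sum>n. f n t x)"
      using s N by blast
    fix e :: real assume "e > 0"
    then obtain n0 where n0: "\<And>n. n \<ge> n0 \<Longrightarrow> norm (\<Sum>i. b (i + n)) < e"
      using suminf_exist_split[OF _ sb] by blast
    have "norm ((\<Sum>i<n. frechet_derivative (f i t) (at y) h) -
        (\<Sum>n. frechet_derivative (f n t) (at y) h)) \<le> e * norm h"
      if "n \<ge> n0" "y \<in> ball x r" for n y h
    proof -
      have y: "y \<in> N" using that r by auto
      have sbn: "summable (\<lambda>i. b (i + n) * norm h)"
        by (intro summable_mult2 summable_ignore_initial_segment sb)
      have "(\<Sum>n. frechet_derivative (f n t) (at y) h) =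
          (\<Sum>i. frechet_derivative (f (i + n) t) (at y) h) + (\<Sum>i<n. frechet_derivative (f i t) (at y) h)"
        by (rule suminf_split_initial_segment[OF s'[OF y]])
      moreover have "norm (\<Sum>i. frechet_derivative (f (i + n) t) (at y) h) \<le> (\<Sum>i. b (i + n) * norm h)"
        by (rule norm_suminf_le) (use b'[OF y] sbn in auto)
      moreover have "(\<Sum>i. b (i + n) * norm h) = (\<Sum>i. b (i + n)) * norm h"
        using suminf_mult2[OF summable_ignore_initial_segment[OF sb]] by metis
      moreover have "(\<Sum>i. b (i + n)) * norm h \<le> e * norm h"
        using n0[OF that(1)] by (intro mult_right_mono) auto
      ultimately show ?thesis by simp
    qed
    then show "\<forall>\<^sub>F n in sequentially. \<forall>y\<in>ball x r. \<forall>h.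
        norm ((\<Sum>i<n. frechet_derivative (f i t) (at y) h) -
          (\<Sum>n. frechet_derivative (f n t) (at y) h)) \<le> e * norm h"
      unfolding eventually_sequentially by blast
  qed (use r in auto)
  then obtain g where g: "\<And>y. y \<in> ball x r \<Longrightarrow> (\<lambda>n. f n t y) sums g y"
    "(g has_derivative (\<lambda>h. \<Sum>n. frechet_derivative (f n t) (at x) h)) (at x within ball x r)"
    using centre_in_ball[of x r] r(1) by blast
  have "(g has_derivative (\<lambda>h. \<Sum>n. frechet_derivative (f n t) (at x) h)) (at x)"
    using g(2) r by (simp add: at_within_open[of x "ball x r"])
  then show "((\<lambda>x. \<Sum>n. f n t x) has_derivative (\<lambda>h. \<Sum>n. frechet_derivative (f n t) (at x) h)) (at x)"
    by (rule has_derivative_transform_within_open[of _ _ _ _ "ball x r"])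
      (use r g(1) in \<open>auto simp: sums_iff\<close>)
qed

lemma fam_Ck_bound:
  fixes f :: "real \<Rightarrow> 'a::euclidean_space \<Rightarrow> 'b::real_normed_vector"
  assumes "fam_Ck k {0..1} f S" "cball x r \<subseteq> S"
  shows "\<exists>M\<ge>0. \<forall>t\<in>{0..1}. \<forall>y\<in>cball x r. norm (f t y) \<le> M"
proof -
  have "continuous_on ({0..1} \<times> cball x r) (\<lambda>(t, x). f t x)"
    by (rule continuous_on_subset[OF fam_Ck_cont[OF assms(1)]]) (use assms(2) in auto)
  then have "bounded ((\<lambda>(t, x). f t x) ` ({0..1} \<times> cball x r))"
    by (intro compact_imp_bounded compact_continuous_image compact_Times) auto
  then obtain M where "\<And>t y. t \<in> {0..1} \<Longrightarrow> y \<in> cball x r \<Longrightarrow> norm (f t y) \<le> M"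
    unfolding bounded_iff by (fastforce simp del: mem_cball)
  then show ?thesis
    by (intro exI[of _ "max M 0"]) (auto simp del: mem_cball simp: le_max_iff_disj)
qed

lemma fam_Ck_derivative_bound:
  fixes f :: "real \<Rightarrow> 'a::euclidean_space \<Rightarrow> 'b::real_normed_vector"
  assumes f: "fam_Ck (Suc k) {0..1} f S" and S: "cball x r \<subseteq> S"
  shows "\<exists>M\<ge>0. \<forall>t\<in>{0..1}. \<forall>y\<in>cball x r. norm (f t y) \<le> M \<and>
           (\<forall>h. norm (frechet_derivative (f t) (at y) h) \<le> M * norm h)"
proof -
  obtain M0 where M0: "M0 \<ge> 0" "\<forall>t\<in>{0..1}. \<forall>y\<in>cball x r. norm (f t y) \<le> M0"
    using fam_Ck_bound[OF f S] by blast
  have "\<exists>M\<ge>0. \<forall>t\<in>{0..1}. \<forall>y\<in>cball x r. norm (frechet_derivative (f t) (at y) i) \<le> M" for i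
    using fam_Ck_bound[OF fam_Ck_derivative[OF f] S] .
  then obtain M where M: "\<And>i. M i \<ge> 0"
      "\<And>i t y. t \<in> {0..1} \<Longrightarrow> y \<in> cball x r \<Longrightarrow> norm (frechet_derivative (f t) (at y) i) \<le> M i"
    by metis
  have "norm (frechet_derivative (f t) (at y) h) \<le> (\<Sum>i\<in>Basis. M i) * norm h"
    if t: "t \<in> {0..1}" and y: "y \<in> cball x r" for t y h
  proof -
    have "linear (frechet_derivative (f t) (at y))"
      using fam_Ck_has_derivative[OF f t] S y has_derivative_linear by blast
    from linear_sum[OF this, of "\<lambda>i. (h \<bullet> i) *\<^sub>R i" Basis] linear_scale[OF this]
    have "frechet_derivative (f t) (at y) h =
        (\<Sum>i\<in>Basis. (h \<bullet> i) *\<^sub>R frechet_derivative (f t) (at y) i)"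
      by (simp add: euclidean_representation)
    also have "norm \<dots> \<le> (\<Sum>i\<in>Basis. M i * norm h)"
    proof (rule sum_norm_le)
      fix i :: 'a assume "i \<in> Basis"
      then have "norm (h \<bullet> i) * norm (frechet_derivative (f t) (at y) i) \<le> norm h * M i"
        using M(2)[OF t y] M(1) by (intro mult_mono) (auto simp: Basis_le_norm)
      then show "norm ((h \<bullet> i) *\<^sub>R frechet_derivative (f t) (at y) i) \<le> M i * norm h"
        by (simp add: mult.commute)
    qed
    finally show ?thesis
      by (simp add: sum_distrib_right)
  qed
  moreover have "0 \<le> (\<Sum>i\<in>Basis. M i)"
    using M(1) by (simp add: sum_nonneg)
  ultimately show ?thesis
    using M0
    by (intro exI[of _ "M0 + (\<Sum>i\<in>Basis. M i)"])
      (auto simp del: mem_cball atLeastAtMost_iff simp: distrib_right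
        intro: order_trans add_increasing add_increasing2)
qed

lemma volterra_sums:
  assumes c: "\<And>n. continuous_on {0..1} (\<lambda>s. g n s x)" and t: "t \<in> {0..1}"
    and b: "summable b" "\<And>n s. s \<in> {0..1} \<Longrightarrow> norm (g n s x) \<le> b n"
  shows "(\<lambda>n. volterra (g n) t x) sums volterra (\<lambda>s x. \<Sum>n. g n s x) t x"
proof -
  have u: "uniform_limit (cbox 0 1) (\<lambda>n u. \<Sum>i<n. g i (u * t) x) (\<lambda>u. \<Sum>i. g i (u * t) x) sequentially"
    by (rule Weierstrass_m_test[OF _ b(1)]) (use b(2) unit_mult_mem[OF _ t] in auto)
  have cn: "continuous_on {0..1} (\<lambda>u. g n (u * t) x)" for n
    by (rule continuous_rescale[OF c t])
  from u obtain I J where IJ: "\<And>n. ((\<lambda>u. \<Sum>i<n. g i (u * t) x) has_integral I n) (cbox 0 1)"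
      "((\<lambda>u. \<Sum>i. g i (u * t) x) has_integral J) (cbox 0 1)" "I \<longlonglongrightarrow> J"
    by (rule uniform_limit_integral_cbox) (auto intro!: continuous_on_sum cn)
  have I: "I n = (\<Sum>i<n. integral {0..1} (\<lambda>u. g i (u * t) x))" for n
    using IJ(1)[of n] integral_sum[of "{..<n}" "\<lambda>i u. g i (u * t) x" "{0..1}"]
      integrable_continuous_interval[OF cn]
    by (auto dest: integral_unique)
  have "(\<lambda>n. integral {0..1} (\<lambda>u. g n (u * t) x)) sums integral {0..1} (\<lambda>u. \<Sum>i. g i (u * t) x)"
    using IJ(3) integral_unique[OF IJ(2)] unfolding sums_def I[symmetric] by simp
  then show ?thesis
    unfolding volterra_def by (rule sums_scaleR_right)
qed

lemma exp_majorant: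
  fixes C K t :: real
  assumes "0 \<le> C" "0 \<le> K" "t \<in> {0..1}"
  shows "C * ((K * t) ^ n / fact n) \<le> C * (K ^ n / fact n)"
  using assms by (intro mult_left_mono divide_right_mono power_mono) (auto intro: mult_left_le)

lemma summable_exp_majorant: "summable (\<lambda>n. C * (K ^ n / fact n :: real))"
  using summable_mult[OF summable_exp[of K], of C] by (simp add: divide_inverse mult.commute)

text \<open>The terms, not the partial sums, of the Picard iteration for \<open>X = F + volterra (act A X)\<close>: the
  solution is their sum.\<close>

primrec picard :: "('m \<Rightarrow> 'e \<Rightarrow> 'e) \<Rightarrow> (real \<Rightarrow> 'a \<Rightarrow> 'm) \<Rightarrow> (real \<Rightarrow> 'a \<Rightarrow> 'e::euclidean_space) \<Rightarrow>
    nat \<Rightarrow> real \<Rightarrow> 'a \<Rightarrow> 'e" where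
  "picard act A F 0 = F"
| "picard act A F (Suc n) = volterra (\<lambda>t x. act (A t x) (picard act A F n t x))"

context
  fixes act :: "'m::euclidean_space \<Rightarrow> 'e::euclidean_space \<Rightarrow> 'e"
  assumes act: "bounded_bilinear act"
begin

lemma fam_Ck_picard:
  fixes A :: "real \<Rightarrow> 'a::euclidean_space \<Rightarrow> 'm"
  assumes "fam_Ck k {0..1} A S" "fam_Ck k {0..1} F S" "open S"
  shows "fam_Ck k {0..1} (picard act A F n) S"
  by (induction n) (simp_all add: assms fam_Ck_volterra fam_Ck_bilinear[OF act])

lemma act_bound:
  fixes A :: "real \<Rightarrow> 'a::euclidean_space \<Rightarrow> 'm"
  assumes A: "fam_Ck k {0..1} A S" and S: "cball x r \<subseteq> S"
  shows "\<exists>M\<ge>0. \<forall>t\<in>{0..1}. \<forall>y\<in>cball x r. \<forall>e. norm (act (A t y) e) \<le> M * norm e"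
proof -
  obtain M where M: "M \<ge> 0" "\<And>t y. t \<in> {0..1} \<Longrightarrow> y \<in> cball x r \<Longrightarrow> norm (A t y) \<le> M"
    using fam_Ck_bound[OF A S] by blast
  obtain K where K: "K > 0" "\<And>a e. norm (act a e) \<le> norm a * norm e * K"
    using bounded_bilinear.pos_bounded[OF act] by blast
  have "norm (act (A t y) e) \<le> (M * K) * norm e" if "t \<in> {0..1}" "y \<in> cball x r" for t y e
  proof -
    have "norm (A t y) * (norm e * K) \<le> M * (norm e * K)"
      using M(2)[OF that] K(1) by (intro mult_right_mono) auto
    then show ?thesis
      using K(2)[of "A t y" e] by (simp add: mult_ac)
  qed
  then show ?thesis
    using M(1) K(1) by (intro exI[of _ "M * K"]) auto
qed

lemma act_derivative_bound:
  fixes A :: "real \<Rightarrow> 'a::euclidean_space \<Rightarrow> 'm"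
  assumes A: "fam_Ck (Suc k) {0..1} A S" and S: "cball x r \<subseteq> S"
  shows "\<exists>M\<ge>0. \<forall>t\<in>{0..1}. \<forall>y\<in>cball x r. \<forall>e. norm (act (A t y) e) \<le> M * norm e \<and>
           (\<forall>h. norm (act (frechet_derivative (A t) (at y) h) e) \<le> M * norm h * norm e)"
proof -
  obtain M where M: "M \<ge> 0" "\<And>t y. t \<in> {0..1} \<Longrightarrow> y \<in> cball x r \<Longrightarrow> norm (A t y) \<le> M"
      "\<And>t y h. t \<in> {0..1} \<Longrightarrow> y \<in> cball x r \<Longrightarrow>
          norm (frechet_derivative (A t) (at y) h) \<le> M * norm h"
    using fam_Ck_derivative_bound[OF A S] by blast
  obtain K where K: "K > 0" "\<And>a e. norm (act a e) \<le> norm a * norm e * K"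
    using bounded_bilinear.pos_bounded[OF act] by blast
  have *: "norm (act a e) \<le> (M * K) * c * norm e" if "norm a \<le> M * c" for a e c
  proof -
    have "norm a * (norm e * K) \<le> M * c * (norm e * K)"
      using that K(1) by (intro mult_right_mono) auto
    then show ?thesis
      using K(2)[of a e] by (simp add: mult_ac)
  qed
  have "norm (act (A t y) e) \<le> (M * K) * norm e \<and>
      (\<forall>h. norm (act (frechet_derivative (A t) (at y) h) e) \<le> (M * K) * norm h * norm e)"
    if "t \<in> {0..1}" "y \<in> cball x r" for t y e
    using *[of "A t y" 1 e] *[OF M(3)[OF that]] M(2)[OF that] by simp
  then show ?thesis
    using M(1) K(1) by (intro exI[of _ "M * K"]) auto
qed

lemma norm_picard_le:
  assumes A: "continuous_on {0..1} (\<lambda>t. A t x)" and F: "continuous_on {0..1} (\<lambda>t. F t x)"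
    and M: "\<And>t e. t \<in> {0..1} \<Longrightarrow> norm (act (A t x) e) \<le> M * norm e" "0 \<le> M"
    and C: "\<And>t. t \<in> {0..1} \<Longrightarrow> norm (F t x) \<le> C"
  shows "continuous_on {0..1} (\<lambda>t. picard act A F n t x) \<and>
    (\<forall>t\<in>{0..1}. norm (picard act A F n t x) \<le> C * ((M * t) ^ n / fact n))"
proof (induction n)
  case 0
  then show ?case using F C by simp
next
  case (Suc n)
  have c: "continuous_on {0..1} (\<lambda>t. act (A t x) (picard act A F n t x))"
    using bounded_bilinear.continuous_on[OF act A] Suc.IH by blast
  have "norm (act (A s x) (picard act A F n s x)) \<le> C * M * ((M * s) ^ n / fact n)"
    if s: "s \<in> {0..1}" for s
  proof -
    have "M * norm (picard act A F n s x) \<le> M * (C * ((M * s) ^ n / fact n))"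
      using Suc.IH s M(2) by (intro mult_left_mono) auto
    then show ?thesis
      using M(1)[OF s, of "picard act A F n s x"] by (simp add: mult_ac)
  qed
  moreover have "continuous_on {0..1} (\<lambda>t. volterra (\<lambda>t x. act (A t x) (picard act A F n t x)) t x)"
    using volterra_has_vector_derivative[of "\<lambda>t x. act (A t x) (picard act A F n t x)", OF c]
    by (meson continuous_on_eq_continuous_within has_vector_derivative_continuous)
  ultimately show ?case
    using norm_volterra_le[of "\<lambda>t x. act (A t x) (picard act A F n t x)" x _ C M n, OF c] by simp
qed

text \<open>A solution of the homogeneous equation equals each of its own Picard terms, which tend to 0.\<close>

lemma volterra_unique:
  assumes A: "continuous_on {0..1} (\<lambda>t. A t x)"
    and D: "continuous_on {0..1} (\<lambda>t. D t x)"
    and eq: "\<And>t. t \<in> {0..1} \<Longrightarrow> D t x = volterra (\<lambda>t x. act (A t x) (D t x)) t x"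
    and t: "t \<in> {0..1}"
  shows "D t x = 0"
proof -
  obtain K where K: "K > 0" "\<And>a e. norm (act a e) \<le> norm a * norm e * K"
    using bounded_bilinear.pos_bounded[OF act] by blast
  have "bounded ((\<lambda>t. A t x) ` {0..1})" "bounded ((\<lambda>t. D t x) ` {0..1})"
    using A D by (auto intro!: compact_imp_bounded compact_continuous_image)
  then obtain a C where a: "\<And>t. t \<in> {0..1} \<Longrightarrow> norm (A t x) \<le> a"
      and C: "\<And>t. t \<in> {0..1} \<Longrightarrow> norm (D t x) \<le> C"
    unfolding bounded_iff by (metis image_eqI)
  have a0: "0 \<le> a"
    using a[OF t] norm_ge_zero order_trans by blast
  have M: "norm (act (A t x) e) \<le> (a * K) * norm e" if "t \<in> {0..1}" for t e
  proof -
    have "norm (A t x) * (norm e * K) \<le> a * (norm e * K)"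
      using a[OF that] K(1) by (intro mult_right_mono) auto
    then show ?thesis
      using K(2)[of "A t x" e] by (simp add: mult_ac)
  qed
  have pic: "picard act A D n t x = D t x" if "t \<in> {0..1}" for n t
    using that
  proof (induction n arbitrary: t)
    case (Suc n)
    have "volterra (\<lambda>t x. act (A t x) (picard act A D n t x)) t x =
        volterra (\<lambda>t x. act (A t x) (D t x)) t x"
      by (rule volterra_cong) (use Suc in auto)
    then show ?case
      using eq[OF Suc.prems] by simp
  qed simp
  have "norm (D t x) \<le> C * ((a * K * t) ^ n / fact n)" for n
    using norm_picard_le[of A x D "a * K" C n, OF A D M _ C] pic[OF t, of n] a0 K(1) t
    by (metis less_imp_le mult_nonneg_nonneg)
  moreover have "(\<lambda>n. C * ((a * K * t) ^ n / fact n)) \<longlonglongrightarrow> 0"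
    by (rule summable_LIMSEQ_zero[OF summable_exp_majorant])
  ultimately have "norm (D t x) \<le> 0"
    by (intro LIMSEQ_le_const) auto
  then show ?thesis by simp
qed

text \<open>The product rule turns one term into two, each of which satisfies the bound for \<open>M\<close>; hence the
  factor 2 in the exponential.\<close>

lemma norm_picard_derivative_le:
  fixes A :: "real \<Rightarrow> 'a::euclidean_space \<Rightarrow> 'm"
  assumes A: "fam_Ck (Suc 0) {0..1} A S" and F: "fam_Ck (Suc 0) {0..1} F S" and S: "open S"
    and y: "y \<in> S" and M: "0 \<le> M"
    and A1: "\<And>t e. t \<in> {0..1} \<Longrightarrow> norm (act (A t y) e) \<le> M * norm e"
    and A2: "\<And>t e. t \<in> {0..1} \<Longrightarrow> norm (act (frechet_derivative (A t) (at y) h) e) \<le> M * norm h * norm e"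
    and F1: "\<And>t. t \<in> {0..1} \<Longrightarrow> norm (F t y) \<le> C"
    and F2: "\<And>t. t \<in> {0..1} \<Longrightarrow> norm (frechet_derivative (F t) (at y) h) \<le> C * norm h"
    and t: "t \<in> {0..1}"
  shows "norm (frechet_derivative (picard act A F n t) (at y) h) \<le> C * norm h * ((2 * M * t) ^ n / fact n)"
  using t
proof (induction n arbitrary: t)
  case 0
  then show ?case using F2 by simp
next
  case (Suc n)
  let ?P = "picard act A F n"
  let ?f = "\<lambda>t x. act (A t x) (?P t x)"
  have P: "fam_Ck (Suc 0) {0..1} ?P S"
    using fam_Ck_picard[OF A F S] .
  have f: "fam_Ck (Suc 0) {0..1} ?f S"
    by (rule fam_Ck_bilinear[OF act A P S])
  have "frechet_derivative (volterra ?f t) (at y) h =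
      volterra (\<lambda>t x. frechet_derivative (?f t) (at x) h) t y"
    by (rule frechet_derivative_apply[OF volterra_has_derivative[OF f S Suc.prems y]])
  moreover have "norm (volterra (\<lambda>t x. frechet_derivative (?f t) (at x) h) t y)
      \<le> (C * norm h) * ((2 * M * t) ^ Suc n / fact (Suc n))"
  proof (rule norm_volterra_le[OF _ Suc.prems])
    show "continuous_on {0..1} (\<lambda>t. frechet_derivative (?f t) (at y) h)"
      using fam_continuous_slice[OF fam_Ck_cont[OF fam_Ck_derivative[OF f]] y] .
    fix s :: real assume s: "s \<in> {0..1}"
    let ?B = "(2 * M * s) ^ n / fact n"
    have "norm (?P s y) \<le> C * ?B"
    proof (rule norm_picard_le[THEN conjunct2, rule_format, OF _ _ _ _ _ s])
      show "continuous_on {0..1} (\<lambda>t. A t y)" "continuous_on {0..1} (\<lambda>t. F t y)"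
        using fam_continuous_slice[OF fam_Ck_cont y] A F by blast+
      show "norm (act (A t y) e) \<le> (2 * M) * norm e" if "t \<in> {0..1}" for t e
        using A1[OF that, of e] M mult_nonneg_nonneg[OF M norm_ge_zero[of e]] by linarith
    qed (use F1 M in auto)
    then have "norm (act (frechet_derivative (A s) (at y) h) (?P s y)) \<le> M * norm h * (C * ?B)"
      using A2[OF s, of "?P s y"] M
      by (meson mult_left_mono mult_nonneg_nonneg norm_ge_zero order_trans)
    moreover have "norm (act (A s y) (frechet_derivative (?P s) (at y) h)) \<le> M * (C * norm h * ?B)"
      using A1[OF s, of "frechet_derivative (?P s) (at y) h"] M Suc.IH[OF s]
      by (meson mult_left_mono order_trans)
    moreover have "norm (frechet_derivative (?f s) (at y) h) \<le>
        norm (act (A s y) (frechet_derivative (?P s) (at y) h)) +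
        norm (act (frechet_derivative (A s) (at y) h) (?P s y))"
      unfolding frechet_derivative_apply[OF bounded_bilinear.FDERIV[OF act
        fam_Ck_has_derivative[OF A s y] fam_Ck_has_derivative[OF P s y]]]
      by (rule norm_triangle_ineq)
    moreover have "C * norm h * (2 * M) * ?B = M * norm h * (C * ?B) + M * (C * norm h * ?B)"
      by (simp add: algebra_simps)
    ultimately show "norm (frechet_derivative (?f s) (at y) h) \<le> C * norm h * (2 * M) * ?B"
      by linarith
  qed
  ultimately show ?case by simp
qed

definition volterra_series ::
    "(real \<Rightarrow> 'a::euclidean_space \<Rightarrow> 'm) \<Rightarrow> (real \<Rightarrow> 'a \<Rightarrow> 'e) \<Rightarrow> real \<Rightarrow> 'a \<Rightarrow> 'e" where
  "volterra_series A F t x = (\<Sum>n. picard act A F n t x)"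

lemma picard_locally_dominated:
  fixes A :: "real \<Rightarrow> 'a::euclidean_space \<Rightarrow> 'm"
  assumes A: "fam_Ck 0 {0..1} A S" and F: "fam_Ck 0 {0..1} F S" and S: "open S" and x: "x \<in> S"
  shows "\<exists>N b. open N \<and> x \<in> N \<and> summable b \<and>
                 (\<forall>n. \<forall>t\<in>{0..1}. \<forall>y\<in>N. norm (picard act A F n t y) \<le> b n)"
proof -
  obtain r where r: "r > 0" "cball x r \<subseteq> S"
    using S x open_contains_cball by blast
  obtain M where M: "0 \<le> M" "\<And>t y e. t \<in> {0..1} \<Longrightarrow> y \<in> cball x r \<Longrightarrow> norm (act (A t y) e) \<le> M * norm e"
    using act_bound[OF A r(2)] by blast
  obtain C where C: "0 \<le> C" "\<And>t y. t \<in> {0..1} \<Longrightarrow> y \<in> cball x r \<Longrightarrow> norm (F t y) \<le> C"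
    using fam_Ck_bound[OF F r(2)] by blast
  have "norm (picard act A F n t y) \<le> C * (M ^ n / fact n)" if t: "t \<in> {0..1}" and y: "y \<in> ball x r" for n t y
  proof -
    have yS: "y \<in> S" "y \<in> cball x r" using y r by auto
    have "norm (picard act A F n t y) \<le> C * ((M * t) ^ n / fact n)"
      using norm_picard_le[of A y F M C n, OF fam_continuous_slice[OF fam_Ck_cont[OF A] yS(1)]
          fam_continuous_slice[OF fam_Ck_cont[OF F] yS(1)] M(2)[OF _ yS(2)] M(1) C(2)[OF _ yS(2)]] t
      by blast
    then show ?thesis
      using exp_majorant[OF C(1) M(1) t, of n] by (rule order_trans)
  qed
  then show ?thesis
    using r(1) summable_exp_majorant[of C M]
    by (intro exI[of _ "ball x r"] exI[of _ "\<lambda>n. C * (M ^ n / fact n)"]) (auto simp del: mem_ball)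
qed

lemma fam_C0_volterra_series:
  fixes A :: "real \<Rightarrow> 'a::euclidean_space \<Rightarrow> 'm"
  assumes A: "fam_Ck 0 {0..1} A S" and F: "fam_Ck 0 {0..1} F S" and S: "open S"
  shows "fam_Ck 0 {0..1} (volterra_series A F) S"
  unfolding volterra_series_def[abs_def]
  by (rule fam_C0_suminf[OF fam_Ck_picard[OF A F S] picard_locally_dominated[OF A F S]])

lemma fam_C1_volterra_series:
  fixes A :: "real \<Rightarrow> 'a::euclidean_space \<Rightarrow> 'm"
  assumes A: "fam_Ck (Suc 0) {0..1} A S" and F: "fam_Ck (Suc 0) {0..1} F S" and S: "open S"
  shows "fam_Ck (Suc 0) {0..1} (volterra_series A F) S"
  unfolding volterra_series_def[abs_def]
proof (rule fam_C1_suminf[OF fam_Ck_picard[OF A F S] S])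
  fix x assume x: "x \<in> S"
  obtain r where r: "r > 0" "cball x r \<subseteq> S"
    using S x open_contains_cball by blast
  obtain M where M: "0 \<le> M" "\<And>t y e. t \<in> {0..1} \<Longrightarrow> y \<in> cball x r \<Longrightarrow> norm (act (A t y) e) \<le> M * norm e"
     "\<And>t y e h. t \<in> {0..1} \<Longrightarrow> y \<in> cball x r \<Longrightarrow>
        norm (act (frechet_derivative (A t) (at y) h) e) \<le> M * norm h * norm e"
    using act_derivative_bound[OF A r(2)] by blast
  obtain C where C: "0 \<le> C" "\<And>t y. t \<in> {0..1} \<Longrightarrow> y \<in> cball x r \<Longrightarrow> norm (F t y) \<le> C"
      "\<And>t y h. t \<in> {0..1} \<Longrightarrow> y \<in> cball x r \<Longrightarrow> norm (frechet_derivative (F t) (at y) h) \<le> C * norm h"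
    using fam_Ck_derivative_bound[OF F r(2)] by blast
  define b where "b n = C * ((2 * M) ^ n / fact n)" for n
  have "norm (picard act A F n t y) \<le> b n \<and>
      (\<forall>h. norm (frechet_derivative (picard act A F n t) (at y) h) \<le> b n * norm h)"
    if t: "t \<in> {0..1}" and y: "y \<in> ball x r" for n t y
  proof (intro conjI allI)
    have yS: "y \<in> S" "y \<in> cball x r" using y r by auto
    have "norm (picard act A F n t y) \<le> C * ((2 * M * t) ^ n / fact n)"
    proof (rule norm_picard_le[THEN conjunct2, rule_format, OF _ _ _ _ _ t])
      show "continuous_on {0..1} (\<lambda>t. A t y)" "continuous_on {0..1} (\<lambda>t. F t y)"
        using fam_continuous_slice[OF fam_Ck_cont yS(1)] A F by blast+
      show "norm (act (A t y) e) \<le> 2 * M * norm e" if "t \<in> {0..1}" for t e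
        using M(2)[OF that yS(2), of e] mult_nonneg_nonneg[OF M(1) norm_ge_zero[of e]] by linarith
    qed (use M C yS in auto)
    also have "\<dots> \<le> b n"
      unfolding b_def by (rule exp_majorant[OF C(1) _ t]) (use M in simp)
    finally show "norm (picard act A F n t y) \<le> b n" .
    fix h
    have "norm (frechet_derivative (picard act A F n t) (at y) h) \<le> C * norm h * ((2 * M * t) ^ n / fact n)"
      by (rule norm_picard_derivative_le[OF A F S yS(1) M(1)]) (use M C yS t in auto)
    also have "\<dots> \<le> b n * norm h"
      using exp_majorant[of "C * norm h" "2 * M" t n] C(1) M(1) t unfolding b_def by (simp add: mult_ac)
    finally show "norm (frechet_derivative (picard act A F n t) (at y) h) \<le> b n * norm h" .
  qed
  moreover have "summable b"
    unfolding b_def by (rule summable_exp_majorant)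
  ultimately show "\<exists>N b. open N \<and> x \<in> N \<and> summable b \<and>
      (\<forall>n. \<forall>t\<in>{0..1}. \<forall>y\<in>N. norm (picard act A F n t y) \<le> b n \<and>
        (\<forall>h. norm (frechet_derivative (picard act A F n t) (at y) h) \<le> b n * norm h))"
    using r by (intro exI[of _ "ball x r"] exI[of _ b]) (auto simp del: mem_ball)
qed

lemma volterra_series_eq:
  fixes A :: "real \<Rightarrow> 'a::euclidean_space \<Rightarrow> 'm"
  assumes A: "fam_Ck 0 {0..1} A S" and F: "fam_Ck 0 {0..1} F S" and S: "open S"
    and t: "t \<in> {0..1}" and x: "x \<in> S"
  shows "volterra_series A F t x =
    F t x + volterra (\<lambda>t x. act (A t x) (volterra_series A F t x)) t x"
proof -
  obtain b where b: "summable b" "\<And>n t. t \<in> {0..1} \<Longrightarrow> norm (picard act A F n t x) \<le> b n"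
    using picard_locally_dominated[OF A F S x] by blast
  obtain M where M: "0 \<le> M" "\<And>t e. t \<in> {0..1} \<Longrightarrow> norm (act (A t x) e) \<le> M * norm e"
    using act_bound[OF A, of x 0] x by auto
  have s: "summable (\<lambda>n. picard act A F n s x)" if "s \<in> {0..1}" for s
    using summable_comparison_test'[OF b(1), of 0 "\<lambda>n. picard act A F n s x"] b(2)[OF that] by auto
  have "(\<lambda>n. volterra (\<lambda>t x. act (A t x) (picard act A F n t x)) t x) sums
      volterra (\<lambda>t x. \<Sum>n. act (A t x) (picard act A F n t x)) t x"
  proof (rule volterra_sums[OF _ t])
    show "continuous_on {0..1} (\<lambda>s. act (A s x) (picard act A F n s x))" for n
      using fam_continuous_slice[OF fam_Ck_cont[OF fam_Ck_bilinear[OF act A fam_Ck_picard[OF A F S] S]] x] .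
    show "summable (\<lambda>n. M * b n)"
      by (intro summable_mult b)
    show "norm (act (A s x) (picard act A F n s x)) \<le> M * b n" if "s \<in> {0..1}" for n s
      using M(2)[OF that, of "picard act A F n s x"] mult_left_mono[OF b(2)[OF that] M(1)] order_trans by blast
  qed
  moreover have "volterra (\<lambda>t x. \<Sum>n. act (A t x) (picard act A F n t x)) t x =
      volterra (\<lambda>t x. act (A t x) (volterra_series A F t x)) t x"
    unfolding volterra_series_def
    by (rule volterra_cong[OF _ t])
      (use bounded_linear.suminf[OF bounded_bilinear.bounded_linear_right[OF act] s] in auto)
  ultimately have "(\<lambda>n. picard act A F (Suc n) t x) sums
      volterra (\<lambda>t x. act (A t x) (volterra_series A F t x)) t x"
    by simp
  from sums_Suc[OF this] show ?thesis
    by (simp add: volterra_series_def sums_iff add.commute)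
qed

lemma volterra_solution_eq_series:
  fixes A :: "real \<Rightarrow> 'a::euclidean_space \<Rightarrow> 'm"
  assumes A: "fam_Ck 0 {0..1} A S" and F: "fam_Ck 0 {0..1} F S" and S: "open S"
    and X: "fam_Ck 0 {0..1} X S"
    and eq: "\<And>t x. t \<in> {0..1} \<Longrightarrow> x \<in> S \<Longrightarrow> X t x = F t x + volterra (\<lambda>t x. act (A t x) (X t x)) t x"
    and t: "t \<in> {0..1}" and x: "x \<in> S"
  shows "X t x = volterra_series A F t x"
proof -
  let ?Y = "volterra_series A F"
  have Y: "fam_Ck 0 {0..1} ?Y S"
    by (rule fam_C0_volterra_series[OF A F S])
  have c: "continuous_on {0..1} (\<lambda>t. A t x)" "continuous_on {0..1} (\<lambda>t. X t x)" "continuous_on {0..1} (\<lambda>t. ?Y t x)"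
    using fam_continuous_slice[OF fam_Ck_cont x] A X Y by blast+
  have "X t x - ?Y t x = 0"
  proof (rule volterra_unique[where A=A and D="\<lambda>t x. X t x - ?Y t x" and x=x and t=t, OF c(1) _ _ t])
    show "continuous_on {0..1} (\<lambda>t. X t x - ?Y t x)"
      by (intro continuous_intros c)
    fix s :: real assume s: "s \<in> {0..1}"
    have "X s x - ?Y s x = volterra (\<lambda>t x. act (A t x) (X t x)) s x - volterra (\<lambda>t x. act (A t x) (?Y t x)) s x"
      using eq[OF s x] volterra_series_eq[OF A F S s x] by simp
    also have "\<dots> = volterra (\<lambda>t x. act (A t x) (X t x) - act (A t x) (?Y t x)) s x"
      by (rule volterra_diff[symmetric, OF _ _ s]) (intro bounded_bilinear.continuous_on[OF act] c)+
    finally show "X s x - ?Y s x = volterra (\<lambda>t x. act (A t x) (X t x - ?Y t x)) s x"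
      by (simp add: bounded_bilinear.diff_right[OF act])
  qed
  then show ?thesis by simp
qed

lemma volterra_solution_derivative:
  fixes A :: "real \<Rightarrow> 'a::euclidean_space \<Rightarrow> 'm"
  assumes A: "fam_Ck (Suc 0) {0..1} A S" and F: "fam_Ck (Suc 0) {0..1} F S" and S: "open S"
    and X: "fam_Ck (Suc 0) {0..1} X S"
    and eq: "\<And>t x. t \<in> {0..1} \<Longrightarrow> x \<in> S \<Longrightarrow> X t x = F t x + volterra (\<lambda>t x. act (A t x) (X t x)) t x"
    and t: "t \<in> {0..1}" and x: "x \<in> S"
  shows "frechet_derivative (X t) (at x) v = frechet_derivative (F t) (at x) v +
     volterra (\<lambda>t x. act (frechet_derivative (A t) (at x) v) (X t x)) t x +
     volterra (\<lambda>t x. act (A t x) (frechet_derivative (X t) (at x) v)) t x"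
proof -
  let ?f = "\<lambda>t x. act (A t x) (X t x)"
  have f: "fam_Ck (Suc 0) {0..1} ?f S"
    by (rule fam_Ck_bilinear[OF act A X S])
  have "((\<lambda>x. F t x + volterra ?f t x) has_derivative
      (\<lambda>v. frechet_derivative (F t) (at x) v + volterra (\<lambda>t x. frechet_derivative (?f t) (at x) v) t x)) (at x)"
    by (intro has_derivative_add fam_Ck_has_derivative[OF F t x] volterra_has_derivative[OF f S t x])
  then have "(X t has_derivative
      (\<lambda>v. frechet_derivative (F t) (at x) v + volterra (\<lambda>t x. frechet_derivative (?f t) (at x) v) t x)) (at x)"
    by (rule has_derivative_transform_within_open[OF _ S x]) (use eq t in auto)
  then have "frechet_derivative (X t) (at x) v =
      frechet_derivative (F t) (at x) v + volterra (\<lambda>t x. frechet_derivative (?f t) (at x) v) t x"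
    by (rule frechet_derivative_apply)
  moreover have "volterra (\<lambda>t x. frechet_derivative (?f t) (at x) v) t x =
      volterra (\<lambda>t x. act (frechet_derivative (A t) (at x) v) (X t x) +
        act (A t x) (frechet_derivative (X t) (at x) v)) t x"
  proof (rule volterra_cong[OF _ t])
    fix s :: real assume s: "s \<in> {0..1}"
    show "frechet_derivative (?f s) (at x) v = act (frechet_derivative (A s) (at x) v) (X s x) +
        act (A s x) (frechet_derivative (X s) (at x) v)"
      using frechet_derivative_apply[OF bounded_bilinear.FDERIV[OF act
        fam_Ck_has_derivative[OF A s x] fam_Ck_has_derivative[OF X s x]], of v] by simp
  qed
  moreover have "\<dots> = volterra (\<lambda>t x. act (frechet_derivative (A t) (at x) v) (X t x)) t x +
     volterra (\<lambda>t x. act (A t x) (frechet_derivative (X t) (at x) v)) t x"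
    by (rule volterra_add[OF _ _ t]; intro bounded_bilinear.continuous_on[OF act])
      (use fam_continuous_slice[OF fam_Ck_cont x] fam_continuous_slice[OF fam_Ck_cont[OF fam_Ck_derivative] x] A X
        in blast)+
  ultimately show ?thesis
    by simp
qed

text \<open>Smooth dependence on parameters. A directional derivative of \<open>X\<close> solves the equation with the same
  coefficients \<open>A\<close> and the inhomogeneity \<open>D F + volterra (act (D A) X)\<close>, which by the induction
  hypothesis for \<open>X\<close> is again of class \<open>k\<close>. So the induction on \<open>k\<close> has to range over all
  inhomogeneities, but never changes the space of unknowns.\<close>

lemma fam_Ck_volterra_solution:
  fixes A :: "real \<Rightarrow> 'a::euclidean_space \<Rightarrow> 'm"
  assumes A: "fam_Ck k {0..1} A S" and F: "fam_Ck k {0..1} F S" and S: "open S"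
    and X: "fam_Ck 0 {0..1} X S"
    and eq: "\<And>t x. t \<in> {0..1} \<Longrightarrow> x \<in> S \<Longrightarrow> X t x = F t x + volterra (\<lambda>t x. act (A t x) (X t x)) t x"
  shows "fam_Ck k {0..1} X S"
  using A F X eq
proof (induction k arbitrary: F X)
  case 0
  then show ?case by blast
next
  case (Suc k)
  have A1: "fam_Ck (Suc 0) {0..1} A S" and F1: "fam_Ck (Suc 0) {0..1} F S"
    using Suc.prems(1,2) fam_Ck_mono[of "Suc k" _ _ _ "Suc 0"] by blast+
  have "X t x = volterra_series A F t x" if "t \<in> {0..1}" "x \<in> S" for t x
    by (rule volterra_solution_eq_series[OF _ _ S Suc.prems(3,4) that])
      (use A1 F1 fam_Ck_Suc_imp in blast)+
  then have X1: "fam_Ck (Suc 0) {0..1} X S"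
    using fam_C1_volterra_series[OF A1 F1 S] fam_Ck_cong[OF S, of "{0..1}" X "volterra_series A F"]
    by blast
  have Xk: "fam_Ck k {0..1} X S"
    by (rule Suc.IH[OF Suc.prems(1,2)[THEN fam_Ck_Suc_imp] Suc.prems(3,4)])
  have Dk: "fam_Ck k {0..1} (\<lambda>t x. frechet_derivative (X t) (at x) v) S" for v
  proof (rule Suc.IH)
    show "fam_Ck k {0..1} A S"
      using Suc.prems(1) fam_Ck_Suc_imp by blast
    show "fam_Ck k {0..1} (\<lambda>t x. frechet_derivative (F t) (at x) v +
        volterra (\<lambda>t x. act (frechet_derivative (A t) (at x) v) (X t x)) t x) S"
      by (intro fam_Ck_add fam_Ck_volterra fam_Ck_bilinear[OF act] fam_Ck_derivative Suc.prems Xk S)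
    show "fam_Ck 0 {0..1} (\<lambda>t x. frechet_derivative (X t) (at x) v) S"
      by (rule fam_Ck_derivative[OF X1])
    show "frechet_derivative (X t) (at x) v = frechet_derivative (F t) (at x) v +
        volterra (\<lambda>t x. act (frechet_derivative (A t) (at x) v) (X t x)) t x +
        volterra (\<lambda>t x. act (A t x) (frechet_derivative (X t) (at x) v)) t x"
      if "t \<in> {0..1}" "x \<in> S" for t x
      by (rule volterra_solution_derivative[OF A1 F1 S X1 Suc.prems(4) that])
  qed
  show ?case
    using fam_Ck_cont[OF X1] Dk X1 by auto
qed

end

section \<open>Integrable linear systems\<close>

text \<open>The Frobenius theorem for linear systems, with parameter \<open>c\<close>. On the ray from \<open>p0\<close> to a point the
  system prescribes a linear ordinary differential equation in the ray time \<open>t\<close>, with solution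
  \<open>X\<close>; its value at time 1 is the only candidate. Write \<open>Z\<close> for the difference between the derivative of
  \<open>X\<close> in a basis direction \<open>i\<close> and \<open>t\<close> times the prescribed value. The integrability conditions
  say exactly that \<open>Z\<close> solves the homogeneous equation along the ray, and \<open>Z = 0\<close> at \<open>t = 0\<close>.\<close>

lemma frobenius_linear:
  fixes act :: "'m::euclidean_space \<Rightarrow> 'e::euclidean_space \<Rightarrow> 'e"
    and \<Omega> :: "'p::euclidean_space \<Rightarrow> 'c::euclidean_space \<times> 'p \<Rightarrow> 'm"
  assumes act: "bounded_bilinear act" and L: "open L" and r: "0 < r"
    and \<Omega>: "\<And>i. i \<in> Basis \<Longrightarrow> smooth_on (\<Omega> i) (L \<times> ball p0 r)"
    and integ: "\<And>i j z e. i \<in> Basis \<Longrightarrow> j \<in> Basis \<Longrightarrow> z \<in> L \<times> ball p0 r \<Longrightarrow>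
        act (frechet_derivative (\<Omega> j) (at z) (0, i)) e + act (\<Omega> j z) (act (\<Omega> i z) e) =
        act (frechet_derivative (\<Omega> i) (at z) (0, j)) e + act (\<Omega> i z) (act (\<Omega> j z) e)"
  obtains X where "smooth_on X (L \<times> ball p0 r)" "\<And>c. c \<in> L \<Longrightarrow> X (c, p0) = x0"
    "\<And>z i. z \<in> L \<times> ball p0 r \<Longrightarrow> i \<in> Basis \<Longrightarrow>
       frechet_derivative X (at z) (0, i) = act (\<Omega> i z) (X z)"
proof -
  define W where "W = L \<times> ball p0 r"
  have W: "open W"
    unfolding W_def by (intro open_Times L open_ball)
  \<comment> \<open>The contraction to \<open>p0\<close>, with the parameter fixed.\<close>
  define \<rho> where "\<rho> t z = (fst z, p0 + t *\<^sub>R (snd z - p0))" for t :: real and z :: "'c \<times> 'p"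
  have \<rho>W: "\<rho> t z \<in> W" if "t \<in> {0..1}" "z \<in> W" for t z
  proof -
    have "t * dist p0 (snd z) \<le> 1 * dist p0 (snd z)"
      using that by (intro mult_right_mono) auto
    then have "dist p0 (p0 + t *\<^sub>R (snd z - p0)) < r"
      using that by (auto simp: W_def dist_norm norm_minus_commute)
    then show ?thesis
      using that by (auto simp: \<rho>_def W_def)
  qed
  have \<rho>C: "fam_Ck k {0..1} \<rho> W" for k
  proof -
    have "fam_Ck k {0..1} (\<lambda>t z. (fst z, 0 :: 'p)) W"
      by (rule fam_Ck_linear[where L="\<lambda>z. (fst z, 0)", OF _ fam_Ck_id[OF W] W]) (intro bounded_linear_intros)
    moreover have "fam_Ck k {0..1} (\<lambda>t z. (0 :: 'c, t *\<^sub>R snd z)) W"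
    proof (rule fam_Ck_linear[where L="\<lambda>y. (0, y)", OF _ _ W])
      show "fam_Ck k {0..1} (\<lambda>t z :: 'c \<times> 'p. t *\<^sub>R snd z) W"
        by (rule fam_Ck_bilinear[OF bounded_bilinear_scaleR fam_Ck_time
              fam_Ck_linear[OF bounded_linear_snd fam_Ck_id[OF W] W] W])
          (auto intro!: continuous_intros W)
    qed (intro bounded_linear_intros)
    moreover have "fam_Ck k {0..1} (\<lambda>t z. (0 :: 'c, (1 - t) *\<^sub>R p0)) W"
      by (rule fam_Ck_time) (auto intro!: continuous_intros W)
    ultimately have "fam_Ck k {0..1} (\<lambda>t z. (fst z, 0) + (0, t *\<^sub>R snd z) + (0, (1 - t) *\<^sub>R p0)) W"
      by (intro fam_Ck_add W)
    then show ?thesis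
      by (simp add: \<rho>_def[abs_def] algebra_simps)
  qed
  define B where "B t z = (\<Sum>i\<in>Basis. ((snd z - p0) \<bullet> i) *\<^sub>R \<Omega> i (\<rho> t z))" for t z
  have B: "fam_Ck k {0..1} B W" for k
    unfolding B_def[abs_def]
  proof (intro fam_Ck_sum finite_Basis W fam_Ck_bilinear[OF bounded_bilinear_scaleR])
    fix i :: 'p assume i: "i \<in> Basis"
    show "fam_Ck k {0..1} (\<lambda>t z. \<Omega> i (\<rho> t z)) W"
      using \<Omega>[OF i] by (intro fam_Ck_compose[OF _ \<rho>C W \<rho>W]) (auto simp: smooth_on_def W_def)
    have "fam_Ck k {0..1} (\<lambda>(t::real) (z :: 'c \<times> 'p). snd z \<bullet> i + - (p0 \<bullet> i)) W"
    proof (intro fam_Ck_add W fam_Ck_const)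
      show "fam_Ck k {0..1} (\<lambda>(t::real) (z :: 'c \<times> 'p). snd z \<bullet> i) W"
        by (rule fam_Ck_linear[where L="\<lambda>z. snd z \<bullet> i", OF _ fam_Ck_id[OF W] W])
          (intro bounded_linear_inner_left_comp bounded_linear_snd)
    qed
    then show "fam_Ck k {0..1} (\<lambda>(t::real) (z :: 'c \<times> 'p). (snd z - p0) \<bullet> i) W"
      by (simp add: inner_diff_left)
  qed
  define F where "F = (\<lambda>(t::real) (z::'c \<times> 'p). x0)"
  have F: "fam_Ck k {0..1} F W" for k
    unfolding F_def by (rule fam_Ck_const[OF W])
  define X where "X = volterra_series act B F"
  have eq: "X t z = x0 + volterra (\<lambda>t x. act (B t x) (X t x)) t z" if "t \<in> {0..1}" "z \<in> W" for t z
    using volterra_series_eq[OF act B F W that] unfolding X_def F_def .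
  have X: "fam_Ck k {0..1} X W" for k
    by (rule fam_Ck_volterra_solution[OF act B F W])
      (use fam_C0_volterra_series[OF act B F W] eq in \<open>auto simp: X_def F_def simp del: fam_Ck.simps\<close>)
  have slice: "continuous_on {0..1} (\<lambda>t. f t z)" if "\<And>k. fam_Ck k {0..1} f W" "z \<in> W"
    for f :: "real \<Rightarrow> 'c \<times> 'p \<Rightarrow> 'd::real_normed_vector" and z
    using fam_continuous_slice[OF fam_Ck_cont[OF that(1)] that(2)] .
  have main: "frechet_derivative (X 1) (at z) (0, i) = act (\<Omega> i z) (X 1 z)"
    if z: "z \<in> W" and i: "i \<in> Basis" for z i
  proof -
    let ?q = "snd z - p0"
    let ?D = "\<lambda>j t v. frechet_derivative (\<Omega> j) (at (\<rho> t z)) v"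
    have D\<Omega>: "(\<Omega> j has_derivative ?D j t) (at (\<rho> t z))" if "j \<in> Basis" "t \<in> {0..1}" for j t
      by (rule smooth_on_has_derivative[OF \<Omega>[OF that(1)] \<rho>W[OF that(2) z, unfolded W_def]])
    have Dlin: "?D j t (s *\<^sub>R v) = s *\<^sub>R ?D j t v" if "j \<in> Basis" "t \<in> {0..1}" for j t s v
      using linear_scale[OF has_derivative_linear[OF D\<Omega>[OF that]]] .
    have Dq: "?D j t (0, ?q) = (\<Sum>l\<in>Basis. (?q \<bullet> l) *\<^sub>R ?D j t (0, l))" if "j \<in> Basis" "t \<in> {0..1}" for j t
    proof -
      have "(0 :: 'c, ?q) = (\<Sum>l\<in>Basis. (?q \<bullet> l) *\<^sub>R (0, l))"
        by (rule prod_eqI) (simp_all add: fst_sum snd_sum euclidean_representation)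
      then show ?thesis
        using linear_sum[OF has_derivative_linear[OF D\<Omega>[OF that]], of "\<lambda>l. (?q \<bullet> l) *\<^sub>R (0, l)" Basis]
        unfolding Dlin[OF that] by metis
    qed
    have DB: "frechet_derivative (B t) (at z) (0, i) =
        \<Omega> i (\<rho> t z) + t *\<^sub>R (\<Sum>j\<in>Basis. (?q \<bullet> j) *\<^sub>R ?D j t (0, i))" if t: "t \<in> {0..1}" for t
    proof -
      have D\<rho>: "(\<rho> t has_derivative (\<lambda>v. (fst v, t *\<^sub>R snd v))) (at z)"
        unfolding \<rho>_def[abs_def] by (rule derivative_eq_intros refl | simp)+
      have "(B t has_derivative (\<lambda>v. \<Sum>j\<in>Basis. (?q \<bullet> j) *\<^sub>R ?D j t (fst v, t *\<^sub>R snd v) +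
          (snd v \<bullet> j) *\<^sub>R \<Omega> j (\<rho> t z))) (at z)"
        unfolding B_def[abs_def]
        by (intro has_derivative_sum bounded_bilinear.FDERIV[OF bounded_bilinear_scaleR]
            has_derivative_compose[OF D\<rho> D\<Omega>[OF _ t]]) (auto intro!: derivative_eq_intros)
      then have "frechet_derivative (B t) (at z) (0, i) = (\<Sum>j\<in>Basis. (?q \<bullet> j) *\<^sub>R ?D j t (0, t *\<^sub>R i) +
          (i \<bullet> j) *\<^sub>R \<Omega> j (\<rho> t z))"
        by (simp add: frechet_derivative_apply)
      also have "\<dots> = (\<Sum>j\<in>Basis. (?q \<bullet> j) *\<^sub>R (t *\<^sub>R ?D j t (0, i))) + (\<Sum>j\<in>Basis. (i \<bullet> j) *\<^sub>R \<Omega> j (\<rho> t z))"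
        using Dlin[OF _ t, of _ t "(0, i)"] by (simp add: sum.distrib scaleR_Pair)
      also have "(\<Sum>j\<in>Basis. (i \<bullet> j) *\<^sub>R \<Omega> j (\<rho> t z)) = (\<Sum>j\<in>Basis. if j = i then \<Omega> j (\<rho> t z) else 0)"
        by (rule sum.cong) (use i in \<open>auto simp: inner_Basis\<close>)
      also have "\<dots> = \<Omega> i (\<rho> t z)"
        using i by simp
      finally show ?thesis
        by (simp add: scaleR_sum_right mult.commute)
    qed
    define Y where "Y t = frechet_derivative (X t) (at z) (0, i)" for t
    define E where "E t = act (\<Omega> i (\<rho> t z)) (X t z)" for t
    define Z where "Z t = Y t - t *\<^sub>R E t" for t
    have X': "((\<lambda>t. X t z) has_vector_derivative act (B t z) (X t z)) (at t within {0..1})"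
      if t: "t \<in> {0..1}" for t
    proof -
      have "((\<lambda>t. x0 + volterra (\<lambda>t x. act (B t x) (X t x)) t z) has_vector_derivative
          0 + act (B t z) (X t z)) (at t within {0..1})"
        by (intro has_vector_derivative_add has_vector_derivative_const volterra_has_vector_derivative
            slice z fam_Ck_bilinear[OF act B X W] t)
      then show ?thesis
        using has_vector_derivative_transform[OF t eq[OF _ z]] by simp
    qed
    have Y_eq: "Y t = volterra (\<lambda>t x. act (frechet_derivative (B t) (at x) (0, i)) (X t x)) t z +
        volterra (\<lambda>t x. act (B t x) (frechet_derivative (X t) (at x) (0, i))) t z"
      if t: "t \<in> {0..1}" for t
      unfolding Y_def
      using volterra_solution_derivative[OF act B F W X _ t z, of "(0, i)"] eq
      by (simp add: F_def frechet_derivative_const)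
    have DX: "fam_Ck k {0..1} (\<lambda>t x. frechet_derivative (X t) (at x) (0, i)) W"
      and DBC: "fam_Ck k {0..1} (\<lambda>t x. frechet_derivative (B t) (at x) (0, i)) W" for k
      using fam_Ck_derivative[OF X] fam_Ck_derivative[OF B] by blast+
    have Y': "(Y has_vector_derivative act (frechet_derivative (B t) (at z) (0, i)) (X t z) + act (B t z) (Y t))
        (at t within {0..1})" if t: "t \<in> {0..1}" for t
    proof (rule has_vector_derivative_transform[OF t Y_eq])
      show "((\<lambda>t. volterra (\<lambda>t x. act (frechet_derivative (B t) (at x) (0, i)) (X t x)) t z +
        volterra (\<lambda>t x. act (B t x) (frechet_derivative (X t) (at x) (0, i))) t z) has_vector_derivative
        act (frechet_derivative (B t) (at z) (0, i)) (X t z) + act (B t z) (Y t)) (at t within {0..1})"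
        unfolding Y_def
        by (intro has_vector_derivative_add volterra_has_vector_derivative t slice z
            fam_Ck_bilinear[OF act] DBC X DX B W)
    qed
    have E': "(E has_vector_derivative act (\<Omega> i (\<rho> t z)) (act (B t z) (X t z)) + act (?D i t (0, ?q)) (X t z))
        (at t within {0..1})" if t: "t \<in> {0..1}" for t
    proof -
      have "((\<lambda>t. \<rho> t z) has_derivative (\<lambda>s. s *\<^sub>R (0, ?q))) (at t within {0..1})"
        unfolding \<rho>_def by (auto intro!: derivative_eq_intros simp: scaleR_Pair)
      from has_derivative_compose[OF this D\<Omega>[OF i t]]
      have "((\<lambda>t. \<Omega> i (\<rho> t z)) has_vector_derivative ?D i t (0, ?q)) (at t within {0..1})"
        unfolding has_vector_derivative_def Dlin[OF i t] by simp
      from bounded_bilinear.has_vector_derivative[OF act this X'[OF t]]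
      show ?thesis unfolding E_def[abs_def] .
    qed
    have Z': "(Z has_vector_derivative act (B t z) (Z t)) (at t within {0..1})" if t: "t \<in> {0..1}" for t
    proof -
      have "((\<lambda>t. t *\<^sub>R E t) has_vector_derivative t *\<^sub>R (act (\<Omega> i (\<rho> t z)) (act (B t z) (X t z)) +
          act (?D i t (0, ?q)) (X t z)) + 1 *\<^sub>R E t) (at t within {0..1})"
        by (rule has_vector_derivative_scaleR[OF _ E'[OF t]]) (rule DERIV_ident)
      from has_vector_derivative_diff[OF Y'[OF t] this]
      have "(Z has_vector_derivative act (frechet_derivative (B t) (at z) (0, i)) (X t z) + act (B t z) (Y t) -
          (t *\<^sub>R (act (\<Omega> i (\<rho> t z)) (act (B t z) (X t z)) + act (?D i t (0, ?q)) (X t z)) + 1 *\<^sub>R E t))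
          (at t within {0..1})"
        unfolding Z_def[abs_def] .
      moreover have "act (frechet_derivative (B t) (at z) (0, i)) (X t z) + act (B t z) (Y t) -
          (t *\<^sub>R (act (\<Omega> i (\<rho> t z)) (act (B t z) (X t z)) + act (?D i t (0, ?q)) (X t z)) + 1 *\<^sub>R E t) =
          act (B t z) (Z t)"
      proof -
        let ?\<Omega> = "\<lambda>j. \<Omega> j (\<rho> t z)"
        note al = bounded_bilinear.add_left[OF act] bounded_bilinear.add_right[OF act]
          bounded_bilinear.scaleR_left[OF act] bounded_bilinear.scaleR_right[OF act]
          bounded_bilinear.diff_right[OF act] bounded_bilinear.sum_left[OF act]
          bounded_bilinear.sum_right[OF act]
        have Bx: "act (B t z) e = (\<Sum>j\<in>Basis. (?q \<bullet> j) *\<^sub>R act (?\<Omega> j) e)" for e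
          unfolding B_def al ..
        \<comment> \<open>This is where integrability enters.\<close>
        have s1: "act (\<Sum>j\<in>Basis. (?q \<bullet> j) *\<^sub>R ?D j t (0, i)) (X t z) + act (B t z) (E t) =
            act (?D i t (0, ?q)) (X t z) + act (?\<Omega> i) (act (B t z) (X t z))"
        proof -
          have "act (\<Sum>j\<in>Basis. (?q \<bullet> j) *\<^sub>R ?D j t (0, i)) (X t z) + act (B t z) (E t) =
              (\<Sum>j\<in>Basis. (?q \<bullet> j) *\<^sub>R (act (?D j t (0, i)) (X t z) + act (?\<Omega> j) (act (?\<Omega> i) (X t z))))"
            unfolding Bx E_def al scaleR_add_right sum.distrib ..
          also have "\<dots> = (\<Sum>j\<in>Basis. (?q \<bullet> j) *\<^sub>R (act (?D i t (0, j)) (X t z) + act (?\<Omega> i) (act (?\<Omega> j) (X t z))))"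
            by (intro sum.cong refl arg_cong[where f="scaleR _"] integ i) (use \<rho>W[OF t z] W_def in auto)
          also have "\<dots> = act (?D i t (0, ?q)) (X t z) + act (?\<Omega> i) (act (B t z) (X t z))"
            unfolding Dq[OF i t] Bx al scaleR_add_right sum.distrib ..
          finally show ?thesis .
        qed
        have s2: "act (frechet_derivative (B t) (at z) (0, i)) (X t z) =
            E t + t *\<^sub>R act (\<Sum>j\<in>Basis. (?q \<bullet> j) *\<^sub>R ?D j t (0, i)) (X t z)"
          unfolding DB[OF t] E_def al(1,3) ..
        have s3: "act (B t z) (Z t) = act (B t z) (Y t) - t *\<^sub>R act (B t z) (E t)"
          unfolding Z_def al(4,5) ..
        have "e + t *\<^sub>R d + y - (t *\<^sub>R (w + u) + 1 *\<^sub>R e) = y - t *\<^sub>R b" if "d + b = u + w" for e d y w u b :: 'e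
        proof -
          have "d = u + w - b" using that by (simp add: eq_diff_eq)
          show ?thesis unfolding \<open>d = u + w - b\<close> by (simp add: algebra_simps)
        qed
        from this[OF s1] show ?thesis
          unfolding s2 s3 .
      qed
      ultimately show ?thesis by simp
    qed
    have Z0: "Z 0 = 0"
      using Y_eq[of 0] by (simp add: Z_def volterra_def)
    have "Z 1 = 0"
    proof (rule volterra_unique[OF act, where A=B and D="\<lambda>t _. Z t" and x=z and t=1])
      show "continuous_on {0..1} (\<lambda>t. B t z)"
        by (rule slice[OF B z])
      show cZ: "continuous_on {0..1} Z"
        using Z' by (meson continuous_on_eq_continuous_within has_vector_derivative_continuous)
      show "Z t = volterra (\<lambda>t x. act (B t x) (Z t)) t z" if t: "t \<in> {0..1}" for t
        using volterra_eq_antiderivative[where f="\<lambda>t x. act (B t x) (Z t)" and P=Z and x=z, OF _ t Z']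
          bounded_bilinear.continuous_on[OF act slice[OF B z] cZ] Z0 by simp
    qed simp
    then show ?thesis
      by (simp add: Z_def Y_def E_def \<rho>_def)
  qed
  show thesis
  proof
    show "smooth_on (X 1) (L \<times> ball p0 r)"
      using fam_Ck_slice[OF X, of 1] by (simp add: smooth_on_def W_def)
    show "X 1 (c, p0) = x0" if "c \<in> L" for c
    proof -
      have "(c, p0) \<in> W" using that r by (simp add: W_def)
      from eq[OF _ this, of 1] show ?thesis
        by (simp add: volterra_def B_def bounded_bilinear.zero_left[OF act])
    qed
    show "frechet_derivative (X 1) (at z) (0, i) = act (\<Omega> i z) (X 1 z)"
      if "z \<in> L \<times> ball p0 r" "i \<in> Basis" for z i
      using main that unfolding W_def by blast
  qed
qed

section \<open>Partial derivatives\<close>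

lemma volterra_shift:
  fixes f :: "'a::euclidean_space \<Rightarrow> 'b::euclidean_space"
  assumes f: "smooth_on f U" and seg: "\<And>t. t \<in> {0..1} \<Longrightarrow> x + t *\<^sub>R w \<in> U" and t: "t \<in> {0..1}"
  shows "volterra (\<lambda>t x. frechet_derivative f (at (x + t *\<^sub>R w)) w) t x = f (x + t *\<^sub>R w) - f x"
proof -
  have der: "((\<lambda>t. f (x + t *\<^sub>R w)) has_vector_derivative frechet_derivative f (at (x + s *\<^sub>R w)) w)
      (at s within {0..1})" if s: "s \<in> {0..1}" for s
  proof -
    have "((\<lambda>t. x + t *\<^sub>R w) has_derivative (\<lambda>h. h *\<^sub>R w)) (at s within {0..1})"
      by (auto intro!: derivative_eq_intros)
    from has_derivative_compose[OF this smooth_on_has_derivative[OF f seg[OF s]]]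
    show ?thesis
      unfolding has_vector_derivative_def
        linear_scale[OF has_derivative_linear[OF smooth_on_has_derivative[OF f seg[OF s]]]] .
  qed
  have "continuous_on {0..1} (\<lambda>t. frechet_derivative f (at (x + t *\<^sub>R w)) w)"
    by (rule continuous_on_compose2[OF smooth_on_continuous[OF smooth_on_derivative[OF f]]])
      (use seg in \<open>auto intro!: continuous_intros\<close>)
  from volterra_eq_antiderivative[where f="\<lambda>t x. frechet_derivative f (at (x + t *\<^sub>R w)) w"
      and P="\<lambda>t. f (x + t *\<^sub>R w)", OF this t der]
  show ?thesis by simp
qed

text \<open>The increment of \<open>f\<close> along \<open>w\<close> is the time integral of its derivative in direction \<open>w\<close>.
  Differentiating this identity in direction \<open>u\<close>, under the integral, and then in time at 0 gives the
  symmetry for \<open>u\<close> and \<open>w\<close>. The vector \<open>w\<close> is a multiple of \<open>v\<close> short enough to stay in \<open>U\<close>.\<close>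

lemma second_derivative_commute:
  fixes f :: "'a::euclidean_space \<Rightarrow> 'b::euclidean_space"
  assumes f: "smooth_on f U" and U: "open U" and p: "p \<in> U"
  shows "frechet_derivative (\<lambda>x. frechet_derivative f (at x) u) (at p) v =
    frechet_derivative (\<lambda>x. frechet_derivative f (at x) v) (at p) u"
proof -
  obtain \<delta> where \<delta>: "\<delta> > 0" "ball p \<delta> \<subseteq> U"
    using U p openE by blast
  define \<epsilon> where "\<epsilon> = \<delta> / (2 * (norm v + 1))"
  define w where "w = \<epsilon> *\<^sub>R v"
  have \<epsilon>: "\<epsilon> > 0" and w: "norm w \<le> \<delta> / 2"
  proof -
    have "norm v + 1 > 0" by (simp add: add_nonneg_pos)
    then show "\<epsilon> > 0" using \<delta>(1) by (simp add: \<epsilon>_def)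
    have "\<delta> * norm v \<le> \<delta> * (norm v + 1)" using \<delta>(1) by simp
    then show "norm w \<le> \<delta> / 2"
      using \<open>norm v + 1 > 0\<close> \<delta>(1) by (simp add: w_def \<epsilon>_def field_simps)
  qed
  define N where "N = ball p (\<delta> / 2)"
  have N: "open N" "p \<in> N"
    using \<delta>(1) by (auto simp: N_def)
  have shift: "x + t *\<^sub>R w \<in> U" if "t \<in> {0..1}" "x \<in> N" for t x
  proof -
    have "norm (t *\<^sub>R w) \<le> 1 * norm w"
      unfolding norm_scaleR using that by (intro mult_right_mono) auto
    moreover have "dist p (x + t *\<^sub>R w) \<le> dist p x + norm (t *\<^sub>R w)"
      using norm_triangle_ineq[of "x - p" "t *\<^sub>R w"] by (simp add: dist_norm norm_minus_commute algebra_simps)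
    ultimately have "x + t *\<^sub>R w \<in> ball p \<delta>"
      using that w by (simp add: N_def)
    then show ?thesis using \<delta>(2) by blast
  qed
  have sh: "fam_Ck k {0..1} (\<lambda>t x. x + t *\<^sub>R w) N" for k
    by (intro fam_Ck_add fam_Ck_id fam_Ck_time N) (auto intro!: continuous_intros)
  have comp: "fam_Ck k {0..1} (\<lambda>t x. g (x + t *\<^sub>R w)) N" if "smooth_on g U" for k
    and g :: "'a \<Rightarrow> 'b"
    using that by (intro fam_Ck_compose[OF _ sh N(1) shift]) (auto simp: smooth_on_def)
  let ?h = "\<lambda>x. frechet_derivative f (at x) w"
  let ?H = "\<lambda>t x. ?h (x + t *\<^sub>R w)"
  have h: "smooth_on ?h U"
    by (rule smooth_on_derivative[OF f])
  have D: "frechet_derivative (\<lambda>x. g (x + t *\<^sub>R w)) (at x) u = frechet_derivative g (at (x + t *\<^sub>R w)) u"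
    if g: "smooth_on g U" and "t \<in> {0..1}" "x \<in> N" for g :: "'a \<Rightarrow> 'b" and t x
  proof -
    have "((\<lambda>x. x + t *\<^sub>R w) has_derivative (\<lambda>h. h)) (at x)"
      by (auto intro!: derivative_eq_intros)
    from has_derivative_compose[OF this smooth_on_has_derivative[OF g shift[OF that(2,3)]]]
    show ?thesis by (rule frechet_derivative_apply)
  qed
  have eq: "volterra (\<lambda>t x. frechet_derivative ?h (at (x + t *\<^sub>R w)) u) t p =
      frechet_derivative f (at (p + t *\<^sub>R w)) u - frechet_derivative f (at p) u"
    if t: "t \<in> {0..1}" for t
  proof -
    have "volterra (\<lambda>t x. frechet_derivative ?h (at (x + t *\<^sub>R w)) u) t p =
        volterra (\<lambda>t x. frechet_derivative (?H t) (at x) u) t p"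
      by (rule volterra_cong[OF _ t]) (use D[OF h _ N(2)] in simp)
    also have "\<dots> = frechet_derivative (volterra ?H t) (at p) u"
      using frechet_derivative_apply[OF volterra_has_derivative[OF comp[OF h] N(1) t N(2)]] by simp
    also have "\<dots> = frechet_derivative f (at (p + t *\<^sub>R w)) u - frechet_derivative f (at p) u"
    proof (rule frechet_derivative_apply)
      have "((\<lambda>x. f (x + t *\<^sub>R w)) has_derivative frechet_derivative (\<lambda>x. f (x + t *\<^sub>R w)) (at p)) (at p)"
        using fam_Ck_has_derivative[OF comp[OF f] t N(2)] .
      moreover have "frechet_derivative (\<lambda>x. f (x + t *\<^sub>R w)) (at p) = frechet_derivative f (at (p + t *\<^sub>R w))"
      proof -
        have "((\<lambda>x. x + t *\<^sub>R w) has_derivative (\<lambda>h. h)) (at p)"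
          by (auto intro!: derivative_eq_intros)
        from has_derivative_compose[OF this smooth_on_has_derivative[OF f shift[OF t N(2)]]]
        show ?thesis by (simp flip: frechet_derivative_at)
      qed
      ultimately have "((\<lambda>x. f (x + t *\<^sub>R w) - f x) has_derivative
          (\<lambda>u. frechet_derivative f (at (p + t *\<^sub>R w)) u - frechet_derivative f (at p) u)) (at p)"
        using has_derivative_diff[OF _ smooth_on_has_derivative[OF f p]] by metis
      then show "(volterra ?H t has_derivative
          (\<lambda>u. frechet_derivative f (at (p + t *\<^sub>R w)) u - frechet_derivative f (at p) u)) (at p)"
        by (rule has_derivative_transform_within_open[OF _ N])
          (use volterra_shift[OF f shift t] in auto)
    qed
    finally show ?thesis .
  qed
  have 0: "(0::real) \<in> {0..1}" by simp
  have "((\<lambda>t. volterra (\<lambda>t x. frechet_derivative ?h (at (x + t *\<^sub>R w)) u) t p) has_vector_derivative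
      frechet_derivative ?h (at (p + 0 *\<^sub>R w)) u) (at 0 within {0..1})"
    using fam_continuous_slice[OF fam_Ck_cont[OF comp[OF smooth_on_derivative[OF h]]] N(2)]
    by (intro volterra_has_vector_derivative 0)
  then have 1: "((\<lambda>t. frechet_derivative f (at (p + t *\<^sub>R w)) u - frechet_derivative f (at p) u)
      has_vector_derivative frechet_derivative ?h (at p) u) (at 0 within {0..1})"
    using has_vector_derivative_transform[OF 0 eq[symmetric]] by simp
  let ?k = "\<lambda>x. frechet_derivative f (at x) u"
  have kD: "(?k has_derivative frechet_derivative ?k (at p)) (at p)"
    by (rule smooth_on_has_derivative[OF smooth_on_derivative[OF f] p])
  have "((\<lambda>t. p + t *\<^sub>R w) has_derivative (\<lambda>h. h *\<^sub>R w)) (at 0 within {0..1})"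
    by (auto intro!: derivative_eq_intros)
  from has_derivative_compose[OF this, of ?k "frechet_derivative ?k (at p)"] kD
  have "((\<lambda>t. ?k (p + t *\<^sub>R w)) has_vector_derivative frechet_derivative ?k (at p) w) (at 0 within {0..1})"
    unfolding has_vector_derivative_def using linear_scale[OF has_derivative_linear[OF kD]] by simp
  from has_vector_derivative_diff[OF this has_vector_derivative_const, of "?k p"]
  have 2: "((\<lambda>t. ?k (p + t *\<^sub>R w) - ?k p) has_vector_derivative frechet_derivative ?k (at p) w) (at 0 within {0..1})"
    by simp
  have "frechet_derivative ?h (at p) u = frechet_derivative ?k (at p) w"
    using vector_derivative_unique_within_closed_interval[OF _ _ 1[folded cbox_interval] 2[folded cbox_interval]] by simp
  moreover have "frechet_derivative ?k (at p) w = \<epsilon> *\<^sub>R frechet_derivative ?k (at p) v"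
    unfolding w_def using linear_scale[OF has_derivative_linear[OF kD]] .
  moreover have "frechet_derivative ?h (at p) u = \<epsilon> *\<^sub>R frechet_derivative (\<lambda>x. frechet_derivative f (at x) v) (at p) u"
  proof (rule frechet_derivative_apply)
    have "((\<lambda>x. \<epsilon> *\<^sub>R frechet_derivative f (at x) v) has_derivative
        (\<lambda>u. \<epsilon> *\<^sub>R frechet_derivative (\<lambda>x. frechet_derivative f (at x) v) (at p) u)) (at p)"
      by (intro has_derivative_scaleR_right smooth_on_has_derivative[OF smooth_on_derivative[OF f] p])
    then show "(?h has_derivative
        (\<lambda>u. \<epsilon> *\<^sub>R frechet_derivative (\<lambda>x. frechet_derivative f (at x) v) (at p) u)) (at p)"
      by (rule has_derivative_transform_within_open[OF _ U p])
        (simp add: w_def linear_scale[OF has_derivative_linear[OF smooth_on_has_derivative[OF f]]])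
  qed
  ultimately show ?thesis using \<epsilon> by simp
qed

lemma partial_deriv_commute:
  fixes f :: "real^2 \<Rightarrow> 'b::euclidean_space"
  assumes "smooth_on f U" "open U" "p \<in> U"
  shows "partial_deriv i (partial_deriv j f) p = partial_deriv j (partial_deriv i f) p"
  using second_derivative_commute[OF assms] by (simp add: partial_deriv_def[abs_def])

lemma partial_derivI: "(f has_derivative f') (at p) \<Longrightarrow> partial_deriv i f p = f' (axis i 1)"
  unfolding partial_deriv_def by (rule frechet_derivative_apply)

lemma smooth_on_differentiable: "smooth_on f S \<Longrightarrow> x \<in> S \<Longrightarrow> f differentiable (at x)"
  using smooth_on_has_derivative differentiable_def by blast

lemma partial_deriv_cong:
  assumes "open U" "p \<in> U" "\<And>q. q \<in> U \<Longrightarrow> f q = g q"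
  shows "partial_deriv i f p = partial_deriv i g p"
proof -
  have "(f has_derivative d) (at p) \<longleftrightarrow> (g has_derivative d) (at p)" for d
    using has_derivative_transform_within_open[OF _ assms(1,2)] assms(3) by metis
  then show ?thesis
    by (simp add: partial_deriv_def frechet_derivative_def)
qed

lemma partial_deriv_const [simp]: "partial_deriv i (\<lambda>q. c) p = 0"
  by (rule partial_derivI[where f'="\<lambda>_. 0"]) simp

lemma partial_deriv_bilinear:
  assumes "bounded_bilinear B" "f differentiable (at p)" "g differentiable (at p)"
  shows "partial_deriv i (\<lambda>q. B (f q) (g q)) p = B (f p) (partial_deriv i g p) + B (partial_deriv i f p) (g p)"
  using partial_derivI[OF bounded_bilinear.FDERIV[OF assms(1)]] assms(2,3)
  by (simp add: frechet_derivative_works partial_deriv_def)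

lemmas partial_deriv_mult = partial_deriv_bilinear[OF bounded_bilinear_mult]
lemmas partial_deriv_inner = partial_deriv_bilinear[OF bounded_bilinear_inner]
lemmas partial_deriv_scaleR = partial_deriv_bilinear[OF bounded_bilinear_scaleR]

lemma partial_deriv_add:
  assumes "f differentiable (at p)" "g differentiable (at p)"
  shows "partial_deriv i (\<lambda>q. f q + g q) p = partial_deriv i f p + partial_deriv i g p"
  using partial_derivI[OF has_derivative_add] assms by (simp add: frechet_derivative_works partial_deriv_def)

lemma partial_deriv_minus:
  assumes "f differentiable (at p)"
  shows "partial_deriv i (\<lambda>q. - f q) p = - partial_deriv i f p"
  using partial_derivI[OF has_derivative_minus] assms by (simp add: frechet_derivative_works partial_deriv_def)

lemma partial_deriv_divide:
  fixes f g :: "real^2 \<Rightarrow> real"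
  assumes "f differentiable (at p)" "g differentiable (at p)" "g p \<noteq> 0"
  shows "partial_deriv i (\<lambda>q. f q / g q) p =
    partial_deriv i f p / g p - f p * partial_deriv i g p / (g p)\<^sup>2"
proof -
  have "((\<lambda>q. f q / g q) has_derivative (\<lambda>h. (frechet_derivative f (at p) h * g p - f p * frechet_derivative g (at p) h) / (g p * g p))) (at p)"
    using assms by (intro has_derivative_divide') (auto simp: frechet_derivative_works)
  from partial_derivI[OF this] show ?thesis
    using assms(3) by (simp add: partial_deriv_def field_simps power2_eq_square)
qed

lemma partial_deriv_sqrt:
  fixes f :: "real^2 \<Rightarrow> real"
  assumes "f differentiable (at p)" "f p > 0"
  shows "partial_deriv i (\<lambda>q. sqrt (f q)) p = partial_deriv i f p / (2 * sqrt (f p))"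
proof -
  have f: "(f has_derivative frechet_derivative f (at p)) (at p)"
    using assms by (simp add: frechet_derivative_works)
  have "((\<lambda>q. sqrt (f q)) has_derivative (\<lambda>h. frechet_derivative f (at p) h / (2 * sqrt (f p)))) (at p)"
    using assms(2) by (auto intro!: derivative_eq_intros f simp: field_simps)
  from partial_derivI[OF this] show ?thesis
    by (simp add: partial_deriv_def)
qed

section \<open>Curvature of an orthogonal metric\<close>

text \<open>For the metric with coefficients \<open>h1^2, h2^2\<close>, \<open>rot_coeff 2 h1 h2\<close> and \<open>rot_coeff 1 h2 h1\<close> are the
  rotation coefficients \<open>a\<close> and \<open>b\<close>.\<close>

definition rot_coeff :: "2 \<Rightarrow> (real^2 \<Rightarrow> real) \<Rightarrow> (real^2 \<Rightarrow> real) \<Rightarrow> real^2 \<Rightarrow> real" where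
  "rot_coeff i h k p = partial_deriv i h p / k p"

lemma smooth_on_rot_coeff:
  assumes "smooth_on h U" "smooth_on k U" "open U" "\<And>q. q \<in> U \<Longrightarrow> 0 < k q"
  shows "smooth_on (rot_coeff i h k) U"
  unfolding rot_coeff_def[abs_def]
  by (intro smooth_on_divide smooth_on_partial_deriv assms) (use assms(4) in force)

lemma matrix_inv_diag:
  fixes a b :: real
  assumes "a \<noteq> 0" "b \<noteq> 0"
  shows "matrix_inv (vector [vector [a, 0], vector [0, b]] :: real^2^2) =
    vector [vector [1 / a, 0], vector [0, 1 / b]]"
proof -
  let ?A = "vector [vector [a, 0], vector [0, b]] :: real^2^2"
  let ?B = "vector [vector [1 / a, 0], vector [0, 1 / b]] :: real^2^2"
  have AB: "?A ** ?B = mat 1" "?B ** ?A = mat 1"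
    using assms by (simp_all add: vec_eq_iff forall_2 matrix_matrix_mult_def sum_2 mat_def)
  then have "?A ** matrix_inv ?A = mat 1"
    unfolding matrix_inv_def
    using someI[of "\<lambda>C. ?A ** C = mat 1 \<and> C ** ?A = mat 1" ?B] by blast
  then have "?B ** (?A ** matrix_inv ?A) = ?B"
    by (simp add: matrix_mul_rid)
  then show ?thesis
    by (simp add: matrix_mul_assoc AB matrix_mul_lid)
qed

lemma diag_metric_nth [simp]:
  "diag_metric a b p $ 1 $ 1 = a p" "diag_metric a b p $ 1 $ 2 = 0"
  "diag_metric a b p $ 2 $ 1 = 0" "diag_metric a b p $ 2 $ 2 = b p"
  by (simp_all add: diag_metric_def)

context
  fixes U :: "(real^2) set" and E G h1 h2 :: "real^2 \<Rightarrow> real"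
  assumes U: "open U"
    and h: "smooth_on h1 U" "smooth_on h2 U" "\<And>q. q \<in> U \<Longrightarrow> 0 < h1 q" "\<And>q. q \<in> U \<Longrightarrow> 0 < h2 q"
    and EG: "\<And>q. q \<in> U \<Longrightarrow> E q = (h1 q)\<^sup>2" "\<And>q. q \<in> U \<Longrightarrow> G q = (h2 q)\<^sup>2"
begin

lemma christoffel_diag:
  assumes p: "p \<in> U"
  shows "christoffel (diag_metric E G) 1 1 1 p = partial_deriv 1 h1 p / h1 p"
    "christoffel (diag_metric E G) 1 1 2 p = rot_coeff 2 h1 h2 p * h2 p / h1 p"
    "christoffel (diag_metric E G) 1 2 1 p = rot_coeff 2 h1 h2 p * h2 p / h1 p"
    "christoffel (diag_metric E G) 1 2 2 p = - (rot_coeff 1 h2 h1 p * h2 p / h1 p)"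
    "christoffel (diag_metric E G) 2 1 2 p = partial_deriv 1 h2 p / h2 p"
    "christoffel (diag_metric E G) 2 2 2 p = partial_deriv 2 h2 p / h2 p"
proof -
  have dE: "partial_deriv i E p = 2 * h1 p * partial_deriv i h1 p"
    and dG: "partial_deriv i G p = 2 * h2 p * partial_deriv i h2 p" for i
    using partial_deriv_cong[OF U p, of E "\<lambda>q. h1 q * h1 q" i] partial_deriv_cong[OF U p, of G "\<lambda>q. h2 q * h2 q" i]
      EG h(1,2)[THEN smooth_on_differentiable, OF p]
    by (simp_all add: power2_eq_square partial_deriv_mult)
  have inv: "matrix_inv (diag_metric E G p) = vector [vector [1 / E p, 0], vector [0, 1 / G p]]"
    unfolding diag_metric_def using h(3,4)[OF p] EG[OF p] by (intro matrix_inv_diag) auto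
  show "christoffel (diag_metric E G) 1 1 1 p = partial_deriv 1 h1 p / h1 p"
    "christoffel (diag_metric E G) 1 1 2 p = rot_coeff 2 h1 h2 p * h2 p / h1 p"
    "christoffel (diag_metric E G) 1 2 1 p = rot_coeff 2 h1 h2 p * h2 p / h1 p"
    "christoffel (diag_metric E G) 1 2 2 p = - (rot_coeff 1 h2 h1 p * h2 p / h1 p)"
    "christoffel (diag_metric E G) 2 1 2 p = partial_deriv 1 h2 p / h2 p"
    "christoffel (diag_metric E G) 2 2 2 p = partial_deriv 2 h2 p / h2 p"
    using h(3,4)[OF p] EG[OF p]
    by (simp_all add: christoffel_def sum_2 inv dE dG rot_coeff_def power2_eq_square field_simps)
qed

text \<open>The Christoffel symbols are written through the rotation coefficients, so that the
  terms without second derivatives cancel.\<close>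

lemma riemann_diag:
  assumes p: "p \<in> U"
  shows "riemann (diag_metric E G) 1 2 1 2 p =
    - (partial_deriv 1 (rot_coeff 1 h2 h1) p + partial_deriv 2 (rot_coeff 2 h1 h2) p) * h2 p / h1 p"
proof -
  have rs: "smooth_on (rot_coeff 1 h2 h1) U" "smooth_on (rot_coeff 2 h1 h2) U"
    using h U by (simp_all add: smooth_on_rot_coeff)
  have q: "smooth_on (\<lambda>q. h2 q / h1 q) U"
    using h(3) by (intro smooth_on_divide h U) force
  note d = h(1,2)[THEN smooth_on_differentiable, OF p] rs[THEN smooth_on_differentiable, OF p]
    q[THEN smooth_on_differentiable, OF p]
    smooth_on_mult[OF rs(1) q U, THEN smooth_on_differentiable, OF p]
  have p1: "partial_deriv 1 (christoffel (diag_metric E G) 1 2 2) p =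
      - (rot_coeff 1 h2 h1 p * partial_deriv 1 (\<lambda>q. h2 q / h1 q) p + partial_deriv 1 (rot_coeff 1 h2 h1) p * (h2 p / h1 p))"
  proof -
    have "partial_deriv 1 (christoffel (diag_metric E G) 1 2 2) p =
        partial_deriv 1 (\<lambda>q. - (rot_coeff 1 h2 h1 q * (h2 q / h1 q))) p"
      by (rule partial_deriv_cong[OF U p]) (simp add: christoffel_diag)
    then show ?thesis
      using d by (simp add: partial_deriv_minus partial_deriv_mult del: times_divide_eq_right)
  qed
  have p2: "partial_deriv 2 (christoffel (diag_metric E G) 1 1 2) p =
      rot_coeff 2 h1 h2 p * partial_deriv 2 (\<lambda>q. h2 q / h1 q) p + partial_deriv 2 (rot_coeff 2 h1 h2) p * (h2 p / h1 p)"
  proof -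
    have "partial_deriv 2 (christoffel (diag_metric E G) 1 1 2) p =
        partial_deriv 2 (\<lambda>q. rot_coeff 2 h1 h2 q * (h2 q / h1 q)) p"
      by (rule partial_deriv_cong[OF U p]) (simp add: christoffel_diag)
    then show ?thesis
      using d by (simp add: partial_deriv_mult del: times_divide_eq_right)
  qed
  have pq: "partial_deriv i (\<lambda>q. h2 q / h1 q) p =
      partial_deriv i h2 p / h1 p - h2 p * partial_deriv i h1 p / (h1 p)\<^sup>2" for i
    using d h(3)[OF p] by (intro partial_deriv_divide) auto
  have rot: "partial_deriv 1 h2 p = rot_coeff 1 h2 h1 p * h1 p" "partial_deriv 2 h1 p = rot_coeff 2 h1 h2 p * h2 p"
    using h(3,4)[OF p] by (simp_all add: rot_coeff_def)
  show ?thesis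
    using h(3,4)[OF p]
    by (simp add: riemann_def sum_2 p1 p2 pq christoffel_diag[OF p] rot power2_eq_square field_simps)
qed

lemma gauss_curvature_diag:
  assumes p: "p \<in> U"
  shows "gauss_curvature (diag_metric E G) p =
    - (partial_deriv 1 (rot_coeff 1 h2 h1) p + partial_deriv 2 (rot_coeff 2 h1 h2) p) / (h1 p * h2 p)"
  using h(3,4)[OF p] EG[OF p]
  by (simp add: gauss_curvature_def sum_2 det_2 riemann_diag[OF p] power2_eq_square field_simps)

end

lemma partial_deriv_other_coordinate:
  fixes f :: "real \<Rightarrow> real"
  assumes "(\<lambda>q. f (q $ j)) differentiable (at p)" "i \<noteq> j"
  shows "partial_deriv i (\<lambda>q. f (q $ j)) p = 0"
proof -
  let ?F = "\<lambda>q :: real^2. f (q $ j)"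
  have F: "(?F has_derivative frechet_derivative ?F (at p)) (at p)"
    using assms(1) by (simp add: frechet_derivative_works)
  have "((\<lambda>t. p + t *\<^sub>R axis i 1) has_derivative (\<lambda>t. t *\<^sub>R axis i 1)) (at (0::real))"
    by (auto intro!: derivative_eq_intros)
  from has_derivative_compose[OF this, of ?F "frechet_derivative ?F (at p)"] F
  have "((\<lambda>t. f ((p + t *\<^sub>R axis i 1) $ j)) has_derivative (\<lambda>t. frechet_derivative ?F (at p) (t *\<^sub>R axis i 1))) (at 0)"
    by simp
  moreover have "(\<lambda>t. f ((p + t *\<^sub>R axis i 1) $ j)) = (\<lambda>t. f (p $ j))"
    using assms(2) by (simp add: axis_def)
  ultimately have "(\<lambda>t. frechet_derivative ?F (at p) (t *\<^sub>R axis i 1)) = (\<lambda>t. 0)"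
    using has_derivative_unique[OF _ has_derivative_const] by metis
  then have "frechet_derivative ?F (at p) (1 *\<^sub>R axis i 1) = 0"
    by metis
  then show ?thesis by (simp add: partial_deriv_def)
qed

text \<open>This is \<open>(1 - K) * h1 * h2\<close>, with \<open>K\<close> the Gaussian curvature of the metric \<open>h1^2, h2^2\<close>.\<close>

definition gauss_defect :: "(real^2 \<Rightarrow> real) \<Rightarrow> (real^2 \<Rightarrow> real) \<Rightarrow> real^2 \<Rightarrow> real" where
  "gauss_defect h1 h2 p = partial_deriv 1 (rot_coeff 1 h2 h1) p + partial_deriv 2 (rot_coeff 2 h1 h2) p + h1 p * h2 p"

text \<open>The part of the defect of the deformed metric that does not depend on \<open>\<mu>\<close>, after multiplication by
  the square roots of \<open>\<mu> + f1\<close> and \<open>\<mu> + f2\<close>.\<close>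

definition weighted_defect ::
    "(real^2 \<Rightarrow> real) \<Rightarrow> (real^2 \<Rightarrow> real) \<Rightarrow> (real^2 \<Rightarrow> real) \<Rightarrow> (real^2 \<Rightarrow> real) \<Rightarrow> real^2 \<Rightarrow> real" where
  "weighted_defect H1 H2 f1 f2 p =
     f1 p * partial_deriv 1 (rot_coeff 1 H2 H1) p + f2 p * partial_deriv 2 (rot_coeff 2 H1 H2) p +
     (rot_coeff 1 H2 H1 p * partial_deriv 1 f1 p + rot_coeff 2 H1 H2 p * partial_deriv 2 f2 p) / 2 + H1 p * H2 p"

context
  fixes U :: "(real^2) set" and H1 H2 f1 f2 :: "real^2 \<Rightarrow> real" and \<mu> :: real
  assumes U: "open U"
    and H: "smooth_on H1 U" "smooth_on H2 U" "\<And>q. q \<in> U \<Longrightarrow> 0 < H1 q" "\<And>q. q \<in> U \<Longrightarrow> 0 < H2 q"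
    and f: "smooth_on f1 U" "smooth_on f2 U"
      "\<And>q. q \<in> U \<Longrightarrow> partial_deriv 2 f1 q = 0" "\<And>q. q \<in> U \<Longrightarrow> partial_deriv 1 f2 q = 0"
    and pos: "\<And>q. q \<in> U \<Longrightarrow> 0 < \<mu> + f1 q" "\<And>q. q \<in> U \<Longrightarrow> 0 < \<mu> + f2 q"
begin

lemma deform_sqrt_smooth: "smooth_on (\<lambda>q. sqrt (\<mu> + f1 q)) U" "smooth_on (\<lambda>q. sqrt (\<mu> + f2 q)) U"
  using smooth_on_sqrt[OF smooth_on_add[OF smooth_on_const[OF U] f(1) U] U pos(1)]
    smooth_on_sqrt[OF smooth_on_add[OF smooth_on_const[OF U] f(2) U] U pos(2)] by blast+

lemma deform_sqrt_pos: "q \<in> U \<Longrightarrow> 0 < sqrt (\<mu> + f1 q)" "q \<in> U \<Longrightarrow> 0 < sqrt (\<mu> + f2 q)"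
  using pos by simp_all

lemma deform_partial:
  assumes p: "p \<in> U"
  shows "partial_deriv i (\<lambda>q. sqrt (\<mu> + f1 q)) p = partial_deriv i f1 p / (2 * sqrt (\<mu> + f1 p))"
    "partial_deriv i (\<lambda>q. sqrt (\<mu> + f2 q)) p = partial_deriv i f2 p / (2 * sqrt (\<mu> + f2 p))"
proof -
  have s: "smooth_on (\<lambda>q. \<mu> + f1 q) U" "smooth_on (\<lambda>q. \<mu> + f2 q) U" "smooth_on (\<lambda>q. \<mu>) U"
    by (intro smooth_on_add smooth_on_const U f)+
  note d = s[THEN smooth_on_differentiable, OF p] f(1,2)[THEN smooth_on_differentiable, OF p]
  show "partial_deriv i (\<lambda>q. sqrt (\<mu> + f1 q)) p = partial_deriv i f1 p / (2 * sqrt (\<mu> + f1 p))"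
    "partial_deriv i (\<lambda>q. sqrt (\<mu> + f2 q)) p = partial_deriv i f2 p / (2 * sqrt (\<mu> + f2 p))"
    using d pos[OF p] by (simp_all add: partial_deriv_sqrt partial_deriv_add)
qed

lemma deform_smooth:
  "smooth_on (\<lambda>q. H1 q / sqrt (\<mu> + f1 q)) U" "smooth_on (\<lambda>q. H2 q / sqrt (\<mu> + f2 q)) U"
  using deform_sqrt_pos by (intro smooth_on_divide H U deform_sqrt_smooth; force)+

lemma deform_partial_H:
  assumes p: "p \<in> U"
  shows "partial_deriv 2 (\<lambda>q. H1 q / sqrt (\<mu> + f1 q)) p = partial_deriv 2 H1 p / sqrt (\<mu> + f1 p)"
    "partial_deriv 1 (\<lambda>q. H2 q / sqrt (\<mu> + f2 q)) p = partial_deriv 1 H2 p / sqrt (\<mu> + f2 p)"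
  using deform_sqrt_pos[OF p] f(3,4)[OF p] deform_partial[OF p]
    H(1,2)[THEN smooth_on_differentiable, OF p] deform_sqrt_smooth[THEN smooth_on_differentiable, OF p]
  by (simp_all add: partial_deriv_divide)

lemma deform_rot_coeff:
  assumes p: "p \<in> U"
  shows "rot_coeff 2 (\<lambda>q. H1 q / sqrt (\<mu> + f1 q)) (\<lambda>q. H2 q / sqrt (\<mu> + f2 q)) p =
      rot_coeff 2 H1 H2 p * (sqrt (\<mu> + f2 p) / sqrt (\<mu> + f1 p))"
    "rot_coeff 1 (\<lambda>q. H2 q / sqrt (\<mu> + f2 q)) (\<lambda>q. H1 q / sqrt (\<mu> + f1 q)) p =
      rot_coeff 1 H2 H1 p * (sqrt (\<mu> + f1 p) / sqrt (\<mu> + f2 p))"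
  by (simp_all add: rot_coeff_def deform_partial_H[OF p])

text \<open>The square roots enter the two rotation coefficients through reciprocal ratios, so that multiplication
  by their product leaves no square root. The coefficient of \<open>\<mu>\<close> measures the curvature of the metric
  \<open>H1^2, H2^2\<close>.\<close>

lemma gauss_defect_deform:
  assumes p: "p \<in> U"
  shows "gauss_defect (\<lambda>q. H1 q / sqrt (\<mu> + f1 q)) (\<lambda>q. H2 q / sqrt (\<mu> + f2 q)) p
      * (sqrt (\<mu> + f1 p) * sqrt (\<mu> + f2 p)) =
    \<mu> * (partial_deriv 1 (rot_coeff 1 H2 H1) p + partial_deriv 2 (rot_coeff 2 H1 H2) p) + weighted_defect H1 H2 f1 f2 p"
proof -
  let ?s1 = "\<lambda>q. sqrt (\<mu> + f1 q)" and ?s2 = "\<lambda>q. sqrt (\<mu> + f2 q)"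
  have rs: "smooth_on (rot_coeff 1 H2 H1) U" "smooth_on (rot_coeff 2 H1 H2) U"
    using H U by (simp_all add: smooth_on_rot_coeff)
  have q: "smooth_on (\<lambda>q. ?s1 q / ?s2 q) U" "smooth_on (\<lambda>q. ?s2 q / ?s1 q) U"
    using deform_sqrt_pos by (intro smooth_on_divide U deform_sqrt_smooth; force)+
  note d = rs[THEN smooth_on_differentiable, OF p] q[THEN smooth_on_differentiable, OF p]
    deform_sqrt_smooth[THEN smooth_on_differentiable, OF p]
  note s = deform_sqrt_pos[OF p]
  have sq: "?s1 p * ?s1 p = \<mu> + f1 p" "?s2 p * ?s2 p = \<mu> + f2 p"
    using pos[OF p] by simp_all
  have alg: "(A * (B / (2 * x) / y) + C * (x / y)) * (x * y) = x * x * C + A * B / 2"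
    if "0 < x" "0 < y" for A B C x y :: real
    using that by (simp add: field_simps)
  have 1: "partial_deriv 1 (rot_coeff 1 (\<lambda>q. H2 q / ?s2 q) (\<lambda>q. H1 q / ?s1 q)) p * (?s1 p * ?s2 p) =
      (\<mu> + f1 p) * partial_deriv 1 (rot_coeff 1 H2 H1) p + rot_coeff 1 H2 H1 p * partial_deriv 1 f1 p / 2"
  proof -
    have "partial_deriv 1 (rot_coeff 1 (\<lambda>q. H2 q / ?s2 q) (\<lambda>q. H1 q / ?s1 q)) p =
        partial_deriv 1 (\<lambda>q. rot_coeff 1 H2 H1 q * (?s1 q / ?s2 q)) p"
      by (rule partial_deriv_cong[OF U p]) (simp add: deform_rot_coeff)
    also have "\<dots> = rot_coeff 1 H2 H1 p * (partial_deriv 1 f1 p / (2 * ?s1 p) / ?s2 p) +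
        partial_deriv 1 (rot_coeff 1 H2 H1) p * (?s1 p / ?s2 p)"
      using d s by (simp add: partial_deriv_mult partial_deriv_divide deform_partial[OF p] f(4)[OF p]
          del: times_divide_eq_right)
    finally have e: "partial_deriv 1 (rot_coeff 1 (\<lambda>q. H2 q / ?s2 q) (\<lambda>q. H1 q / ?s1 q)) p = \<dots>" .
    show ?thesis
      unfolding e alg[OF s] sq ..
  qed
  have 2: "partial_deriv 2 (rot_coeff 2 (\<lambda>q. H1 q / ?s1 q) (\<lambda>q. H2 q / ?s2 q)) p * (?s1 p * ?s2 p) =
      (\<mu> + f2 p) * partial_deriv 2 (rot_coeff 2 H1 H2) p + rot_coeff 2 H1 H2 p * partial_deriv 2 f2 p / 2"
  proof -
    have "partial_deriv 2 (rot_coeff 2 (\<lambda>q. H1 q / ?s1 q) (\<lambda>q. H2 q / ?s2 q)) p =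
        partial_deriv 2 (\<lambda>q. rot_coeff 2 H1 H2 q * (?s2 q / ?s1 q)) p"
      by (rule partial_deriv_cong[OF U p]) (simp add: deform_rot_coeff)
    also have "\<dots> = rot_coeff 2 H1 H2 p * (partial_deriv 2 f2 p / (2 * ?s2 p) / ?s1 p) +
        partial_deriv 2 (rot_coeff 2 H1 H2) p * (?s2 p / ?s1 p)"
      using d s by (simp add: partial_deriv_mult partial_deriv_divide deform_partial[OF p] f(3)[OF p]
          del: times_divide_eq_right)
    finally have e: "partial_deriv 2 (rot_coeff 2 (\<lambda>q. H1 q / ?s1 q) (\<lambda>q. H2 q / ?s2 q)) p = \<dots>" .
    show ?thesis
      unfolding e mult.commute[of "?s1 p" "?s2 p"] alg[OF s(2,1)] sq ..
  qed
  have 3: "(H1 p / ?s1 p) * (H2 p / ?s2 p) * (?s1 p * ?s2 p) = H1 p * H2 p"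
    using s by simp
  show ?thesis
    unfolding gauss_defect_def weighted_defect_def distrib_right 1 2 3 by (simp add: algebra_simps)
qed

lemma gauss_defect_deform_zero:
  assumes "p \<in> U" "partial_deriv 1 (rot_coeff 1 H2 H1) p + partial_deriv 2 (rot_coeff 2 H1 H2) p = 0"
    "weighted_defect H1 H2 f1 f2 p = 0"
  shows "gauss_defect (\<lambda>q. H1 q / sqrt (\<mu> + f1 q)) (\<lambda>q. H2 q / sqrt (\<mu> + f2 q)) p = 0"
  using gauss_defect_deform[OF assms(1)] deform_sqrt_pos[OF assms(1)] unfolding assms(2,3) by simp

end

section \<open>Orthonormal moving frames\<close>

definition orthonormal3 :: "real^3 \<Rightarrow> real^3 \<Rightarrow> real^3 \<Rightarrow> bool" where
  "orthonormal3 e1 e2 e3 \<longleftrightarrow> e1 \<bullet> e1 = 1 \<and> e2 \<bullet> e2 = 1 \<and> e3 \<bullet> e3 = 1 \<and>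
     e1 \<bullet> e2 = 0 \<and> e1 \<bullet> e3 = 0 \<and> e2 \<bullet> e3 = 0"

text \<open>A square matrix has orthonormal rows iff it has orthonormal columns. In the sum on the right
  each vector of the frame is paired only with itself, which makes it easy to differentiate.\<close>

lemma orthonormal3_iff_parseval:
  "orthonormal3 e1 e2 e3 \<longleftrightarrow>
     (\<forall>x y. (x \<bullet> e1) * (y \<bullet> e1) + (x \<bullet> e2) * (y \<bullet> e2) + (x \<bullet> e3) * (y \<bullet> e3) = x \<bullet> y)"
proof -
  let ?A = "vector [e1, e2, e3] :: real^3^3"
  have rows: "(?A *v x) \<bullet> (?A *v y) = (x \<bullet> e1) * (y \<bullet> e1) + (x \<bullet> e2) * (y \<bullet> e2) + (x \<bullet> e3) * (y \<bullet> e3)" for x y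
    by (simp add: matrix_vector_mult_def inner_vec_def sum_3 mult_ac)
  have tr: "(?A *v x) \<bullet> (?A *v y) = (transpose ?A ** ?A *v x) \<bullet> y" for x y
    unfolding dot_lmul_matrix[symmetric] transpose_matrix_vector[symmetric] matrix_vector_mul_assoc ..
  have "orthonormal3 e1 e2 e3 \<longleftrightarrow> ?A ** transpose ?A = mat 1"
    by (auto simp: orthonormal3_def vec_eq_iff forall_3 matrix_matrix_mult_def transpose_def mat_def
        inner_vec_def sum_3 mult_ac)
  also have "\<dots> \<longleftrightarrow> transpose ?A ** ?A = mat 1"
    by (rule matrix_left_right_inverse)
  also have "\<dots> \<longleftrightarrow> (\<forall>x y. (?A *v x) \<bullet> (?A *v y) = x \<bullet> y)"
  proof
    assume "transpose ?A ** ?A = mat 1"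
    then show "\<forall>x y. (?A *v x) \<bullet> (?A *v y) = x \<bullet> y"
      unfolding tr by simp
  next
    assume *: "\<forall>x y. (?A *v x) \<bullet> (?A *v y) = x \<bullet> y"
    then have "transpose ?A ** ?A *v x = mat 1 *v x" for x
      unfolding tr by (simp add: vector_eq_rdot)
    then show "transpose ?A ** ?A = mat 1"
      using matrix_eq by blast
  qed
  finally show ?thesis unfolding rows .
qed

lemmas orthonormal3_parseval = orthonormal3_iff_parseval[THEN iffD1, rule_format]

lemma orthonormal3_eqI:
  assumes "orthonormal3 e1 e2 e3" "x \<bullet> e1 = y \<bullet> e1" "x \<bullet> e2 = y \<bullet> e2" "x \<bullet> e3 = y \<bullet> e3"
  shows "x = y"
proof -
  have "(x - y) \<bullet> (x - y) = 0"
    using orthonormal3_parseval[OF assms(1), of "x - y" "x - y"] assms(2-4) by (simp add: inner_diff_left)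
  then show ?thesis by simp
qed

lemma inner_deriv_const:
  fixes f g :: "real^2 \<Rightarrow> real^3"
  assumes "smooth_on f U" "smooth_on g U" "open U" "p \<in> U" "\<And>q. q \<in> U \<Longrightarrow> f q \<bullet> g q = c"
  shows "partial_deriv i f p \<bullet> g p = - (f p \<bullet> partial_deriv i g p)"
proof -
  have "partial_deriv i (\<lambda>q. f q \<bullet> g q) p = partial_deriv i (\<lambda>q. c) p"
    by (rule partial_deriv_cong[OF assms(3,4)]) (rule assms(5))
  then show ?thesis
    using assms by (simp add: partial_deriv_inner smooth_on_differentiable)
qed

context
  fixes U :: "(real^2) set" and e1 e2 n :: "real^2 \<Rightarrow> real^3" and h1 h2 :: "real^2 \<Rightarrow> real"
  assumes U: "open U"
    and smooth: "smooth_on e1 U" "smooth_on e2 U" "smooth_on n U" "smooth_on h1 U" "smooth_on h2 U"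
    and pos: "\<And>q. q \<in> U \<Longrightarrow> 0 < h1 q" "\<And>q. q \<in> U \<Longrightarrow> 0 < h2 q"
    and onb: "\<And>q. q \<in> U \<Longrightarrow> orthonormal3 (e1 q) (e2 q) (n q)"
    and dn: "\<And>q. q \<in> U \<Longrightarrow> partial_deriv 1 n q = h1 q *\<^sub>R e1 q"
      "\<And>q. q \<in> U \<Longrightarrow> partial_deriv 2 n q = h2 q *\<^sub>R e2 q"
begin

text \<open>Differentiating the constant inner products leaves only \<open>d1 e2 . e1\<close> and \<open>d2 e1 . e2\<close> undetermined.
  These follow from the symmetry of the second derivatives of \<open>n\<close>.\<close>

lemma frame_connection:
  assumes p: "p \<in> U"
  shows "partial_deriv 1 e1 p \<bullet> e1 p = 0" "partial_deriv 1 e1 p \<bullet> e2 p = - rot_coeff 2 h1 h2 p"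
    "partial_deriv 1 e1 p \<bullet> n p = - h1 p"
    "partial_deriv 2 e1 p \<bullet> e1 p = 0" "partial_deriv 2 e1 p \<bullet> e2 p = rot_coeff 1 h2 h1 p"
    "partial_deriv 2 e1 p \<bullet> n p = 0"
    "partial_deriv 1 e2 p \<bullet> e1 p = rot_coeff 2 h1 h2 p" "partial_deriv 1 e2 p \<bullet> e2 p = 0"
    "partial_deriv 1 e2 p \<bullet> n p = 0"
    "partial_deriv 2 e2 p \<bullet> e1 p = - rot_coeff 1 h2 h1 p" "partial_deriv 2 e2 p \<bullet> e2 p = 0"
    "partial_deriv 2 e2 p \<bullet> n p = - h2 p"
proof -
  have on: "e1 q \<bullet> e1 q = 1" "e2 q \<bullet> e2 q = 1" "n q \<bullet> n q = 1" "e1 q \<bullet> e2 q = 0"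
    "e1 q \<bullet> n q = 0" "e2 q \<bullet> n q = 0" "e2 q \<bullet> e1 q = 0" if "q \<in> U" for q
    using onb[OF that] by (auto simp: orthonormal3_def inner_commute)
  note D = inner_deriv_const[OF _ _ U p]
  have s: "partial_deriv i e1 p \<bullet> e1 p = 0" "partial_deriv i e2 p \<bullet> e2 p = 0" for i
    using D[OF smooth(1,1) on(1), of i] D[OF smooth(2,2) on(2), of i] by (simp_all add: inner_commute)
  have c: "partial_deriv i e1 p \<bullet> e2 p = - (partial_deriv i e2 p \<bullet> e1 p)" for i
    using D[OF smooth(1,2) on(4), of i] by (simp add: inner_commute)
  show "partial_deriv 1 e1 p \<bullet> e1 p = 0" "partial_deriv 2 e1 p \<bullet> e1 p = 0"
    "partial_deriv 1 e2 p \<bullet> e2 p = 0" "partial_deriv 2 e2 p \<bullet> e2 p = 0"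
    by (simp_all add: s)
  show "partial_deriv 1 e1 p \<bullet> n p = - h1 p" "partial_deriv 2 e1 p \<bullet> n p = 0"
    "partial_deriv 1 e2 p \<bullet> n p = 0" "partial_deriv 2 e2 p \<bullet> n p = - h2 p"
    using D[OF smooth(1,3) on(5), of 1] D[OF smooth(1,3) on(5), of 2]
      D[OF smooth(2,3) on(6), of 1] D[OF smooth(2,3) on(6), of 2]
    by (simp_all add: dn[OF p] on[OF p])
  note d = smooth[THEN smooth_on_differentiable, OF p]
  have "partial_deriv 1 (partial_deriv 2 n) p = partial_deriv 2 (partial_deriv 1 n) p"
    by (rule partial_deriv_commute[OF smooth(3) U p])
  moreover have "partial_deriv 1 (partial_deriv 2 n) p = h2 p *\<^sub>R partial_deriv 1 e2 p + partial_deriv 1 h2 p *\<^sub>R e2 p"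
    using partial_deriv_cong[OF U p, of "partial_deriv 2 n" "\<lambda>q. h2 q *\<^sub>R e2 q" 1] dn(2) d
    by (simp add: partial_deriv_scaleR)
  moreover have "partial_deriv 2 (partial_deriv 1 n) p = h1 p *\<^sub>R partial_deriv 2 e1 p + partial_deriv 2 h1 p *\<^sub>R e1 p"
    using partial_deriv_cong[OF U p, of "partial_deriv 1 n" "\<lambda>q. h1 q *\<^sub>R e1 q" 2] dn(1) d
    by (simp add: partial_deriv_scaleR)
  ultimately have mixed: "h2 p *\<^sub>R partial_deriv 1 e2 p + partial_deriv 1 h2 p *\<^sub>R e2 p =
      h1 p *\<^sub>R partial_deriv 2 e1 p + partial_deriv 2 h1 p *\<^sub>R e1 p" by simp
  from arg_cong[OF this, of "\<lambda>v. v \<bullet> e1 p"] arg_cong[OF this, of "\<lambda>v. v \<bullet> e2 p"]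
  have m: "h2 p * (partial_deriv 1 e2 p \<bullet> e1 p) = partial_deriv 2 h1 p"
    "h1 p * (partial_deriv 2 e1 p \<bullet> e2 p) = partial_deriv 1 h2 p"
    by (simp_all add: inner_add_left s on[OF p])
  show e: "partial_deriv 1 e2 p \<bullet> e1 p = rot_coeff 2 h1 h2 p" "partial_deriv 2 e1 p \<bullet> e2 p = rot_coeff 1 h2 h1 p"
    using pos[OF p] by (simp_all add: rot_coeff_def m[symmetric])
  show "partial_deriv 1 e1 p \<bullet> e2 p = - rot_coeff 2 h1 h2 p" "partial_deriv 2 e2 p \<bullet> e1 p = - rot_coeff 1 h2 h1 p"
    using c[of 1] c[of 2] e by simp_all
qed

text \<open>Theorema egregium for the unit sphere: \<open>d1 b + d2 a\<close> is the derivative of the connection form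
  \<open>d e1 . e2\<close>. The second derivatives of \<open>e1\<close> cancel, and what is left is \<open>d2 e1 . d1 e2 - d1 e1 . d2 e2\<close>,
  where only the components along \<open>n\<close> contribute.\<close>

lemma frame_gauss:
  assumes p: "p \<in> U"
  shows "gauss_defect h1 h2 p = 0"
proof -
  note d = smooth[THEN smooth_on_differentiable, OF p]
    smooth(1)[THEN smooth_on_partial_deriv, THEN smooth_on_differentiable, OF p]
  have "partial_deriv 1 (rot_coeff 1 h2 h1) p = partial_deriv 1 (\<lambda>q. partial_deriv 2 e1 q \<bullet> e2 q) p"
    by (rule partial_deriv_cong[OF U p]) (simp add: frame_connection)
  then have b: "partial_deriv 1 (rot_coeff 1 h2 h1) p =
      partial_deriv 2 e1 p \<bullet> partial_deriv 1 e2 p + partial_deriv 1 (partial_deriv 2 e1) p \<bullet> e2 p"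
    using d by (simp add: partial_deriv_inner)
  have "partial_deriv 2 (rot_coeff 2 h1 h2) p = partial_deriv 2 (\<lambda>q. - (partial_deriv 1 e1 q \<bullet> e2 q)) p"
    by (rule partial_deriv_cong[OF U p]) (simp add: frame_connection)
  then have a: "partial_deriv 2 (rot_coeff 2 h1 h2) p =
      - (partial_deriv 1 e1 p \<bullet> partial_deriv 2 e2 p + partial_deriv 2 (partial_deriv 1 e1) p \<bullet> e2 p)"
    using d smooth_on_inner[OF smooth_on_partial_deriv[OF smooth(1)] smooth(2) U, THEN smooth_on_differentiable, OF p]
    by (simp add: partial_deriv_inner partial_deriv_minus)
  have "partial_deriv 2 e1 p \<bullet> partial_deriv 1 e2 p = 0"
    "partial_deriv 1 e1 p \<bullet> partial_deriv 2 e2 p = h1 p * h2 p"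
    using orthonormal3_parseval[OF onb[OF p], of "partial_deriv 2 e1 p" "partial_deriv 1 e2 p"]
      orthonormal3_parseval[OF onb[OF p], of "partial_deriv 1 e1 p" "partial_deriv 2 e2 p"]
    by (simp_all add: frame_connection[OF p])
  then show ?thesis
    unfolding gauss_defect_def a b
    by (simp add: partial_deriv_commute[OF smooth(1) U p, of 1 2])
qed

text \<open>Both equations are components of \<open>d1 d2 r = d2 d1 r\<close>.\<close>

lemma frame_codazzi:
  fixes r :: "real^2 \<Rightarrow> real^3"
  assumes p: "p \<in> U" and k: "smooth_on k1 U" "smooth_on k2 U" and r: "smooth_on r U"
    and dr: "\<And>q. q \<in> U \<Longrightarrow> partial_deriv 1 r q = - (k1 q *\<^sub>R partial_deriv 1 n q)"
      "\<And>q. q \<in> U \<Longrightarrow> partial_deriv 2 r q = - (k2 q *\<^sub>R partial_deriv 2 n q)"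
  shows "partial_deriv 2 k1 p * h1 p = (k2 p - k1 p) * partial_deriv 2 h1 p"
    "partial_deriv 1 k2 p * h2 p = (k1 p - k2 p) * partial_deriv 1 h2 p"
proof -
  have on: "e1 p \<bullet> e1 p = 1" "e2 p \<bullet> e2 p = 1" "e1 p \<bullet> e2 p = 0" "e2 p \<bullet> e1 p = 0"
    using onb[OF p] by (auto simp: orthonormal3_def inner_commute)
  have kh: "smooth_on (\<lambda>q. - (k1 q * h1 q)) U" "smooth_on (\<lambda>q. - (k2 q * h2 q)) U"
    "smooth_on (\<lambda>q. k1 q * h1 q) U" "smooth_on (\<lambda>q. k2 q * h2 q) U"
    by (intro smooth_on_minus smooth_on_mult k smooth U)+
  note d = smooth[THEN smooth_on_differentiable, OF p] k[THEN smooth_on_differentiable, OF p]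
    kh[THEN smooth_on_differentiable, OF p]
  have "partial_deriv 1 (partial_deriv 2 r) p = partial_deriv 2 (partial_deriv 1 r) p"
    by (rule partial_deriv_commute[OF r U p])
  moreover have "partial_deriv 1 (partial_deriv 2 r) p = partial_deriv 1 (\<lambda>q. (- (k2 q * h2 q)) *\<^sub>R e2 q) p"
    by (rule partial_deriv_cong[OF U p]) (simp add: dr dn)
  moreover have "partial_deriv 2 (partial_deriv 1 r) p = partial_deriv 2 (\<lambda>q. (- (k1 q * h1 q)) *\<^sub>R e1 q) p"
    by (rule partial_deriv_cong[OF U p]) (simp add: dr dn)
  ultimately have "(- (k2 p * h2 p)) *\<^sub>R partial_deriv 1 e2 p + (- (k2 p * partial_deriv 1 h2 p + partial_deriv 1 k2 p * h2 p)) *\<^sub>R e2 p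
      = (- (k1 p * h1 p)) *\<^sub>R partial_deriv 2 e1 p + (- (k1 p * partial_deriv 2 h1 p + partial_deriv 2 k1 p * h1 p)) *\<^sub>R e1 p"
    using d by (simp only: partial_deriv_scaleR partial_deriv_minus partial_deriv_mult)
  from arg_cong[OF this, of "\<lambda>v. v \<bullet> e1 p"] arg_cong[OF this, of "\<lambda>v. v \<bullet> e2 p"]
  have "k2 p * (h2 p * rot_coeff 2 h1 h2 p) = k1 p * partial_deriv 2 h1 p + partial_deriv 2 k1 p * h1 p"
    "k1 p * (h1 p * rot_coeff 1 h2 h1 p) = k2 p * partial_deriv 1 h2 p + partial_deriv 1 k2 p * h2 p"
    by (simp_all add: inner_diff_left inner_add_left on frame_connection[OF p])
  moreover have "h2 p * rot_coeff 2 h1 h2 p = partial_deriv 2 h1 p" "h1 p * rot_coeff 1 h2 h1 p = partial_deriv 1 h2 p"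
    using pos[OF p] by (simp_all add: rot_coeff_def)
  ultimately show "partial_deriv 2 k1 p * h1 p = (k2 p - k1 p) * partial_deriv 2 h1 p"
    "partial_deriv 1 k2 p * h2 p = (k1 p - k2 p) * partial_deriv 1 h2 p"
    by (simp_all add: algebra_simps)
qed

end

section \<open>Surfaces in curvature line coordinates\<close>

lemma mat2_eq_iff: "A = (B :: real^2^2) \<longleftrightarrow>
    A $ 1 $ 1 = B $ 1 $ 1 \<and> A $ 1 $ 2 = B $ 1 $ 2 \<and> A $ 2 $ 1 = B $ 2 $ 1 \<and> A $ 2 $ 2 = B $ 2 $ 2"
  by (auto simp: vec_eq_iff forall_2)

lemma diag_matrix_axis:
  fixes a b :: real
  shows "(vector [vector [a, 0], vector [0, b]] :: real^2^2) *v axis 1 1 = a *\<^sub>R axis 1 1"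
    "(vector [vector [a, 0], vector [0, b]] :: real^2^2) *v axis 2 1 = b *\<^sub>R axis 2 1"
  unfolding matrix_vector_mult_basis by (simp_all add: vec_eq_iff forall_2 column_def axis_def)

lemma weingarten_diag:
  assumes "first_form r p = vector [vector [E, 0], vector [0, G]]"
    and "second_form r p = vector [vector [L, 0], vector [0, N]]" and "E \<noteq> 0" "G \<noteq> 0"
  shows "weingarten r p = vector [vector [L / E, 0], vector [0, N / G]]"
  unfolding weingarten_def assms(1,2) matrix_inv_diag[OF assms(3,4)]
  by (simp add: mat2_eq_iff matrix_matrix_mult_def sum_2)

lemma principal_radii_diag:
  assumes "weingarten r p = vector [vector [a, 0], vector [0, b]]"
  shows "weingarten r p *v axis 1 1 = c *\<^sub>R axis 1 1 \<longleftrightarrow> a = c"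
    "weingarten r p *v axis 2 1 = d *\<^sub>R axis 2 1 \<longleftrightarrow> b = d"
  unfolding assms diag_matrix_axis by (simp_all add: vec_eq_iff forall_2 axis_def)

lemma weingarten_eqI:
  assumes "principal_radii r U k1 k2" "principal_radii s V k1 k2" "p \<in> U" "p \<in> V"
  shows "weingarten s p = weingarten r p"
proof -
  have "column i (weingarten s p) = column i (weingarten r p)" for i
    using assms exhaust_2[of i] unfolding principal_radii_def matrix_vector_mult_basis by auto
  then show ?thesis
    by (simp add: column_def vec_eq_iff)
qed

lemma bounded_bilinear_cross3: "bounded_bilinear cross3"
  using bilinear_cross bilinear_conv_bounded_bilinear by blast

context
  fixes r :: "real^2 \<Rightarrow> real^3" and U :: "(real^2) set"
  assumes regular: "regular_surface r U"
begin

lemma surface_open: "open U" and surface_smooth: "smooth_on r U"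
  using regular by (simp_all add: regular_surface_def)

lemma normal_field_nonzero: "p \<in> U \<Longrightarrow> cross3 (partial_deriv 1 r p) (partial_deriv 2 r p) \<noteq> 0"
  using regular by (simp add: regular_surface_def)

lemma smooth_on_unit_normal: "smooth_on (unit_normal r) U"
proof -
  let ?N = "\<lambda>p. cross3 (partial_deriv 1 r p) (partial_deriv 2 r p)"
  have N: "smooth_on ?N U"
    by (intro smooth_on_bilinear[OF bounded_bilinear_cross3] smooth_on_partial_deriv surface_smooth surface_open)
  have "smooth_on (\<lambda>p. inverse (sqrt (?N p \<bullet> ?N p)) *\<^sub>R ?N p) U"
    by (intro smooth_on_scaleR smooth_on_inverse smooth_on_sqrt smooth_on_inner N surface_open)
      (use normal_field_nonzero in auto)
  then show ?thesis
    by (simp add: unit_normal_def[abs_def] sgn_div_norm norm_eq_sqrt_inner)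
qed

lemma unit_normal_inner:
  assumes "p \<in> U"
  shows "unit_normal r p \<bullet> unit_normal r p = 1" "partial_deriv 1 r p \<bullet> unit_normal r p = 0"
    "partial_deriv 2 r p \<bullet> unit_normal r p = 0"
proof -
  have "norm (unit_normal r p) = 1"
    using normal_field_nonzero[OF assms] by (simp add: unit_normal_def norm_sgn)
  then show "unit_normal r p \<bullet> unit_normal r p = 1"
    by (simp add: norm_eq_1)
qed (simp_all add: unit_normal_def sgn_div_norm dot_cross_self)

lemma second_form_eq:
  assumes "p \<in> U"
  shows "second_form r p $ i $ j = - (partial_deriv j r p \<bullet> partial_deriv i (unit_normal r) p)"
proof -
  have "partial_deriv j r q \<bullet> unit_normal r q = 0" if "q \<in> U" for q
    using unit_normal_inner[OF that] exhaust_2[of j] by auto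
  from inner_deriv_const[OF smooth_on_partial_deriv[OF surface_smooth] smooth_on_unit_normal surface_open assms this, of i]
  show ?thesis by (simp add: second_form_def)
qed

lemma partial_deriv_nonzero:
  assumes "p \<in> U"
  shows "0 < partial_deriv 1 r p \<bullet> partial_deriv 1 r p" "0 < partial_deriv 2 r p \<bullet> partial_deriv 2 r p"
  using normal_field_nonzero[OF assms] by auto

context
  fixes k1 k2 :: "real^2 \<Rightarrow> real"
  assumes coords: "curvature_line_coords r U" and radii: "principal_radii r U k1 k2"
begin

lemma principal_second_form:
  assumes p: "p \<in> U"
  shows "second_form r p $ 1 $ 1 = (partial_deriv 1 r p \<bullet> partial_deriv 1 r p) / k1 p"
    "second_form r p $ 2 $ 2 = (partial_deriv 2 r p \<bullet> partial_deriv 2 r p) / k2 p"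
proof -
  let ?E = "partial_deriv 1 r p \<bullet> partial_deriv 1 r p" and ?G = "partial_deriv 2 r p \<bullet> partial_deriv 2 r p"
  have 1: "first_form r p = vector [vector [?E, 0], vector [0, ?G]]"
    using coords p by (auto simp: curvature_line_coords_def mat2_eq_iff first_form_def)
  have 2: "second_form r p = vector [vector [second_form r p $ 1 $ 1, 0], vector [0, second_form r p $ 2 $ 2]]"
    using coords p by (auto simp: curvature_line_coords_def mat2_eq_iff)
  have "second_form r p $ 1 $ 1 / ?E = 1 / k1 p" "second_form r p $ 2 $ 2 / ?G = 1 / k2 p"
    using radii p partial_deriv_nonzero[OF p]
      principal_radii_diag[OF weingarten_diag[OF 1 2]]
    unfolding principal_radii_def by (metis less_irrefl)+
  then show "second_form r p $ 1 $ 1 = ?E / k1 p" "second_form r p $ 2 $ 2 = ?G / k2 p"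
    using partial_deriv_nonzero[OF p] radii p by (auto simp: principal_radii_def field_simps)
qed

text \<open>The radii are quotients of the coefficients of the first two fundamental forms, so their smoothness
  is a consequence of that of \<open>r\<close>.\<close>

lemma smooth_on_principal_radii: "smooth_on k1 U" "smooth_on k2 U"
proof -
  have nz: "second_form r p $ 1 $ 1 \<noteq> 0" "second_form r p $ 2 $ 2 \<noteq> 0" if "p \<in> U" for p
    using principal_second_form[OF that] partial_deriv_nonzero[OF that] radii that
    by (auto simp: principal_radii_def)
  have s: "smooth_on (\<lambda>p. second_form r p $ i $ i) U" for i
    using smooth_on_inner[OF smooth_on_partial_deriv[OF smooth_on_partial_deriv[OF surface_smooth]]
        smooth_on_unit_normal surface_open] by (simp add: second_form_def)
  have f: "smooth_on (\<lambda>p. partial_deriv i r p \<bullet> partial_deriv i r p) U" for i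
    by (intro smooth_on_inner smooth_on_partial_deriv surface_smooth surface_open)
  have "k1 p = (partial_deriv 1 r p \<bullet> partial_deriv 1 r p) / second_form r p $ 1 $ 1"
    "k2 p = (partial_deriv 2 r p \<bullet> partial_deriv 2 r p) / second_form r p $ 2 $ 2" if "p \<in> U" for p
    unfolding nonzero_eq_divide_eq[OF nz(1)[OF that]] nonzero_eq_divide_eq[OF nz(2)[OF that]]
    unfolding principal_second_form[OF that]
    using radii that by (auto simp: principal_radii_def)
  then have "smooth_on k1 U = smooth_on (\<lambda>p. (partial_deriv 1 r p \<bullet> partial_deriv 1 r p) / second_form r p $ 1 $ 1) U"
    "smooth_on k2 U = smooth_on (\<lambda>p. (partial_deriv 2 r p \<bullet> partial_deriv 2 r p) / second_form r p $ 2 $ 2) U"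
    by (intro smooth_on_cong surface_open; blast)+
  then show "smooth_on k1 U" "smooth_on k2 U"
    using smooth_on_divide[OF f s surface_open nz(1)] smooth_on_divide[OF f s surface_open nz(2)] by blast+
qed

text \<open>Rodrigues' formula: both sides have the same components in the orthogonal frame given by the
  two coordinate tangents and the normal.\<close>

lemma rodrigues:
  assumes p: "p \<in> U"
  shows "partial_deriv 1 r p = - (k1 p *\<^sub>R partial_deriv 1 (unit_normal r) p)"
    "partial_deriv 2 r p = - (k2 p *\<^sub>R partial_deriv 2 (unit_normal r) p)"
proof -
  let ?r1 = "partial_deriv 1 r p" and ?r2 = "partial_deriv 2 r p" and ?n = "unit_normal r p"
  let ?n1 = "partial_deriv 1 (unit_normal r) p" and ?n2 = "partial_deriv 2 (unit_normal r) p"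
  note pos = partial_deriv_nonzero[OF p]
  have orth: "?r1 \<bullet> ?r2 = 0" "?r2 \<bullet> ?r1 = 0"
    using coords p by (auto simp: curvature_line_coords_def first_form_def)
  have onb: "orthonormal3 (sgn ?r1) (sgn ?r2) ?n"
    using pos orth unit_normal_inner[OF p]
    by (simp add: orthonormal3_def sgn_div_norm field_simps flip: power2_eq_square power2_norm_eq_inner)
  have "?n1 \<bullet> ?n = 0" "?n2 \<bullet> ?n = 0"
    using inner_deriv_const[OF smooth_on_unit_normal smooth_on_unit_normal surface_open p unit_normal_inner(1), of 1]
      inner_deriv_const[OF smooth_on_unit_normal smooth_on_unit_normal surface_open p unit_normal_inner(1), of 2]
    by (simp_all add: inner_commute)
  moreover have "?r1 \<bullet> ?n1 = - (?r1 \<bullet> ?r1) / k1 p" "?r2 \<bullet> ?n2 = - (?r2 \<bullet> ?r2) / k2 p"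
    "?r2 \<bullet> ?n1 = 0" "?r1 \<bullet> ?n2 = 0"
    using principal_second_form[OF p] second_form_eq[OF p] coords p
    by (auto simp: curvature_line_coords_def)
  moreover have "k1 p \<noteq> 0" "k2 p \<noteq> 0"
    using radii p by (auto simp: principal_radii_def)
  ultimately show "?r1 = - (k1 p *\<^sub>R ?n1)" "?r2 = - (k2 p *\<^sub>R ?n2)"
    using unit_normal_inner[OF p] orth
    by (auto intro!: orthonormal3_eqI[OF onb] simp: sgn_div_norm inner_commute)
qed

end

end

text \<open>The sign \<open>\<sigma>\<close> is the orientation of the frame. The normal determined by the coordinates is a positive
  multiple of \<open>k1 * k2 * \<sigma> * n\<close>, so \<open>\<sigma>\<close> has to be chosen as the sign of \<open>k1 * k2\<close> for \<open>n\<close> to be that normal.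
  Otherwise both radii would change sign.\<close>

lemma surface_of_frame:
  fixes V :: "(real^2) set" and s e1 e2 n :: "real^2 \<Rightarrow> real^3" and h1 h2 k1 k2 :: "real^2 \<Rightarrow> real"
  assumes V: "open V" and smooth: "smooth_on s V"
    and pos: "\<And>q. q \<in> V \<Longrightarrow> 0 < h1 q" "\<And>q. q \<in> V \<Longrightarrow> 0 < h2 q"
    and onb: "\<And>q. q \<in> V \<Longrightarrow> orthonormal3 (e1 q) (e2 q) (n q)"
    and dn: "\<And>q. q \<in> V \<Longrightarrow> partial_deriv 1 n q = h1 q *\<^sub>R e1 q"
      "\<And>q. q \<in> V \<Longrightarrow> partial_deriv 2 n q = h2 q *\<^sub>R e2 q"
    and ds: "\<And>q. q \<in> V \<Longrightarrow> partial_deriv 1 s q = - ((k1 q * h1 q) *\<^sub>R e1 q)"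
      "\<And>q. q \<in> V \<Longrightarrow> partial_deriv 2 s q = - ((k2 q * h2 q) *\<^sub>R e2 q)"
    and orient: "\<And>q. q \<in> V \<Longrightarrow> cross3 (e1 q) (e2 q) = \<sigma> *\<^sub>R n q"
      "\<And>q. q \<in> V \<Longrightarrow> 0 < k1 q * k2 q * \<sigma>"
  shows "regular_surface s V" "curvature_line_coords s V" "principal_radii s V k1 k2"
    "\<And>q. q \<in> V \<Longrightarrow> third_form s q = diag_metric (\<lambda>q. (h1 q)\<^sup>2) (\<lambda>q. (h2 q)\<^sup>2) q"
proof -
  have k: "k1 q \<noteq> 0" "k2 q \<noteq> 0" if "q \<in> V" for q
    using orient(2)[OF that] by auto
  have on: "e1 q \<bullet> e1 q = 1" "e2 q \<bullet> e2 q = 1" "n q \<bullet> n q = 1" "e1 q \<bullet> e2 q = 0"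
    "e1 q \<bullet> n q = 0" "e2 q \<bullet> n q = 0" "e2 q \<bullet> e1 q = 0" if "q \<in> V" for q
    using onb[OF that] by (auto simp: orthonormal3_def inner_commute)
  have cross: "cross3 (partial_deriv 1 s q) (partial_deriv 2 s q) = (k1 q * k2 q * \<sigma> * (h1 q * h2 q)) *\<^sub>R n q"
    if "q \<in> V" for q
    by (simp add: ds[OF that] orient[OF that] cross_mult_left cross_mult_right mult_ac)
  have c: "0 < k1 q * k2 q * \<sigma> * (h1 q * h2 q)" if "q \<in> V" for q
    using mult_pos_pos[OF orient(2)[OF that] mult_pos_pos[OF pos(1)[OF that] pos(2)[OF that]]] .
  have n0: "n q \<noteq> 0" if "q \<in> V" for q
    using on(3)[OF that] by auto
  show reg: "regular_surface s V"
    unfolding regular_surface_def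
  proof (intro conjI ballI V smooth)
    fix q assume q: "q \<in> V"
    show "cross3 (partial_deriv 1 s q) (partial_deriv 2 s q) \<noteq> 0"
      unfolding cross[OF q] scaleR_eq_0_iff using c[OF q] n0[OF q] by linarith
  qed
  have normal: "unit_normal s q = n q" if "q \<in> V" for q
    unfolding unit_normal_def cross[OF that] sgn_scaleR sgn_pos[OF c[OF that]]
    using on(3)[OF that] by (simp add: sgn_div_norm flip: norm_eq_1)
  have dnormal: "partial_deriv i (unit_normal s) q = partial_deriv i n q" if "q \<in> V" for q i
    by (rule partial_deriv_cong[OF V that normal])
  have first: "first_form s q = vector [vector [(k1 q * h1 q)\<^sup>2, 0], vector [0, (k2 q * h2 q)\<^sup>2]]"
    if "q \<in> V" for q
    by (simp add: mat2_eq_iff first_form_def ds[OF that] on[OF that] power2_eq_square)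
  have second: "second_form s q = vector [vector [k1 q * (h1 q)\<^sup>2, 0], vector [0, k2 q * (h2 q)\<^sup>2]]"
    if "q \<in> V" for q
    by (simp add: mat2_eq_iff second_form_eq[OF reg that] dnormal[OF that] dn[OF that] ds[OF that] on[OF that]
        power2_eq_square)
  show "curvature_line_coords s V"
    unfolding curvature_line_coords_def
    using first second by (auto simp: forall_2)
  show "third_form s q = diag_metric (\<lambda>q. (h1 q)\<^sup>2) (\<lambda>q. (h2 q)\<^sup>2) q" if "q \<in> V" for q
    by (simp add: mat2_eq_iff third_form_def dnormal[OF that] dn[OF that] on[OF that] power2_eq_square)
  show "principal_radii s V k1 k2"
    unfolding principal_radii_def
  proof (intro ballI conjI)
    fix q assume q: "q \<in> V"
    show "k1 q \<noteq> 0" "k2 q \<noteq> 0" by (fact k[OF q])+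
    have W: "weingarten s q = vector [vector [k1 q * (h1 q)\<^sup>2 / (k1 q * h1 q)\<^sup>2, 0],
        vector [0, k2 q * (h2 q)\<^sup>2 / (k2 q * h2 q)\<^sup>2]]"
      by (rule weingarten_diag[OF first[OF q] second[OF q]]) (use k[OF q] pos[OF q] in auto)
    show "weingarten s q *v axis 1 1 = (1 / k1 q) *\<^sub>R axis 1 1"
      "weingarten s q *v axis 2 1 = (1 / k2 q) *\<^sub>R axis 2 1"
      unfolding principal_radii_diag[OF W]
      using k[OF q] pos[OF q] by (simp_all add: power2_eq_square)
  qed
qed

section \<open>The structure equations as a linear system\<close>

text \<open>An element \<open>(w, m1, m2, c1, c2)\<close> holds the coefficients of the structure equations in one direction:
  \<open>w\<close> is the value of the connection form, \<open>m1, m2\<close> are the components of the derivative of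
  the normal, and \<open>c1, c2\<close> those of the derivative of the position vector.\<close>

type_synonym frame_coeffs = "real \<times> real \<times> real \<times> real \<times> real"
type_synonym framed_point = "(real^3) \<times> (real^3) \<times> (real^3) \<times> (real^3)"

definition frame_act :: "frame_coeffs \<Rightarrow> framed_point \<Rightarrow> framed_point" where
  "frame_act = (\<lambda>(w, m1, m2, c1, c2) (e1, e2, n, s).
     (w *\<^sub>R e2 - m1 *\<^sub>R n, - (w *\<^sub>R e1) - m2 *\<^sub>R n, m1 *\<^sub>R e1 + m2 *\<^sub>R e2, c1 *\<^sub>R e1 + c2 *\<^sub>R e2))"

lemma bounded_bilinear_frame_act: "bounded_bilinear frame_act"
proof -
  have "bilinear frame_act"
    unfolding bilinear_def linear_iff
    by (auto simp: frame_act_def algebra_simps)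
  then show ?thesis
    using bilinear_conv_bounded_bilinear by blast
qed

text \<open>The five conditions are the Gauss equation, the definitions of the two rotation coefficients and the two
  Codazzi equations. Primes stand for the derivatives in the respective other direction.\<close>

lemma frame_act_integrable:
  fixes a b h1 h2 c1 c2 a' b' h1' h2' c1' c2' :: real
  assumes "b' + a' + h1 * h2 = 0" "h1' = a * h2" "h2' = b * h1" "c1' = a * c2" "c2' = b * c1"
  shows "frame_act (b', 0, h2', 0, c2') X + frame_act (b, 0, h2, 0, c2) (frame_act (- a, h1, 0, c1, 0) X) =
    frame_act (- a', h1', 0, c1', 0) X + frame_act (- a, h1, 0, c1, 0) (frame_act (b, 0, h2, 0, c2) X)"
proof -
  have b': "b' = - a' - h1 * h2" using assms(1) by simp
  obtain e1 e2 n s where X: "X = (e1, e2, n, s)" by (cases X)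
  show ?thesis
    unfolding X b' assms(2-5) by (simp add: frame_act_def algebra_simps)
qed

lemma partial_deriv_linear:
  assumes "bounded_linear L" "f differentiable (at p)"
  shows "partial_deriv i (\<lambda>q. L (f q)) p = L (partial_deriv i f p)"
  using partial_derivI[OF bounded_linear.has_derivative[OF assms(1)]] assms(2)
  by (simp add: frechet_derivative_works partial_deriv_def)

lemma partial_deriv_Pair:
  assumes "f differentiable (at p)" "g differentiable (at p)"
  shows "partial_deriv i (\<lambda>q. (f q, g q)) p = (partial_deriv i f p, partial_deriv i g p)"
  using partial_derivI[OF has_derivative_Pair] assms by (simp add: frechet_derivative_works partial_deriv_def)

lemma partial_deriv_slice:
  assumes "F differentiable (at (\<mu>, p))"
  shows "partial_deriv i (\<lambda>p. F (\<mu>, p)) p = frechet_derivative F (at (\<mu>, p)) (0, axis i 1)"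
proof -
  have "((\<lambda>p. (\<mu>, p)) has_derivative (\<lambda>v. (0, v))) (at p)"
    by (auto intro!: derivative_eq_intros)
  from has_derivative_compose[OF this, of F "frechet_derivative F (at (\<mu>, p))"] assms
  show ?thesis
    by (intro partial_derivI) (simp add: frechet_derivative_works)
qed

lemma smooth_on_slice:
  fixes F :: "real \<times> (real^2) \<Rightarrow> 'b::real_normed_vector"
  assumes "smooth_on F (L \<times> V)" "\<mu> \<in> L" "open V"
  shows "smooth_on (\<lambda>p. F (\<mu>, p)) V"
  by (rule smooth_on_compose[OF assms(1) smooth_on_Pair[OF smooth_on_const smooth_on_id]])
    (use assms in auto)

lemma zero_partial_derivs_constant:
  fixes f :: "real^2 \<Rightarrow> real"
  assumes f: "smooth_on f (ball p0 \<rho>)" and zero: "\<And>q i. q \<in> ball p0 \<rho> \<Longrightarrow> partial_deriv i f q = 0"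
    and q: "q \<in> ball p0 \<rho>"
  shows "f q = f p0"
proof -
  have D: "(f has_derivative (\<lambda>v. 0)) (at x within ball p0 \<rho>)" if x: "x \<in> ball p0 \<rho>" for x
  proof -
    note D = smooth_on_has_derivative[OF f x]
    have "frechet_derivative f (at x) v = 0" for v
    proof -
      have "v = (v $ 1) *\<^sub>R axis 1 1 + (v $ 2) *\<^sub>R axis 2 1"
        by (simp add: vec_eq_iff forall_2 axis_def)
      then have "frechet_derivative f (at x) v =
          (v $ 1) * partial_deriv 1 f x + (v $ 2) * partial_deriv 2 f x"
        using linear_add[OF has_derivative_linear[OF D]] linear_scale[OF has_derivative_linear[OF D]]
        unfolding partial_deriv_def by (metis real_scaleR_def)
      then show ?thesis using zero[OF x] by simp
    qed
    then have "frechet_derivative f (at x) = (\<lambda>v. 0)" by blast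
    then show ?thesis
      using D by (simp add: has_derivative_at_withinI)
  qed
  obtain c where c: "\<And>x. x \<in> ball p0 \<rho> \<Longrightarrow> f x = c"
    using has_derivative_zero_constant[OF convex_ball D] by blast
  have "p0 \<in> ball p0 \<rho>" using q by (auto intro: le_less_trans[OF zero_le_dist])
  then show ?thesis using c q by metis
qed

text \<open>The rotational part of the structure equations is skew, so the sum in \<open>orthonormal3_iff_parseval\<close> and the
  triple product of the frame have zero derivative. The Gram matrix itself would only satisfy
  a differential equation, whereas for that sum the terms cancel outright.\<close>

lemma frame_stays_orthonormal:
  fixes e1 e2 n :: "real^2 \<Rightarrow> real^3" and w m1 m2 :: "2 \<Rightarrow> real^2 \<Rightarrow> real"
  assumes smooth: "smooth_on e1 (ball p0 \<rho>)" "smooth_on e2 (ball p0 \<rho>)" "smooth_on n (ball p0 \<rho>)"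
    and d: "\<And>q i. q \<in> ball p0 \<rho> \<Longrightarrow> partial_deriv i e1 q = w i q *\<^sub>R e2 q - m1 i q *\<^sub>R n q"
      "\<And>q i. q \<in> ball p0 \<rho> \<Longrightarrow> partial_deriv i e2 q = - (w i q *\<^sub>R e1 q) - m2 i q *\<^sub>R n q"
      "\<And>q i. q \<in> ball p0 \<rho> \<Longrightarrow> partial_deriv i n q = m1 i q *\<^sub>R e1 q + m2 i q *\<^sub>R e2 q"
    and init: "orthonormal3 (e1 p0) (e2 p0) (n p0)" "cross3 (e1 p0) (e2 p0) = \<sigma> *\<^sub>R n p0"
    and q: "q \<in> ball p0 \<rho>"
  shows "orthonormal3 (e1 q) (e2 q) (n q)" "cross3 (e1 q) (e2 q) = \<sigma> *\<^sub>R n q"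
proof -
  note [simp] = smooth[THEN smooth_on_differentiable]
  note o = open_ball[of p0 \<rho>]
  have "(x \<bullet> e1 q) * (y \<bullet> e1 q) + (x \<bullet> e2 q) * (y \<bullet> e2 q) + (x \<bullet> n q) * (y \<bullet> n q) = x \<bullet> y" for x y
  proof -
    let ?f = "\<lambda>q. (x \<bullet> e1 q) * (y \<bullet> e1 q) + (x \<bullet> e2 q) * (y \<bullet> e2 q) + (x \<bullet> n q) * (y \<bullet> n q)"
    have li: "smooth_on (\<lambda>q. x \<bullet> e q) (ball p0 \<rho>)" if "smooth_on e (ball p0 \<rho>)" for x :: "real^3" and e
      by (rule smooth_on_linear[OF bounded_linear_inner_right that o])
    have mu: "smooth_on (\<lambda>q. (x \<bullet> e q) * (y \<bullet> e q)) (ball p0 \<rho>)" if "smooth_on e (ball p0 \<rho>)" for e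
      by (intro smooth_on_mult li that o)
    have s: "smooth_on ?f (ball p0 \<rho>)"
      by (intro smooth_on_add mu smooth o)
    have pm: "partial_deriv i (\<lambda>q. (x \<bullet> e q) * (y \<bullet> e q)) p =
        (x \<bullet> e p) * (y \<bullet> partial_deriv i e p) + (x \<bullet> partial_deriv i e p) * (y \<bullet> e p)"
      if "smooth_on e (ball p0 \<rho>)" "p \<in> ball p0 \<rho>" for e i p
      using li[OF that(1), THEN smooth_on_differentiable, OF that(2)]
        smooth_on_differentiable[OF that]
      by (simp add: partial_deriv_mult partial_deriv_linear[OF bounded_linear_inner_right])
    have "partial_deriv i ?f p = 0" if p: "p \<in> ball p0 \<rho>" for p i
    proof -
      note dd = mu[OF smooth(1), THEN smooth_on_differentiable, OF p] mu[OF smooth(2), THEN smooth_on_differentiable, OF p]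
        mu[OF smooth(3), THEN smooth_on_differentiable, OF p]
        smooth_on_add[OF mu[OF smooth(1)] mu[OF smooth(2)] o, THEN smooth_on_differentiable, OF p]
      have "partial_deriv i ?f p =
        (x \<bullet> e1 p) * (y \<bullet> partial_deriv i e1 p) + (x \<bullet> partial_deriv i e1 p) * (y \<bullet> e1 p) +
        ((x \<bullet> e2 p) * (y \<bullet> partial_deriv i e2 p) + (x \<bullet> partial_deriv i e2 p) * (y \<bullet> e2 p)) +
        ((x \<bullet> n p) * (y \<bullet> partial_deriv i n p) + (x \<bullet> partial_deriv i n p) * (y \<bullet> n p))"
        using dd by (simp only: partial_deriv_add pm[OF smooth(1) p] pm[OF smooth(2) p] pm[OF smooth(3) p])
      then show ?thesis
        unfolding d[OF p] by (simp add: inner_simps algebra_simps)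
    qed
    from zero_partial_derivs_constant[OF s this q]
    show ?thesis
      using orthonormal3_parseval[OF init(1)] by simp
  qed
  then show onb: "orthonormal3 (e1 q) (e2 q) (n q)"
    by (simp add: orthonormal3_iff_parseval)
  have det: "cross3 (e1 q) (e2 q) \<bullet> n q = \<sigma>"
  proof -
    let ?f = "\<lambda>q. cross3 (e1 q) (e2 q) \<bullet> n q"
    have sc: "smooth_on (\<lambda>q. cross3 (e1 q) (e2 q)) (ball p0 \<rho>)"
      by (intro smooth_on_bilinear[OF bounded_bilinear_cross3] smooth o)
    have s: "smooth_on ?f (ball p0 \<rho>)"
      by (intro smooth_on_inner sc smooth o)
    have "partial_deriv i ?f p = 0" if p: "p \<in> ball p0 \<rho>" for p i
    proof -
      have "partial_deriv i ?f p = cross3 (e1 p) (e2 p) \<bullet> partial_deriv i n p +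
          (cross3 (e1 p) (partial_deriv i e2 p) + cross3 (partial_deriv i e1 p) (e2 p)) \<bullet> n p"
        using smooth_on_differentiable[OF sc p] p
        by (simp add: partial_deriv_inner partial_deriv_bilinear[OF bounded_bilinear_cross3])
      then show ?thesis
        unfolding d[OF p]
        by (simp add: inner_add_left inner_add_right Cross3.left_diff_distrib Cross3.right_diff_distrib
            cross_mult_left cross_mult_right inner_diff_left dot_cross_self)
    qed
    from zero_partial_derivs_constant[OF s this q]
    show ?thesis
      using init by (simp add: orthonormal3_def)
  qed
  show "cross3 (e1 q) (e2 q) = \<sigma> *\<^sub>R n q"
    by (rule orthonormal3_eqI[OF onb])
      (use onb det in \<open>auto simp: orthonormal3_def inner_commute dot_cross_self\<close>)
qed

section \<open>The deformed surfaces\<close>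

text \<open>One neighbourhood \<open>V\<close> has to serve all \<open>\<mu>\<close>. If \<open>m\<close> is the minimum of \<open>f1\<close> and \<open>f2\<close> on a compact ball in
  \<open>U\<close>, then the open half-line \<open>L\<close> of all \<open>\<mu> > - m\<close> contains every \<open>\<mu>\<close> that is admissible on all of \<open>U\<close>, and
  the deformed metric is positive on the ball for all \<open>\<mu>\<close> in \<open>L\<close>.\<close>

lemma deformed_surfaces:
  fixes U :: "(real^2) set" and H1 H2 f1 f2 k1 k2 :: "real^2 \<Rightarrow> real"
  assumes U: "open U" and p0: "p0 \<in> U"
    and H: "smooth_on H1 U" "smooth_on H2 U" "\<And>q. q \<in> U \<Longrightarrow> 0 < H1 q" "\<And>q. q \<in> U \<Longrightarrow> 0 < H2 q"
    and f: "smooth_on f1 U" "smooth_on f2 U"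
      "\<And>q. q \<in> U \<Longrightarrow> partial_deriv 2 f1 q = 0" "\<And>q. q \<in> U \<Longrightarrow> partial_deriv 1 f2 q = 0"
    and k: "smooth_on k1 U" "smooth_on k2 U" "\<And>q. q \<in> U \<Longrightarrow> k1 q \<noteq> 0" "\<And>q. q \<in> U \<Longrightarrow> k2 q \<noteq> 0"
    and flat: "\<And>q. q \<in> U \<Longrightarrow> partial_deriv 1 (rot_coeff 1 H2 H1) q + partial_deriv 2 (rot_coeff 2 H1 H2) q = 0"
    and weighted: "\<And>q. q \<in> U \<Longrightarrow> weighted_defect H1 H2 f1 f2 q = 0"
    and codazzi: "\<And>q. q \<in> U \<Longrightarrow> partial_deriv 2 k1 q * H1 q = (k2 q - k1 q) * partial_deriv 2 H1 q"
      "\<And>q. q \<in> U \<Longrightarrow> partial_deriv 1 k2 q * H2 q = (k1 q - k2 q) * partial_deriv 1 H2 q"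
  shows "\<exists>V L (s :: real \<Rightarrow> real^2 \<Rightarrow> real^3). open V \<and> p0 \<in> V \<and> V \<subseteq> U \<and> open L \<and>
    {\<mu>. \<forall>q\<in>U. 0 < \<mu> + f1 q \<and> 0 < \<mu> + f2 q} \<subseteq> L \<and> smooth_on (\<lambda>(\<mu>, p). s \<mu> p) (L \<times> V) \<and>
    (\<forall>\<mu>\<in>L. regular_surface (s \<mu>) V \<and> curvature_line_coords (s \<mu>) V \<and>
      (\<forall>p\<in>V. third_form (s \<mu>) p =
         diag_metric (\<lambda>q. (H1 q / sqrt (\<mu> + f1 q))\<^sup>2) (\<lambda>q. (H2 q / sqrt (\<mu> + f2 q))\<^sup>2) p) \<and>
      principal_radii (s \<mu>) V k1 k2)"
proof -
  define \<sigma> where "\<sigma> = sgn (k1 p0 * k2 p0)"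
  have \<sigma>: "\<sigma> * \<sigma> = 1" "0 < k1 p0 * k2 p0 * \<sigma>"
    using k(3,4)[OF p0] by (auto simp: \<sigma>_def sgn_if zero_less_mult_iff mult_less_0_iff)
  \<comment> \<open>The ball is chosen so small that \<open>k1 * k2\<close> keeps its sign, and with it the orientation of the normal.\<close>
  have "open {q \<in> U. 0 < k1 q * k2 q * \<sigma>}"
  proof -
    have "continuous_on U (\<lambda>q. k1 q * k2 q * \<sigma>)"
      by (intro continuous_intros smooth_on_continuous k)
    from continuous_open_preimage[OF this U open_greaterThan[of 0]]
    show ?thesis by (simp add: vimage_def Int_def)
  qed
  then obtain \<rho> where \<rho>: "0 < \<rho>" "cball p0 \<rho> \<subseteq> {q \<in> U. 0 < k1 q * k2 q * \<sigma>}"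
    using p0 \<sigma>(2) unfolding open_contains_cball by auto
  define V where "V = ball p0 \<rho>"
  have V: "open V" "p0 \<in> V" "V \<subseteq> U" and orient: "\<And>q. q \<in> V \<Longrightarrow> 0 < k1 q * k2 q * \<sigma>"
    using \<rho>(1) order_trans[OF ball_subset_cball \<rho>(2)] by (auto simp: V_def)
  obtain m where m: "\<And>q. q \<in> V \<Longrightarrow> m \<le> f1 q" "\<And>q. q \<in> V \<Longrightarrow> m \<le> f2 q"
    and m': "\<And>\<mu>. \<forall>q\<in>U. 0 < \<mu> + f1 q \<and> 0 < \<mu> + f2 q \<Longrightarrow> 0 < \<mu> + m"
  proof -
    have "continuous_on (cball p0 \<rho>) (\<lambda>q. min (f1 q) (f2 q))"
      using \<rho>(2) by (intro continuous_intros smooth_on_continuous smooth_on_subset[OF f(1)] smooth_on_subset[OF f(2)]) auto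
    from continuous_attains_inf[OF compact_cball _ this] \<rho>(1)
    obtain q0 where q0: "q0 \<in> cball p0 \<rho>" "\<And>q. q \<in> cball p0 \<rho> \<Longrightarrow> min (f1 q0) (f2 q0) \<le> min (f1 q) (f2 q)"
      by auto
    show thesis
    proof (rule that[of "min (f1 q0) (f2 q0)"])
      show "min (f1 q0) (f2 q0) \<le> f1 q" "min (f1 q0) (f2 q0) \<le> f2 q" if "q \<in> V" for q
        using q0(2)[of q] that by (auto simp: V_def)
      show "0 < \<mu> + min (f1 q0) (f2 q0)" if "\<forall>q\<in>U. 0 < \<mu> + f1 q \<and> 0 < \<mu> + f2 q" for \<mu>
        using that q0(1) \<rho>(2) by (auto simp: min_def subset_iff)
    qed
  qed
  define L where "L = {- m<..}"
  have L: "open L" by (simp add: L_def)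
  have pos: "0 < \<mu> + f1 q" "0 < \<mu> + f2 q" if "\<mu> \<in> L" "q \<in> V" for \<mu> q
    using m[OF that(2)] that(1) by (auto simp: L_def)
  have LV: "open (L \<times> V)" by (intro open_Times L V)
  note HV = smooth_on_subset[OF H(1) V(3)] smooth_on_subset[OF H(2) V(3)] 
  note fV = smooth_on_subset[OF f(1) V(3)] smooth_on_subset[OF f(2) V(3)]
  note kV = smooth_on_subset[OF k(1) V(3)] smooth_on_subset[OF k(2) V(3)]
  have HVpos: "0 < H1 q" "0 < H2 q" if "q \<in> V" for q using H(3,4) V(3) that by auto
  have fV0: "partial_deriv 2 f1 q = 0" "partial_deriv 1 f2 q = 0" if "q \<in> V" for q using f(3,4) V(3) that by auto

  \<comment> \<open>The coefficients as functions of the pair of parameter and point; on a slice with fixed parameter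
    they are the data of the deformed metric.\<close>
  define \<phi>1 \<phi>2 where "\<phi>1 = (\<lambda>z. sqrt (fst z + f1 (snd z)))" and "\<phi>2 = (\<lambda>z. sqrt (fst z + f2 (snd z)))"
  define h1 h2 where "h1 = (\<lambda>z. H1 (snd z) / \<phi>1 z)" and "h2 = (\<lambda>z. H2 (snd z) / \<phi>2 z)"
  define a b where "a = (\<lambda>z. rot_coeff 2 H1 H2 (snd z) * (\<phi>2 z / \<phi>1 z))"
    and "b = (\<lambda>z. rot_coeff 1 H2 H1 (snd z) * (\<phi>1 z / \<phi>2 z))"
  define c1 c2 where "c1 = (\<lambda>z. - (k1 (snd z) * h1 z))" and "c2 = (\<lambda>z. - (k2 (snd z) * h2 z))"
  have snd: "smooth_on (\<lambda>z. g (snd z)) (L \<times> V)" if "smooth_on g V" for g :: "real^2 \<Rightarrow> real"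
    by (rule smooth_on_compose[OF that smooth_on_linear[OF bounded_linear_snd smooth_on_id[OF LV] LV] LV]) auto
  have \<phi>pos: "0 < \<phi>1 z" "0 < \<phi>2 z" if "z \<in> L \<times> V" for z
    using pos that by (auto simp: \<phi>1_def \<phi>2_def)
  have \<phi>: "smooth_on \<phi>1 (L \<times> V)" "smooth_on \<phi>2 (L \<times> V)"
    unfolding \<phi>1_def \<phi>2_def
    by (intro smooth_on_sqrt smooth_on_add snd fV LV
        smooth_on_linear[OF bounded_linear_fst smooth_on_id[OF LV] LV]; use pos in force)+
  have h: "smooth_on h1 (L \<times> V)" "smooth_on h2 (L \<times> V)"
    unfolding h1_def h2_def by (intro smooth_on_divide snd HV \<phi> LV; use \<phi>pos in force)+
  have ab: "smooth_on a (L \<times> V)" "smooth_on b (L \<times> V)"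
    unfolding a_def b_def
    by (intro smooth_on_mult smooth_on_divide snd smooth_on_rot_coeff HV HVpos \<phi> V LV; use \<phi>pos in force)+
  have c: "smooth_on c1 (L \<times> V)" "smooth_on c2 (L \<times> V)"
    unfolding c1_def c2_def by (intro smooth_on_minus smooth_on_mult snd kV h LV)+

  define \<Omega>1 \<Omega>2 :: "real \<times> (real^2) \<Rightarrow> frame_coeffs"
    where "\<Omega>1 = (\<lambda>z. (- a z, h1 z, 0, c1 z, 0))" and "\<Omega>2 = (\<lambda>z. (b z, 0, h2 z, 0, c2 z))"
  define \<Omega> where "\<Omega> i = (if i = axis 1 1 then \<Omega>1 else \<Omega>2)" for i :: "real^2"
  have \<Omega>12: "smooth_on \<Omega>1 (L \<times> V)" "smooth_on \<Omega>2 (L \<times> V)"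
    unfolding \<Omega>1_def \<Omega>2_def by (intro smooth_on_Pair smooth_on_minus smooth_on_const ab h c LV)+
  have ax: "axis 2 1 \<noteq> (axis 1 1 :: real^2)"
    by (simp add: vec_eq_iff forall_2 axis_def)
  have basis: "i = axis 1 1 \<or> i = axis 2 1" if "i \<in> Basis" for i :: "real^2"
  proof -
    obtain j where "i = axis j 1" using \<open>i \<in> Basis\<close> by (auto simp: Basis_vec_def)
    then show ?thesis using exhaust_2[of j] by auto
  qed
  have integrable: "frame_act (frechet_derivative \<Omega>2 (at z) (0, axis 1 1)) X + frame_act (\<Omega>2 z) (frame_act (\<Omega>1 z) X) =
      frame_act (frechet_derivative \<Omega>1 (at z) (0, axis 2 1)) X + frame_act (\<Omega>1 z) (frame_act (\<Omega>2 z) X)"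
    if z: "z \<in> L \<times> V" for z X
  proof -
    obtain \<mu> p where [simp]: "z = (\<mu>, p)" and \<mu>: "\<mu> \<in> L" and p: "p \<in> V" using z by auto
    let ?h1 = "\<lambda>q. H1 q / sqrt (\<mu> + f1 q)" and ?h2 = "\<lambda>q. H2 q / sqrt (\<mu> + f2 q)"
    note pos' = pos[OF \<mu>]
    note ctx = V(1) HV HVpos fV fV0 pos'
    have s: "h1 (\<mu>, q) = ?h1 q" "h2 (\<mu>, q) = ?h2 q" for q
      by (simp_all add: h1_def h2_def \<phi>1_def \<phi>2_def)
    have r: "a (\<mu>, q) = rot_coeff 2 ?h1 ?h2 q" "b (\<mu>, q) = rot_coeff 1 ?h2 ?h1 q" if "q \<in> V" for q
      using deform_rot_coeff[OF ctx that] by (simp_all add: a_def b_def \<phi>1_def \<phi>2_def)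
    note sm = h[THEN smooth_on_slice, OF \<mu> V(1)] ab[THEN smooth_on_slice, OF \<mu> V(1)]
      c[THEN smooth_on_slice, OF \<mu> V(1)]
    note d = sm[THEN smooth_on_differentiable, OF p] kV[THEN smooth_on_differentiable, OF p]
    have dh: "partial_deriv 2 (\<lambda>q. h1 (\<mu>, q)) p = a z * h2 z" "partial_deriv 1 (\<lambda>q. h2 (\<mu>, q)) p = b z * h1 z"
      using HVpos[OF p] pos'[OF p] by (simp_all add: s r[OF p] rot_coeff_def)
    have g: "partial_deriv 1 (\<lambda>q. b (\<mu>, q)) p + partial_deriv 2 (\<lambda>q. a (\<mu>, q)) p + h1 z * h2 z = 0"
    proof -
      have "gauss_defect ?h1 ?h2 p = 0"
        using gauss_defect_deform_zero[OF ctx p] flat weighted p V(3) by blast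
      moreover have "partial_deriv 1 (\<lambda>q. b (\<mu>, q)) p = partial_deriv 1 (rot_coeff 1 ?h2 ?h1) p"
        "partial_deriv 2 (\<lambda>q. a (\<mu>, q)) p = partial_deriv 2 (rot_coeff 2 ?h1 ?h2) p"
        by (intro partial_deriv_cong[OF V(1) p] r; assumption)+
      ultimately show ?thesis
        by (simp add: gauss_defect_def s)
    qed
    have dc: "partial_deriv 2 (\<lambda>q. c1 (\<mu>, q)) p = a z * c2 z" "partial_deriv 1 (\<lambda>q. c2 (\<mu>, q)) p = b z * c1 z"
    proof -
      have cod: "partial_deriv 2 k1 p * H1 p = (k2 p - k1 p) * (rot_coeff 2 H1 H2 p * H2 p)"
        "partial_deriv 1 k2 p * H2 p = (k1 p - k2 p) * (rot_coeff 1 H2 H1 p * H1 p)"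
        using codazzi[of p] p V(3) HVpos[OF p] by (auto simp: rot_coeff_def)
      have cod': "partial_deriv 2 k1 p * h1 z = (k2 p - k1 p) * (a z * h2 z)"
        "partial_deriv 1 k2 p * h2 z = (k1 p - k2 p) * (b z * h1 z)"
        using cod \<phi>pos[OF z] by (simp_all add: h1_def h2_def a_def b_def)
      have "smooth_on (\<lambda>q. k1 q * h1 (\<mu>, q)) V" "smooth_on (\<lambda>q. k2 q * h2 (\<mu>, q)) V"
        by (intro smooth_on_mult kV sm V)+
      note dd = this[THEN smooth_on_differentiable, OF p]
      have "partial_deriv 2 (\<lambda>q. c1 (\<mu>, q)) p = - (k1 p * (a z * h2 z) + partial_deriv 2 k1 p * h1 z)"
        "partial_deriv 1 (\<lambda>q. c2 (\<mu>, q)) p = - (k2 p * (b z * h1 z) + partial_deriv 1 k2 p * h2 z)"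
        using d dd by (simp_all add: c1_def c2_def partial_deriv_minus partial_deriv_mult dh[simplified])
      then show "partial_deriv 2 (\<lambda>q. c1 (\<mu>, q)) p = a z * c2 z" "partial_deriv 1 (\<lambda>q. c2 (\<mu>, q)) p = b z * c1 z"
        unfolding cod' by (simp_all add: c1_def c2_def algebra_simps)
    qed
    have D1: "frechet_derivative \<Omega>1 (at z) (0, axis 2 1) =
        (- partial_deriv 2 (\<lambda>q. a (\<mu>, q)) p, a z * h2 z, 0, a z * c2 z, 0)"
      using smooth_on_differentiable[OF \<Omega>12(1) z] d
      by (simp add: partial_deriv_slice[symmetric] \<Omega>1_def partial_deriv_Pair partial_deriv_minus
          dh[simplified] dc[simplified])
    have D2: "frechet_derivative \<Omega>2 (at z) (0, axis 1 1) =
        (partial_deriv 1 (\<lambda>q. b (\<mu>, q)) p, 0, b z * h1 z, 0, b z * c1 z)"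
      using smooth_on_differentiable[OF \<Omega>12(2) z] d
      by (simp add: partial_deriv_slice[symmetric] \<Omega>2_def partial_deriv_Pair
          dh[simplified] dc[simplified])
    show ?thesis
      unfolding D1 D2 unfolding \<Omega>1_def \<Omega>2_def
      by (rule frame_act_integrable[OF g refl refl refl refl])
  qed
  \<comment> \<open>At \<open>p0\<close> the standard frame is used, with the normal reversed if \<open>k1 * k2\<close> is negative.\<close>
  define x0 :: framed_point where "x0 = (axis 1 1, axis 2 1, \<sigma> *\<^sub>R axis 3 1, 0)"
  obtain X where X: "smooth_on X (L \<times> V)" "\<And>\<mu>. \<mu> \<in> L \<Longrightarrow> X (\<mu>, p0) = x0"
    "\<And>z i. z \<in> L \<times> V \<Longrightarrow> i \<in> Basis \<Longrightarrow> frechet_derivative X (at z) (0, i) = frame_act (\<Omega> i z) (X z)"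
  proof (rule frobenius_linear[OF bounded_bilinear_frame_act L \<rho>(1), where \<Omega>=\<Omega> and ?p0.0=p0 and ?x0.0=x0, folded V_def])
    show "smooth_on (\<Omega> i) (L \<times> V)" if "i \<in> Basis" for i
      using \<Omega>12 by (simp add: \<Omega>_def)
    show "frame_act (frechet_derivative (\<Omega> j) (at z) (0, i)) e + frame_act (\<Omega> j z) (frame_act (\<Omega> i z) e) =
        frame_act (frechet_derivative (\<Omega> i) (at z) (0, j)) e + frame_act (\<Omega> i z) (frame_act (\<Omega> j z) e)"
      if "i \<in> Basis" "j \<in> Basis" "z \<in> L \<times> V" for i j z e
      using basis[OF that(1)] basis[OF that(2)] integrable[OF that(3), of e] ax by (auto simp: \<Omega>_def)
  qed blast
  define e1 e2 n s where "e1 = (\<lambda>\<mu> p. fst (X (\<mu>, p)))" and "e2 = (\<lambda>\<mu> p. fst (snd (X (\<mu>, p))))"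
    and "n = (\<lambda>\<mu> p. fst (snd (snd (X (\<mu>, p)))))" and "s = (\<lambda>\<mu> p. snd (snd (snd (X (\<mu>, p)))))"
  have lin: "bounded_linear (\<lambda>x :: framed_point. fst x)" "bounded_linear (\<lambda>x :: framed_point. fst (snd x))"
    "bounded_linear (\<lambda>x :: framed_point. fst (snd (snd x)))" "bounded_linear (\<lambda>x :: framed_point. snd (snd (snd x)))"
    by (intro bounded_linear_intros bounded_linear_fst_comp bounded_linear_snd_comp bounded_linear_ident)+
  have surf: "regular_surface (s \<mu>) V \<and> curvature_line_coords (s \<mu>) V \<and>
      (\<forall>p\<in>V. third_form (s \<mu>) p =
         diag_metric (\<lambda>q. (H1 q / sqrt (\<mu> + f1 q))\<^sup>2) (\<lambda>q. (H2 q / sqrt (\<mu> + f2 q))\<^sup>2) p) \<and>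
      principal_radii (s \<mu>) V k1 k2" if \<mu>: "\<mu> \<in> L" for \<mu>
  proof -
    have Xs: "smooth_on (\<lambda>p. X (\<mu>, p)) V"
      by (rule smooth_on_slice[OF X(1) \<mu> V(1)])
    have sm: "smooth_on (e1 \<mu>) V" "smooth_on (e2 \<mu>) V" "smooth_on (n \<mu>) V" "smooth_on (s \<mu>) V"
      unfolding e1_def e2_def n_def s_def by (intro smooth_on_linear[OF _ Xs V(1)] lin)+
    have dX: "partial_deriv 1 (\<lambda>p. X (\<mu>, p)) p = frame_act (\<Omega>1 (\<mu>, p)) (e1 \<mu> p, e2 \<mu> p, n \<mu> p, s \<mu> p)"
      "partial_deriv 2 (\<lambda>p. X (\<mu>, p)) p = frame_act (\<Omega>2 (\<mu>, p)) (e1 \<mu> p, e2 \<mu> p, n \<mu> p, s \<mu> p)" if "p \<in> V" for p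
      using X(3)[of "(\<mu>, p)" "axis 1 1"] X(3)[of "(\<mu>, p)" "axis 2 1"] \<mu> that ax
        partial_deriv_slice[OF smooth_on_differentiable[OF X(1)], of \<mu> p]
      by (simp_all add: \<Omega>_def axis_in_Basis_iff e1_def e2_def n_def s_def)
    have pd: "partial_deriv i (e1 \<mu>) p = fst (partial_deriv i (\<lambda>p. X (\<mu>, p)) p)"
      "partial_deriv i (e2 \<mu>) p = fst (snd (partial_deriv i (\<lambda>p. X (\<mu>, p)) p))"
      "partial_deriv i (n \<mu>) p = fst (snd (snd (partial_deriv i (\<lambda>p. X (\<mu>, p)) p)))"
      "partial_deriv i (s \<mu>) p = snd (snd (snd (partial_deriv i (\<lambda>p. X (\<mu>, p)) p)))" if "p \<in> V" for i p
      unfolding e1_def e2_def n_def s_def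
      by (intro partial_deriv_linear lin smooth_on_differentiable[OF Xs that])+
    define w m1 m2 where "w i p = (if i = 1 then - a (\<mu>, p) else b (\<mu>, p))"
      and "m1 i p = (if i = 1 then h1 (\<mu>, p) else 0)" and "m2 i p = (if i = 1 then 0 else h2 (\<mu>, p))"
      for i :: 2 and p
    have two: "i = 1 \<or> i = 2" for i :: 2 by (rule exhaust_2)
    have frame: "orthonormal3 (e1 \<mu> q) (e2 \<mu> q) (n \<mu> q)" "cross3 (e1 \<mu> q) (e2 \<mu> q) = \<sigma> *\<^sub>R n \<mu> q" if q: "q \<in> V" for q
    proof -
      note st = frame_stays_orthonormal[OF sm(1-3)[unfolded V_def], folded V_def, where w=w and ?m1.0=m1 and ?m2.0=m2 and \<sigma>=\<sigma>]
      have A: "partial_deriv i (e1 \<mu>) q = w i q *\<^sub>R e2 \<mu> q - m1 i q *\<^sub>R n \<mu> q"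
        "partial_deriv i (e2 \<mu>) q = - (w i q *\<^sub>R e1 \<mu> q) - m2 i q *\<^sub>R n \<mu> q"
        "partial_deriv i (n \<mu>) q = m1 i q *\<^sub>R e1 \<mu> q + m2 i q *\<^sub>R e2 \<mu> q" if "q \<in> V" for q i
        using two[of i]
        by (auto simp: pd[OF that] dX[OF that] \<Omega>1_def \<Omega>2_def frame_act_def w_def m1_def m2_def)
      have B: "orthonormal3 (e1 \<mu> p0) (e2 \<mu> p0) (n \<mu> p0)" "cross3 (e1 \<mu> p0) (e2 \<mu> p0) = \<sigma> *\<^sub>R n \<mu> p0"
        using X(2)[OF \<mu>] \<sigma>(1)
        by (simp_all add: e1_def e2_def n_def x0_def orthonormal3_def inner_axis_axis cross_basis)
      show "orthonormal3 (e1 \<mu> q) (e2 \<mu> q) (n \<mu> q)" "cross3 (e1 \<mu> q) (e2 \<mu> q) = \<sigma> *\<^sub>R n \<mu> q"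
        using st[OF A B q] by blast+
    qed
    have S: "partial_deriv 1 (n \<mu>) q = h1 (\<mu>, q) *\<^sub>R e1 \<mu> q" "partial_deriv 2 (n \<mu>) q = h2 (\<mu>, q) *\<^sub>R e2 \<mu> q"
      "partial_deriv 1 (s \<mu>) q = - ((k1 q * h1 (\<mu>, q)) *\<^sub>R e1 \<mu> q)"
      "partial_deriv 2 (s \<mu>) q = - ((k2 q * h2 (\<mu>, q)) *\<^sub>R e2 \<mu> q)" if "q \<in> V" for q
      by (simp_all add: pd[OF that] dX[OF that] \<Omega>1_def \<Omega>2_def frame_act_def c1_def c2_def)
    have hpos: "0 < h1 (\<mu>, q)" "0 < h2 (\<mu>, q)" if "q \<in> V" for q
      using HVpos[OF that] \<phi>pos[of "(\<mu>, q)"] \<mu> that by (auto simp: h1_def h2_def)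
    note surf = surface_of_frame[OF V(1) sm(4) hpos frame(1) S frame(2) orient]
    have "(h1 (\<mu>, q))\<^sup>2 = (H1 q / sqrt (\<mu> + f1 q))\<^sup>2" "(h2 (\<mu>, q))\<^sup>2 = (H2 q / sqrt (\<mu> + f2 q))\<^sup>2" for q
      by (simp_all add: h1_def h2_def \<phi>1_def \<phi>2_def)
    then show ?thesis
      using surf by simp
  qed
  have "smooth_on (\<lambda>(\<mu>, p). s \<mu> p) (L \<times> V)"
    using smooth_on_linear[OF lin(4) X(1) LV] by (simp add: s_def split_beta')
  moreover have "{\<mu>. \<forall>q\<in>U. 0 < \<mu> + f1 q \<and> 0 < \<mu> + f2 q} \<subseteq> L"
  proof
    fix \<mu> assume "\<mu> \<in> {\<mu>. \<forall>q\<in>U. 0 < \<mu> + f1 q \<and> 0 < \<mu> + f2 q}"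
    then have "0 < \<mu> + m" using m' by simp
    then show "\<mu> \<in> L" by (simp add: L_def)
  qed
  ultimately show ?thesis
    using V L surf by blast
qed

theorem mainTheorem4:
  fixes U :: "(real^2) set" and r :: "real^2 \<Rightarrow> real^3"
    and G11 G22 g11 g22 k1 k2 :: "real^2 \<Rightarrow> real"
    and \<eta>1 \<eta>2 :: "real \<Rightarrow> real"
  assumes surface: "regular_surface r U"
    and coords: "curvature_line_coords r U"
    and radii: "principal_radii r U k1 k2"
    and third: "\<forall>p\<in>U. third_form r p = diag_metric G11 G22 p"
    and g_smooth: "smooth_on g11 U" "smooth_on g22 U"
    and g_pos: "\<forall>p\<in>U. 0 < g11 p \<and> 0 < g22 p"
    and g_flat: "flat_on (diag_metric g11 g22) U"
    and eta_pos: "\<forall>p\<in>U. 0 < \<eta>1 (p $ 1) \<and> 0 < \<eta>2 (p $ 2)"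
    and G_g: "\<forall>p\<in>U. G11 p = g11 p / \<eta>1 (p $ 1) \<and> G22 p = g22 p / \<eta>2 (p $ 2)"
  shows "(\<forall>\<mu>\<in>admissible U \<eta>1 \<eta>2. \<forall>p\<in>U.
            gauss_curvature (deformed_metric g11 g22 \<eta>1 \<eta>2 \<mu>) p = 1) \<and>
         (\<forall>p0\<in>U. \<exists>V L (s :: real \<Rightarrow> real^2 \<Rightarrow> real^3).
            open V \<and> p0 \<in> V \<and> V \<subseteq> U \<and>
            open L \<and> admissible U \<eta>1 \<eta>2 \<subseteq> L \<and>
            smooth_on (\<lambda>(\<mu>, p). s \<mu> p) (L \<times> V) \<and>
            (\<forall>\<mu>\<in>admissible U \<eta>1 \<eta>2.
               regular_surface (s \<mu>) V \<and>
               curvature_line_coords (s \<mu>) V \<and>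
               (\<forall>p\<in>V. third_form (s \<mu>) p = deformed_metric g11 g22 \<eta>1 \<eta>2 \<mu> p) \<and>
               principal_radii (s \<mu>) V k1 k2 \<and>
               (\<forall>p\<in>V. weingarten (s \<mu>) p = weingarten r p)))"
proof -
  define n where "n = unit_normal r"
  define f1 f2 where "f1 = (\<lambda>q :: real^2. \<eta>1 (q $ 1))" and "f2 = (\<lambda>q :: real^2. \<eta>2 (q $ 2))"
  define H1 H2 where "H1 = (\<lambda>q. sqrt (g11 q))" and "H2 = (\<lambda>q. sqrt (g22 q))"
  define h1 h2 where "h1 = (\<lambda>q. H1 q / sqrt (0 + f1 q))" and "h2 = (\<lambda>q. H2 q / sqrt (0 + f2 q))"
  define e1 e2 where "e1 = (\<lambda>q. (1 / h1 q) *\<^sub>R partial_deriv 1 n q)" and "e2 = (\<lambda>q. (1 / h2 q) *\<^sub>R partial_deriv 2 n q)"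
  have U: "open U" by (rule surface_open[OF surface])
  have n: "smooth_on n U" unfolding n_def by (rule smooth_on_unit_normal[OF surface])
  have g: "0 < g11 q" "0 < g22 q" if "q \<in> U" for q using g_pos that by auto
  have fpos: "0 < f1 q" "0 < f2 q" if "q \<in> U" for q using eta_pos that by (auto simp: f1_def f2_def)
  have III: "partial_deriv 1 n q \<bullet> partial_deriv 1 n q = g11 q / f1 q"
    "partial_deriv 2 n q \<bullet> partial_deriv 2 n q = g22 q / f2 q"
    "partial_deriv 1 n q \<bullet> partial_deriv 2 n q = 0" if q: "q \<in> U" for q
  proof -
    have "third_form r q = diag_metric G11 G22 q" "G11 q = g11 q / f1 q" "G22 q = g22 q / f2 q"
      using third G_g q by (auto simp: f1_def f2_def)
    then show "partial_deriv 1 n q \<bullet> partial_deriv 1 n q = g11 q / f1 q"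
      "partial_deriv 2 n q \<bullet> partial_deriv 2 n q = g22 q / f2 q"
      "partial_deriv 1 n q \<bullet> partial_deriv 2 n q = 0"
      by (simp_all add: mat2_eq_iff third_form_def n_def)
  qed
  \<comment> \<open>\<open>\<eta>i = gii / Gii\<close> is smooth because \<open>Gii\<close> is the squared norm of a derivative of the normal.\<close>
  have f: "smooth_on f1 U" "smooth_on f2 U"
  proof -
    have pos: "partial_deriv i n q \<bullet> partial_deriv i n q \<noteq> 0" if "q \<in> U" for i q
      using III[OF that] g[OF that] fpos[OF that] exhaust_2[of i] by auto
    have "smooth_on (\<lambda>q. g11 q / (partial_deriv 1 n q \<bullet> partial_deriv 1 n q)) U"
      "smooth_on (\<lambda>q. g22 q / (partial_deriv 2 n q \<bullet> partial_deriv 2 n q)) U"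
      by (intro smooth_on_divide g_smooth smooth_on_inner smooth_on_partial_deriv n U pos; assumption)+
    moreover have "g11 q / (partial_deriv 1 n q \<bullet> partial_deriv 1 n q) = f1 q"
      "g22 q / (partial_deriv 2 n q \<bullet> partial_deriv 2 n q) = f2 q" if "q \<in> U" for q
      unfolding III[OF that] using g[OF that] by simp_all
    ultimately show "smooth_on f1 U" "smooth_on f2 U"
      using smooth_on_cong[OF U, of "\<lambda>q. g11 q / (partial_deriv 1 n q \<bullet> partial_deriv 1 n q)" f1]
        smooth_on_cong[OF U, of "\<lambda>q. g22 q / (partial_deriv 2 n q \<bullet> partial_deriv 2 n q)" f2] by blast+
  qed
  have f0: "partial_deriv 2 f1 q = 0" "partial_deriv 1 f2 q = 0" if "q \<in> U" for q
    using f[THEN smooth_on_differentiable, OF that]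
    by (auto simp: f1_def f2_def intro!: partial_deriv_other_coordinate)
  have H: "smooth_on H1 U" "smooth_on H2 U"
    unfolding H1_def H2_def by (intro smooth_on_sqrt g_smooth U g; assumption)+
  have Hpos: "0 < H1 q" "0 < H2 q" if "q \<in> U" for q
    using g[OF that] by (auto simp: H1_def H2_def)
  have Hsq: "(H1 q)\<^sup>2 = g11 q" "(H2 q)\<^sup>2 = g22 q" if "q \<in> U" for q
    using g[OF that] by (auto simp: H1_def H2_def)
  have fpos0: "0 < 0 + f1 q" "0 < 0 + f2 q" if "q \<in> U" for q
    using fpos[OF that] by simp_all
  note ctx = U H Hpos f f0
  have flat: "partial_deriv 1 (rot_coeff 1 H2 H1) q + partial_deriv 2 (rot_coeff 2 H1 H2) q = 0" if q: "q \<in> U" for q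
  proof -
    have "riemann (diag_metric g11 g22) 1 2 1 2 q = 0"
      using g_flat q by (simp add: flat_on_def)
    then show ?thesis
      using riemann_diag[of U H1 H2 g11 g22 q, OF U H Hpos _ _ q] Hsq Hpos[OF q] by simp
  qed
  have hpos: "0 < h1 q" "0 < h2 q" if "q \<in> U" for q
    using Hpos[OF that] fpos[OF that] by (auto simp: h1_def h2_def)
  have hs: "smooth_on h1 U" "smooth_on h2 U"
    unfolding h1_def h2_def using deform_smooth[OF ctx fpos0] by blast+
  have hsq: "h1 q * h1 q = g11 q / f1 q" "h2 q * h2 q = g22 q / f2 q" if "q \<in> U" for q
    using Hsq[OF that] fpos[OF that] by (simp_all add: h1_def h2_def power2_eq_square)
  have es: "smooth_on e1 U" "smooth_on e2 U"
    unfolding e1_def e2_def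
    by (intro smooth_on_scaleR smooth_on_divide smooth_on_const smooth_on_partial_deriv n hs U; use hpos in force)+
  have dn: "partial_deriv 1 n q = h1 q *\<^sub>R e1 q" "partial_deriv 2 n q = h2 q *\<^sub>R e2 q" if "q \<in> U" for q
    using hpos[OF that] by (simp_all add: e1_def e2_def)
  have onb: "orthonormal3 (e1 q) (e2 q) (n q)" if q: "q \<in> U" for q
  proof -
    have nn: "n q \<bullet> n q = 1" if "q \<in> U" for q
      unfolding n_def by (rule unit_normal_inner(1)[OF surface that])
    have "partial_deriv i n q \<bullet> n q = 0" for i
      using inner_deriv_const[OF n n U q nn, of i] by (simp add: inner_commute)
    moreover have "partial_deriv 1 n q \<bullet> partial_deriv 1 n q = h1 q * h1 q"
      "partial_deriv 2 n q \<bullet> partial_deriv 2 n q = h2 q * h2 q"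
      unfolding III[OF q] hsq[OF q] by (rule refl)+
    ultimately show ?thesis
      using III(3)[OF q] hpos[OF q] nn[OF q] by (simp add: orthonormal3_def e1_def e2_def)
  qed
  note frame = U es n hs hpos onb dn
  \<comment> \<open>The Gauss image lies on the unit sphere, so the defect vanishes at \<open>\<mu> = 0\<close>.\<close>
  have weighted: "weighted_defect H1 H2 f1 f2 q = 0" if q: "q \<in> U" for q
    using gauss_defect_deform[OF ctx fpos0 q] frame_gauss[OF frame q] by (simp add: h1_def h2_def)
  have k: "smooth_on k1 U" "smooth_on k2 U"
    using smooth_on_principal_radii[OF surface coords radii] .
  have k0: "k1 q \<noteq> 0" "k2 q \<noteq> 0" if "q \<in> U" for q
    using radii that by (auto simp: principal_radii_def)
  have codazzi: "partial_deriv 2 k1 q * H1 q = (k2 q - k1 q) * partial_deriv 2 H1 q"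
    "partial_deriv 1 k2 q * H2 q = (k1 q - k2 q) * partial_deriv 1 H2 q" if q: "q \<in> U" for q
    using frame_codazzi[OF frame q k surface_smooth[OF surface] rodrigues[OF surface coords radii, folded n_def]]
      deform_partial_H[OF ctx fpos0 q] fpos[OF q]
    by (simp_all add: h1_def h2_def)
  have adm: "admissible U \<eta>1 \<eta>2 = {\<mu>. \<forall>q\<in>U. 0 < \<mu> + f1 q \<and> 0 < \<mu> + f2 q}"
    by (simp add: admissible_def f1_def f2_def)
  have sq: "g11 q / (\<mu> + f1 q) = (H1 q / sqrt (\<mu> + f1 q))\<^sup>2" "g22 q / (\<mu> + f2 q) = (H2 q / sqrt (\<mu> + f2 q))\<^sup>2"
    if "\<mu> \<in> admissible U \<eta>1 \<eta>2" "q \<in> U" for \<mu> q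
    using that Hsq[of q] unfolding adm by (auto simp: power_divide less_imp_le)
  have deformed: "deformed_metric g11 g22 \<eta>1 \<eta>2 \<mu> =
      diag_metric (\<lambda>q. g11 q / (\<mu> + f1 q)) (\<lambda>q. g22 q / (\<mu> + f2 q))" for \<mu>
    by (simp add: deformed_metric_def f1_def f2_def)
  have curvature: "gauss_curvature (deformed_metric g11 g22 \<eta>1 \<eta>2 \<mu>) p = 1"
    if \<mu>: "\<mu> \<in> admissible U \<eta>1 \<eta>2" and p: "p \<in> U" for \<mu> p
  proof -
    have pos: "0 < \<mu> + f1 q" "0 < \<mu> + f2 q" if "q \<in> U" for q
      using \<mu> that by (auto simp: adm)
    have hpos: "0 < H1 q / sqrt (\<mu> + f1 q)" "0 < H2 q / sqrt (\<mu> + f2 q)" if "q \<in> U" for q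
      using Hpos[OF that] pos[OF that] by simp_all
    let ?h1 = "\<lambda>q. H1 q / sqrt (\<mu> + f1 q)" and ?h2 = "\<lambda>q. H2 q / sqrt (\<mu> + f2 q)"
    have "gauss_defect ?h1 ?h2 p = 0"
      by (rule gauss_defect_deform_zero[OF ctx pos p flat[OF p] weighted[OF p]])
    then have S: "- (partial_deriv 1 (rot_coeff 1 ?h2 ?h1) p + partial_deriv 2 (rot_coeff 2 ?h1 ?h2) p) = ?h1 p * ?h2 p"
      unfolding gauss_defect_def by linarith
    have "gauss_curvature (diag_metric (\<lambda>q. g11 q / (\<mu> + f1 q)) (\<lambda>q. g22 q / (\<mu> + f2 q))) p =
        - (partial_deriv 1 (rot_coeff 1 ?h2 ?h1) p + partial_deriv 2 (rot_coeff 2 ?h1 ?h2) p) / (?h1 p * ?h2 p)"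
      by (rule gauss_curvature_diag[OF U deform_smooth[OF ctx pos] hpos sq[OF \<mu>] p])
    also have "\<dots> = (?h1 p * ?h2 p) / (?h1 p * ?h2 p)"
      by (simp only: S)
    also have "\<dots> = 1"
      by (rule divide_self[OF mult_pos_pos[OF hpos(1)[OF p] hpos(2)[OF p], THEN less_imp_neq, symmetric]])
    finally show ?thesis
      unfolding deformed .
  qed
  have "\<exists>V L (s :: real \<Rightarrow> real^2 \<Rightarrow> real^3).
      open V \<and> p0 \<in> V \<and> V \<subseteq> U \<and> open L \<and> admissible U \<eta>1 \<eta>2 \<subseteq> L \<and>
      smooth_on (\<lambda>(\<mu>, p). s \<mu> p) (L \<times> V) \<and>
      (\<forall>\<mu>\<in>admissible U \<eta>1 \<eta>2. regular_surface (s \<mu>) V \<and> curvature_line_coords (s \<mu>) V \<and>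
         (\<forall>p\<in>V. third_form (s \<mu>) p = deformed_metric g11 g22 \<eta>1 \<eta>2 \<mu> p) \<and>
         principal_radii (s \<mu>) V k1 k2 \<and> (\<forall>p\<in>V. weingarten (s \<mu>) p = weingarten r p))"
    if p0: "p0 \<in> U" for p0
  proof -
    obtain V L and s :: "real \<Rightarrow> real^2 \<Rightarrow> real^3" where VL: "open V" "p0 \<in> V" "V \<subseteq> U" "open L"
        "admissible U \<eta>1 \<eta>2 \<subseteq> L" "smooth_on (\<lambda>(\<mu>, p). s \<mu> p) (L \<times> V)"
      and s: "\<And>\<mu>. \<mu> \<in> L \<Longrightarrow> regular_surface (s \<mu>) V" "\<And>\<mu>. \<mu> \<in> L \<Longrightarrow> curvature_line_coords (s \<mu>) V"
        "\<And>\<mu> p. \<mu> \<in> L \<Longrightarrow> p \<in> V \<Longrightarrow> third_form (s \<mu>) p =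
           diag_metric (\<lambda>q. (H1 q / sqrt (\<mu> + f1 q))\<^sup>2) (\<lambda>q. (H2 q / sqrt (\<mu> + f2 q))\<^sup>2) p"
        "\<And>\<mu>. \<mu> \<in> L \<Longrightarrow> principal_radii (s \<mu>) V k1 k2"
      using deformed_surfaces[OF U p0 H Hpos f f0 k k0 flat weighted codazzi] unfolding adm by blast
    have "third_form (s \<mu>) p = deformed_metric g11 g22 \<eta>1 \<eta>2 \<mu> p"
      if "\<mu> \<in> admissible U \<eta>1 \<eta>2" "p \<in> V" for \<mu> p
    proof -
      have "\<mu> \<in> L" "p \<in> U" using VL(3,5) that by auto
      then show ?thesis
        using s(3)[OF _ that(2)] sq[OF that(1)] by (simp add: deformed mat2_eq_iff)
    qed
    moreover have "weingarten (s \<mu>) p = weingarten r p" if "\<mu> \<in> admissible U \<eta>1 \<eta>2" "p \<in> V" for \<mu> p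
      using weingarten_eqI[OF radii s(4)[of \<mu>], of p] VL(3,5) that by blast
    ultimately show ?thesis
      using VL s(1,2,4) by (intro exI[of _ V] exI[of _ L] exI[of _ s]) blast
  qed
  then show ?thesis
    using curvature by blast
qed

end
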